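(* Let $(X,b,m)$ be a weighted graph, let $\theta$ be a magnetic potential on $(X,b)$ and let $v:X\to\mathbb{R}$ be an electric potential on $X$ such that $Q^{(c)}_{v,\theta}$ and $Q^{(c)}_{-\mathrm{deg},0}$ are semi-bounded from below and closable in $\ell^2(X,m)$. Then for all $t\geq 0$ and all $x,y\in X$ one has $$|\exp(-itL_{v,\theta})(x,y)|\leq \exp(-tL_{-\mathrm{deg},0})(x,y).$$
   Context: Weighted graph: $X$ is a countable set; $b:X\times X\to[0,\infty)$ is symmetric with $b(x,x)=0$ and $\sum_{y\in X}b(x,y)<\infty$ for all $x\in X$; $m:X\to(0,\infty)$ is any function, viewed as a measure via $m(A)=\sum_{x\in A}m(x)$. No local finiteness is assumed. Write $x\sim y$ if $b(x,y)>0$. The weighted degree is $\mathrm{deg}(x)=\frac1{m(x)}\sum_{y\in X}b(x,y)$. Potentials: a magnetic potential is a function $\theta:\{b>0\}\to\mathbb{R}$ with $\theta(x,y)=-\theta(y,x)$; an electric potential is any function $v:X\to\mathbb{R}$. Forms and operators: all function spaces are complex-valued, $i=\sqrt{-1}$, and $C_c(X)$ denotes the finitely supported functions on $X$. For $f,g\in C_c(X)$, $$Q^{(c)}_{v,\theta}(f,g)=\frac12\sum_{x\sim y}b(x,y)\big(f(x)-e^{i\theta(x,y)}f(y)\big)\overline{\big(g(x)-e^{i\theta(x,y)}g(y)\big)}+\sum_{x\in X}v(x)f(x)\overline{g(x)}m(x),$$ the first sum being over ordered pairs $(x,y)$ with $x\sim y$. If this form is bounded from below and closable in $\ell^2(X,m)$,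 its closure is $Q_{v,\theta}$ and $L_{v,\theta}$ is the associated self-adjoint operator. The form $Q^{(c)}_{-\mathrm{deg},0}$ and the operator $L_{-\mathrm{deg},0}$ are those with electric potential $-\mathrm{deg}$ and zero magnetic potential. The integral kernel of a bounded operator $A$ on $\ell^2(X,m)$ is the unique map $A(\cdot,\cdot):X\times X\to\mathbb{C}$ with $Af(x)=\sum_{y\in X}A(x,y)f(y)m(y)$ for all $f\in\ell^2(X,m)$, $x\in X$. *)

theory Defs
  imports "HOL-Analysis.Analysis"
begin

text \<open>
  The countable vertex set is a type \<open>'x :: countable\<close>. Magnetic potentials are total functions, but
  only their values on pairs with \<open>b x y > 0\<close> are constrained or used.
\<close>

definition weighted_graph ::
    "('x::countable \<Rightarrow> 'x \<Rightarrow> real) \<Rightarrow> ('x \<Rightarrow> real) \<Rightarrow> bool" where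
  "weighted_graph b m \<longleftrightarrow>
     (\<forall>x y. 0 \<le> b x y) \<and> (\<forall>x y. b x y = b y x) \<and> (\<forall>x. b x x = 0) \<and>
     (\<forall>x. (\<lambda>y. b x y) summable_on UNIV) \<and> (\<forall>x. 0 < m x)"

definition weighted_degree :: "('x \<Rightarrow> 'x \<Rightarrow> real) \<Rightarrow> ('x \<Rightarrow> real) \<Rightarrow> 'x \<Rightarrow> real" where
  "weighted_degree b m x = (\<Sum>\<^sub>\<infinity>y. b x y) / m x"

definition magnetic_potential :: "('x \<Rightarrow> 'x \<Rightarrow> real) \<Rightarrow> ('x \<Rightarrow> 'x \<Rightarrow> real) \<Rightarrow> bool" where
  "magnetic_potential b \<theta> \<longleftrightarrow> (\<forall>x y. b x y > 0 \<longrightarrow> \<theta> x y = - \<theta> y x)"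


section \<open>The Hilbert space of square summable functions\<close>

definition ell2 :: "('x \<Rightarrow> real) \<Rightarrow> ('x \<Rightarrow> complex) set" where
  "ell2 m = {f. (\<lambda>x. (cmod (f x))\<^sup>2 * m x) summable_on UNIV}"

definition ell2_norm :: "('x \<Rightarrow> real) \<Rightarrow> ('x \<Rightarrow> complex) \<Rightarrow> real" where
  "ell2_norm m f = sqrt (\<Sum>\<^sub>\<infinity>x. (cmod (f x))\<^sup>2 * m x)"

definition ell2_inner :: "('x \<Rightarrow> real) \<Rightarrow> ('x \<Rightarrow> complex) \<Rightarrow> ('x \<Rightarrow> complex) \<Rightarrow> complex" where
  "ell2_inner m f g = (\<Sum>\<^sub>\<infinity>x. f x * cnj (g x) * of_real (m x))"

definition finitely_supported :: "('x \<Rightarrow> complex) set" where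
  "finitely_supported = {f. finite {x. f x \<noteq> 0}}"


section \<open>Sesquilinear forms in the Hilbert space\<close>

type_synonym 'x form = "('x \<Rightarrow> complex) \<Rightarrow> ('x \<Rightarrow> complex) \<Rightarrow> complex"

definition semibounded_below :: "('x \<Rightarrow> real) \<Rightarrow> ('x \<Rightarrow> complex) set \<Rightarrow> 'x form \<Rightarrow> bool" where
  "semibounded_below m D q \<longleftrightarrow> (\<exists>C::real. \<forall>f\<in>D. C * (ell2_norm m f)\<^sup>2 \<le> Re (q f f))"

definition form_Cauchy :: "'x form \<Rightarrow> (nat \<Rightarrow> 'x \<Rightarrow> complex) \<Rightarrow> bool" where
  "form_Cauchy q F \<longleftrightarrow>
     (\<forall>e>0. \<exists>N. \<forall>j\<ge>N. \<forall>k\<ge>N. cmod (q (\<lambda>x. F j x - F k x) (\<lambda>x. F j x - F k x)) < e)"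

definition closable_form :: "('x \<Rightarrow> real) \<Rightarrow> ('x \<Rightarrow> complex) set \<Rightarrow> 'x form \<Rightarrow> bool" where
  "closable_form m D q \<longleftrightarrow>
     (\<forall>F. (\<forall>n. F n \<in> D) \<longrightarrow> form_Cauchy q F \<longrightarrow> (\<lambda>n. ell2_norm m (F n)) \<longlonglongrightarrow> 0 \<longrightarrow>
        (\<lambda>n. q (F n) (F n)) \<longlonglongrightarrow> 0)"

definition form_approximates ::
    "('x \<Rightarrow> real) \<Rightarrow> ('x \<Rightarrow> complex) set \<Rightarrow> 'x form \<Rightarrow> (nat \<Rightarrow> 'x \<Rightarrow> complex) \<Rightarrow>
     ('x \<Rightarrow> complex) \<Rightarrow> bool" where
  "form_approximates m D q F f \<longleftrightarrow>
     f \<in> ell2 m \<and> (\<forall>n. F n \<in> D) \<and> form_Cauchy q F \<and>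
     (\<lambda>n. ell2_norm m (\<lambda>x. F n x - f x)) \<longlonglongrightarrow> 0"

text \<open>Domain and values of the closure, meaningful for a semi-bounded closable form.\<close>

definition closure_domain ::
    "('x \<Rightarrow> real) \<Rightarrow> ('x \<Rightarrow> complex) set \<Rightarrow> 'x form \<Rightarrow> ('x \<Rightarrow> complex) set" where
  "closure_domain m D q = {f. \<exists>F. form_approximates m D q F f}"

definition closure_form ::
    "('x \<Rightarrow> real) \<Rightarrow> ('x \<Rightarrow> complex) set \<Rightarrow> 'x form \<Rightarrow> 'x form" where
  "closure_form m D q f g =
     (THE z. \<forall>F G. form_approximates m D q F f \<longrightarrow> form_approximates m D q G g \<longrightarrow>
        (\<lambda>n. q (F n) (G n)) \<longlonglongrightarrow> z)"

text \<open>Unbounded operators are represented by their graphs.\<close>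

type_synonym 'x operator = "(('x \<Rightarrow> complex) \<times> ('x \<Rightarrow> complex)) set"

definition form_operator ::
    "('x \<Rightarrow> real) \<Rightarrow> ('x \<Rightarrow> complex) set \<Rightarrow> 'x form \<Rightarrow> 'x operator" where
  "form_operator m D q =
     {(f, h). f \<in> D \<and> h \<in> ell2 m \<and> (\<forall>g\<in>D. q f g = ell2_inner m h g)}"


section \<open>Spectral calculus\<close>

definition orthogonal_projection ::
    "('x \<Rightarrow> real) \<Rightarrow> (('x \<Rightarrow> complex) \<Rightarrow> ('x \<Rightarrow> complex)) \<Rightarrow> bool" where
  "orthogonal_projection m P \<longleftrightarrow>
     (\<forall>f\<in>ell2 m. P f \<in> ell2 m) \<and>
     (\<forall>f\<in>ell2 m. \<forall>g\<in>ell2 m. \<forall>c d. P (\<lambda>x. c * f x + d * g x) = (\<lambda>x. c * P f x + d * P g x)) \<and>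
     (\<forall>f\<in>ell2 m. P (P f) = P f) \<and>
     (\<forall>f\<in>ell2 m. \<forall>g\<in>ell2 m. ell2_inner m (P f) g = ell2_inner m f (P g))"

text \<open>
  Values of \<open>E\<close> on sets that are not Borel, and of the projections outside \<^term>\<open>ell2 m\<close>, are
  irrelevant. Multiplicativity \<open>E (A \<inter> B) = E A \<circ> E B\<close> follows from the conditions below.
\<close>

definition projection_valued_measure ::
    "('x \<Rightarrow> real) \<Rightarrow> (real set \<Rightarrow> ('x \<Rightarrow> complex) \<Rightarrow> ('x \<Rightarrow> complex)) \<Rightarrow> bool" where
  "projection_valued_measure m E \<longleftrightarrow>
     (\<forall>B\<in>sets borel. orthogonal_projection m (E B)) \<and>
     (\<forall>f\<in>ell2 m. E UNIV f = f) \<and>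
     (\<forall>A :: nat \<Rightarrow> real set. (\<forall>n. A n \<in> sets borel) \<longrightarrow> disjoint_family A \<longrightarrow>
        (\<forall>f\<in>ell2 m. (\<lambda>N. ell2_norm m (\<lambda>x. E (\<Union>n. A n) f x - (\<Sum>n<N. E (A n) f x))) \<longlonglongrightarrow> 0))"

definition scalar_spectral_measure ::
    "('x \<Rightarrow> real) \<Rightarrow> (real set \<Rightarrow> ('x \<Rightarrow> complex) \<Rightarrow> ('x \<Rightarrow> complex)) \<Rightarrow>
     ('x \<Rightarrow> complex) \<Rightarrow> real measure" where
  "scalar_spectral_measure m E f =
     measure_of UNIV (sets borel) (\<lambda>B. ennreal (Re (ell2_inner m (E B f) f)))"

text \<open>
  The graph of the operator \<open>\<integral>\<phi> dE\<close>, for Borel \<open>\<phi>\<close>: its domain consists of the \<open>f\<close> with \<open>\<phi>\<close> square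
  integrable for the measure \<open>\<langle>E(\<cdot>)f, f\<rangle>\<close>. For \<open>f\<close>, \<open>g\<close> in this (dense) domain, the integral of \<open>\<phi>\<close>
  with respect to the complex measure \<open>\<langle>E(\<cdot>)f, g\<rangle>\<close> is given by the polarization identity.
\<close>

definition spectral_domain ::
    "('x \<Rightarrow> real) \<Rightarrow> (real set \<Rightarrow> ('x \<Rightarrow> complex) \<Rightarrow> ('x \<Rightarrow> complex)) \<Rightarrow>
     (real \<Rightarrow> complex) \<Rightarrow> ('x \<Rightarrow> complex) set" where
  "spectral_domain m E \<phi> =
     {f \<in> ell2 m. integrable (scalar_spectral_measure m E f) (\<lambda>s. (cmod (\<phi> s))\<^sup>2)}"

definition spectral_pairing ::
    "('x \<Rightarrow> real) \<Rightarrow> (real set \<Rightarrow> ('x \<Rightarrow> complex) \<Rightarrow> ('x \<Rightarrow> complex)) \<Rightarrow>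
     (real \<Rightarrow> complex) \<Rightarrow> 'x form" where
  "spectral_pairing m E \<phi> f g =
     (\<Sum>k<4. \<i> ^ k * (\<integral>s. \<phi> s \<partial>scalar_spectral_measure m E (\<lambda>x. f x + \<i> ^ k * g x))) / 4"

definition spectral_integral ::
    "('x \<Rightarrow> real) \<Rightarrow> (real set \<Rightarrow> ('x \<Rightarrow> complex) \<Rightarrow> ('x \<Rightarrow> complex)) \<Rightarrow>
     (real \<Rightarrow> complex) \<Rightarrow> 'x operator" where
  "spectral_integral m E \<phi> =
     {(f, h). f \<in> spectral_domain m E \<phi> \<and> h \<in> ell2 m \<and>
        (\<forall>g\<in>spectral_domain m E \<phi>. ell2_inner m h g = spectral_pairing m E \<phi> f g)}"

text \<open>
  By the spectral theorem a self-adjoint operator has a spectral measure, and it is unique on Borel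
  sets and on \<^term>\<open>ell2 m\<close>. Hence the choice made here is immaterial.
\<close>

definition spectral_measure ::
    "('x \<Rightarrow> real) \<Rightarrow> 'x operator \<Rightarrow> real set \<Rightarrow> ('x \<Rightarrow> complex) \<Rightarrow> ('x \<Rightarrow> complex)" where
  "spectral_measure m L =
     (SOME E. projection_valued_measure m E \<and> L = spectral_integral m E (\<lambda>s. of_real s))"

definition spectral_calculus ::
    "('x \<Rightarrow> real) \<Rightarrow> 'x operator \<Rightarrow> (real \<Rightarrow> complex) \<Rightarrow> ('x \<Rightarrow> complex) \<Rightarrow> ('x \<Rightarrow> complex)" where
  "spectral_calculus m L \<phi> f = (THE h. (f, h) \<in> spectral_integral m (spectral_measure m L) \<phi>)"

definition integral_kernel ::
    "('x \<Rightarrow> real) \<Rightarrow> (('x \<Rightarrow> complex) \<Rightarrow> ('x \<Rightarrow> complex)) \<Rightarrow> 'x \<Rightarrow> 'x \<Rightarrow> complex" where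
  "integral_kernel m A =
     (THE k. \<forall>f\<in>ell2 m. \<forall>x. ((\<lambda>y. k x y * f y * of_real (m y)) has_sum A f x) UNIV)"


section \<open>Magnetic Schroedinger operators\<close>

definition magnetic_form ::
    "('x \<Rightarrow> 'x \<Rightarrow> real) \<Rightarrow> ('x \<Rightarrow> real) \<Rightarrow> ('x \<Rightarrow> real) \<Rightarrow> ('x \<Rightarrow> 'x \<Rightarrow> real) \<Rightarrow> 'x form" where
  "magnetic_form b m v \<theta> f g =
     1 / 2 * (\<Sum>\<^sub>\<infinity>(x, y) \<in> {(x, y). b x y > 0}.
        of_real (b x y) * (f x - exp (\<i> * of_real (\<theta> x y)) * f y)
          * cnj (g x - exp (\<i> * of_real (\<theta> x y)) * g y))
     + (\<Sum>\<^sub>\<infinity>x. of_real (v x) * f x * cnj (g x) * of_real (m x))"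

definition magnetic_schroedinger ::
    "('x \<Rightarrow> 'x \<Rightarrow> real) \<Rightarrow> ('x \<Rightarrow> real) \<Rightarrow> ('x \<Rightarrow> real) \<Rightarrow> ('x \<Rightarrow> 'x \<Rightarrow> real) \<Rightarrow> 'x operator" where
  "magnetic_schroedinger b m v \<theta> =
     form_operator m
       (closure_domain m finitely_supported (magnetic_form b m v \<theta>))
       (closure_form m finitely_supported (magnetic_form b m v \<theta>))"

end

theory Submission
  imports Defs "HOL-Probability.Helly_Selection" "HOL-Probability.Characteristic_Functions"
begin

text \<open>
  Write \<open>L = L\<^bsub>v,\<theta>\<^esub>\<close> and \<open>L\<^sub>0 = L\<^bsub>-deg,0\<^esub>\<close>. With the potential \<open>- deg\<close> the diagonal of the form cancels and \<open>- L\<^sub>0\<close> is the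
  adjacency operator \<open>A\<close>, whereas \<open>L\<close> is a real multiplication operator minus \<open>A\<close> with its entries multiplied by
  phases. The comparison is made on resolvents. If \<open>(1 + i s L) u = f\<close> on a finite set of vertices, then taking
  absolute values at each vertex gives \<open>|u| - s A |u| \<le> |f|\<close>, since the real diagonal of \<open>L\<close> enters through a factor
  of modulus at least one. For small \<open>s > 0\<close> the matrix \<open>1 - s A = 1 + s L\<^sub>0\<close> is positive definite with nonpositive
  off-diagonal entries, so its inverse preserves positivity and \<open>|u| \<le> (1 + s L\<^sub>0)\<^sup>-\<^sup>1 |f|\<close> (\<open>M_matrix\<close>,
  \<open>finite_domination\<close>). The finite problems are the Galerkin approximations of the closed forms. Their solutions
  converge, strongly for \<open>L\<^sub>0\<close> and pointwise for \<open>L\<close>, so the inequality holds for the resolvents on the whole graph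
  (\<open>resolvent_domination\<close>). It can be iterated. With \<open>s = t / n\<close>, the powers \<open>(1 + i s L)\<^sup>-\<^sup>n\<close> and \<open>(1 + s L\<^sub>0)\<^sup>-\<^sup>n\<close> tend to
  \<open>exp (- i t L)\<close> and \<open>exp (- t L\<^sub>0)\<close> by dominated convergence in the functional calculus (\<open>exponential_domination\<close>).

  The functional calculus refers to a chosen spectral measure, so its existence has to be proved. The Galerkin
  approximations of \<open>R = (L + c)\<^sup>-\<^sup>1\<close> converge because they are projections of one another with respect to the form
  \<open>q + c\<close>; closability makes \<open>R\<close> injective and gives \<open>L = R\<^sup>-\<^sup>1 - c\<close> (\<open>L_eq\<close>). For large \<open>c\<close> one has \<open>0 \<le> R \<le> 1\<close>, so the
  numbers \<open>\<langle>R\<^sup>k (1 - R)\<^sup>l f, f\<rangle>\<close> are nonnegative, and by Hausdorff's theorem \<open>\<langle>R\<^sup>k f, f\<rangle>\<close> are the moments of a measure on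
  \<open>[0, 1]\<close> (\<open>Hausdorff_moment\<close>). Measures on \<open>[0, 1]\<close> are determined by their moments (\<open>moments_determine\<close>), and this
  uniqueness shows that the measures obtained come from a projection-valued measure. Its image under
  \<open>r \<mapsto> 1/r - c\<close> is a spectral measure of \<open>L\<close> (\<open>resolvent_spectral_measure\<close>). All properties of the calculus that are
  needed hold for any spectral measure of \<open>L\<close>.
\<close>

section \<open>Positive semidefinite sesquilinear forms\<close>

text \<open>Both the inner product of the Hilbert space and the forms \<open>q + c\<close> on the finitely supported functions are
  of this kind. The single combination \<open>f + c g\<close> covers sums, differences and multiples.\<close>

locale semi_inner =
  fixes V :: "('x \<Rightarrow> complex) set" and q :: "'x form"
  assumes zero_mem: "(\<lambda>_. 0) \<in> V"
    and lin_mem: "\<lbrakk>f \<in> V; g \<in> V\<rbrakk> \<Longrightarrow> (\<lambda>x. f x + c * g x) \<in> V"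
    and lin_left: "\<lbrakk>f \<in> V; g \<in> V; h \<in> V\<rbrakk> \<Longrightarrow> q (\<lambda>x. f x + c * g x) h = q f h + c * q g h"
    and herm: "\<lbrakk>f \<in> V; g \<in> V\<rbrakk> \<Longrightarrow> q g f = cnj (q f g)"
    and pos: "f \<in> V \<Longrightarrow> 0 \<le> Re (q f f)"
begin

definition seminorm :: "('x \<Rightarrow> complex) \<Rightarrow> real" where
  "seminorm f = sqrt (Re (q f f))"

lemma add_mem: "\<lbrakk>f \<in> V; g \<in> V\<rbrakk> \<Longrightarrow> (\<lambda>x. f x + g x) \<in> V"
  using lin_mem[of f g 1] by simp

lemma diff_mem: "\<lbrakk>f \<in> V; g \<in> V\<rbrakk> \<Longrightarrow> (\<lambda>x. f x - g x) \<in> V"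
  using lin_mem[of f g "-1"] by simp

lemma scale_mem: "f \<in> V \<Longrightarrow> (\<lambda>x. c * f x) \<in> V"
  using lin_mem[of "\<lambda>_. 0" f c] zero_mem by simp

lemma lincomb_mem: "\<lbrakk>f \<in> V; g \<in> V\<rbrakk> \<Longrightarrow> (\<lambda>x. c * f x + d * g x) \<in> V"
  using lin_mem[of "\<lambda>x. c * f x" g d] scale_mem by simp

lemma sum_mem: "(\<And>i. i \<in> I \<Longrightarrow> F i \<in> V) \<Longrightarrow> (\<lambda>x. \<Sum>i\<in>I. F i x) \<in> V"
  by (induction I rule: infinite_finite_induct) (auto simp: zero_mem add_mem)

lemmas mem = zero_mem lin_mem add_mem diff_mem scale_mem lincomb_mem

lemma add_left: "\<lbrakk>f \<in> V; g \<in> V; h \<in> V\<rbrakk> \<Longrightarrow> q (\<lambda>x. f x + g x) h = q f h + q g h"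
  using lin_left[of f g h 1] by simp

lemma diff_left: "\<lbrakk>f \<in> V; g \<in> V; h \<in> V\<rbrakk> \<Longrightarrow> q (\<lambda>x. f x - g x) h = q f h - q g h"
  using lin_left[of f g h "-1"] by simp

lemma zero_left [simp]: "h \<in> V \<Longrightarrow> q (\<lambda>_. 0) h = 0"
  using lin_left[of "\<lambda>_. 0" "\<lambda>_. 0" h 1] zero_mem by simp

lemma scale_left: "\<lbrakk>f \<in> V; h \<in> V\<rbrakk> \<Longrightarrow> q (\<lambda>x. c * f x) h = c * q f h"
  using lin_left[of "\<lambda>_. 0" f h c] zero_mem by simp

lemma lin_right: "\<lbrakk>f \<in> V; g \<in> V; h \<in> V\<rbrakk> \<Longrightarrow> q h (\<lambda>x. f x + c * g x) = q h f + cnj c * q h g"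
  using herm[of "\<lambda>x. f x + c * g x" h] herm[of f h] herm[of g h] by (simp add: mem lin_left)

lemma add_right: "\<lbrakk>f \<in> V; g \<in> V; h \<in> V\<rbrakk> \<Longrightarrow> q h (\<lambda>x. f x + g x) = q h f + q h g"
  using lin_right[of f g h 1] by simp

lemma diff_right: "\<lbrakk>f \<in> V; g \<in> V; h \<in> V\<rbrakk> \<Longrightarrow> q h (\<lambda>x. f x - g x) = q h f - q h g"
  using lin_right[of f g h "-1"] by simp

lemma zero_right [simp]: "h \<in> V \<Longrightarrow> q h (\<lambda>_. 0) = 0"
  using lin_right[of "\<lambda>_. 0" "\<lambda>_. 0" h 1] zero_mem by simp

lemma scale_right: "\<lbrakk>f \<in> V; h \<in> V\<rbrakk> \<Longrightarrow> q h (\<lambda>x. c * f x) = cnj c * q h f"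
  using lin_right[of "\<lambda>_. 0" f h c] zero_mem by simp

lemma sum_left:
  "(\<And>i. i \<in> I \<Longrightarrow> F i \<in> V) \<Longrightarrow> h \<in> V \<Longrightarrow> q (\<lambda>x. \<Sum>i\<in>I. F i x) h = (\<Sum>i\<in>I. q (F i) h)"
proof (induction I rule: infinite_finite_induct)
  case (insert i I)
  then show ?case
    using add_left[of "F i" "\<lambda>x. \<Sum>i\<in>I. F i x" h] sum_mem[of I F] by auto
qed auto

lemma self_real: "f \<in> V \<Longrightarrow> q f f = of_real (Re (q f f))"
  using herm[of f f] by (simp add: complex_eq_iff)

lemma seminorm_nonneg [simp]: "f \<in> V \<Longrightarrow> 0 \<le> seminorm f"
  by (simp add: seminorm_def pos)

lemma seminorm_sq: "f \<in> V \<Longrightarrow> (seminorm f)\<^sup>2 = Re (q f f)"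
  by (simp add: seminorm_def pos)

lemma self_eq: "f \<in> V \<Longrightarrow> q f f = of_real ((seminorm f)\<^sup>2)"
  using self_real seminorm_sq by simp

text \<open>If \<open>q g g\<close> vanishes, then \<open>Re (q (f + c g) (f + c g)) \<ge> 0\<close> is affine in \<open>c\<close> and forces
  \<open>q f g = 0\<close>; otherwise the minimizing \<open>c\<close> gives the inequality.\<close>

lemma Cauchy_Schwarz:
  assumes f: "f \<in> V" and g: "g \<in> V"
  shows "cmod (q f g) \<le> seminorm f * seminorm g"
proof -
  have exp: "0 \<le> Re (q f f) + 2 * Re (cnj c * q f g) + (cmod c)\<^sup>2 * Re (q g g)" for c
  proof -
    have "q (\<lambda>x. f x + c * g x) (\<lambda>x. f x + c * g x)
        = q f f + cnj c * q f g + (c * q g f + c * cnj c * q g g)"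
      using f g by (simp add: lin_left lin_right mem algebra_simps)
    also have "c * q g f = cnj (cnj c * q f g)"
      using herm[OF f g] by simp
    also have "q g g = of_real (Re (q g g))" using self_real g by blast
    also have "c * cnj c = of_real ((cmod c)\<^sup>2)" by (rule complex_norm_square[symmetric])
    finally have "Re (q (\<lambda>x. f x + c * g x) (\<lambda>x. f x + c * g x))
        = Re (q f f) + 2 * Re (cnj c * q f g) + (cmod c)\<^sup>2 * Re (q g g)"
      by simp
    then show ?thesis using pos[OF lin_mem[OF f g, of c]] by simp
  qed
  have sq: "(cmod (q f g))\<^sup>2 \<le> Re (q f f) * Re (q g g)"
  proof (cases "Re (q g g) = 0")
    case True
    have "q f g = 0"
    proof (rule ccontr)
      assume nz: "q f g \<noteq> 0"
      define r where "r = (Re (q f f) + 1) / (cmod (q f g))\<^sup>2"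
      have "cnj (- of_real r * q f g) * q f g = - of_real (r * (cmod (q f g))\<^sup>2)"
        by (simp only: complex_norm_square of_real_mult) (simp add: mult_ac)
      also have "r * (cmod (q f g))\<^sup>2 = Re (q f f) + 1" using nz by (simp add: r_def)
      finally have "Re (cnj (- of_real r * q f g) * q f g) = - (Re (q f f) + 1)" by simp
      then show False using exp[of "- of_real r * q f g"] True pos[OF f] by simp
    qed
    then show ?thesis using True by simp
  next
    case False
    then have p: "Re (q g g) > 0" using pos[OF g] by simp
    define r where "r = 1 / Re (q g g)"
    define z where "z = q f g"
    have "cnj (- of_real r * z) * z = - of_real (r * (cmod z)\<^sup>2)"
      by (simp only: complex_norm_square of_real_mult) (simp add: mult_ac)
    then have "Re (cnj (- of_real r * z) * z) = - (r * (cmod z)\<^sup>2)"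
      by (simp only: Re_complex_of_real uminus_complex.sel)
    then have "0 \<le> Re (q f f) - 2 * (r * (cmod z)\<^sup>2) + (cmod (- of_real r * z))\<^sup>2 * Re (q g g)"
      using exp[of "- of_real r * z"] unfolding z_def[symmetric] by linarith
    also have "(cmod (- of_real r * z))\<^sup>2 * Re (q g g) = r * (cmod z)\<^sup>2"
      using p by (simp add: norm_mult norm_divide power_mult_distrib r_def power2_eq_square)
    finally have "r * (cmod z)\<^sup>2 \<le> Re (q f f)" by simp
    then show ?thesis using p by (simp add: r_def z_def field_simps)
  qed
  have "cmod (q f g) = sqrt ((cmod (q f g))\<^sup>2)" by simp
  also have "\<dots> \<le> sqrt (Re (q f f) * Re (q g g))" using sq by (rule real_sqrt_le_mono)
  finally show ?thesis by (simp add: seminorm_def real_sqrt_mult)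
qed

lemma seminorm_add:
  assumes f: "f \<in> V" and g: "g \<in> V"
  shows "seminorm (\<lambda>x. f x + g x) \<le> seminorm f + seminorm g"
proof (rule power2_le_imp_le)
  have "Re (q (\<lambda>x. f x + g x) (\<lambda>x. f x + g x)) = Re (q f f) + Re (q g g) + 2 * Re (q f g)"
    using f g herm[OF f g] by (simp add: add_left add_right mem)
  also have "Re (q f g) \<le> seminorm f * seminorm g"
    using Cauchy_Schwarz[OF f g] complex_Re_le_cmod order_trans by blast
  finally show "(seminorm (\<lambda>x. f x + g x))\<^sup>2 \<le> (seminorm f + seminorm g)\<^sup>2"
    using f g by (simp add: seminorm_sq mem power2_sum)
qed (use f g in simp)

lemma seminorm_scale: "f \<in> V \<Longrightarrow> seminorm (\<lambda>x. c * f x) = cmod c * seminorm f"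
proof -
  assume f: "f \<in> V"
  have "q (\<lambda>x. c * f x) (\<lambda>x. c * f x) = of_real ((cmod c)\<^sup>2) * q f f"
    using f by (simp add: scale_left scale_right mem complex_norm_square del: of_real_power)
  then show ?thesis by (simp add: seminorm_def real_sqrt_mult)
qed

lemma seminorm_diff_commute:
  assumes "f \<in> V" "g \<in> V" shows "seminorm (\<lambda>x. f x - g x) = seminorm (\<lambda>x. g x - f x)"
  using seminorm_scale[OF diff_mem[OF assms], of "-1"] by simp

lemma seminorm_triangle:
  assumes "f \<in> V" "g \<in> V" "h \<in> V"
  shows "seminorm (\<lambda>x. f x - h x) \<le> seminorm (\<lambda>x. f x - g x) + seminorm (\<lambda>x. g x - h x)"
  using seminorm_add[of "\<lambda>x. f x - g x" "\<lambda>x. g x - h x"] assms by (simp add: mem)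

lemma seminorm_le_diff:
  assumes "f \<in> V" "g \<in> V"
  shows "seminorm f \<le> seminorm g + seminorm (\<lambda>x. f x - g x)"
  using seminorm_add[of g "\<lambda>x. f x - g x"] assms by (simp add: mem)

text \<open>Seminorm convergence in both arguments implies convergence of the form; with the second argument
  constant this gives weak convergence.\<close>

lemma tendsto_form:
  assumes F: "\<And>n. F n \<in> V" "f \<in> V" "(\<lambda>n. seminorm (\<lambda>x. F n x - f x)) \<longlonglongrightarrow> 0"
    and G: "\<And>n. G n \<in> V" "g \<in> V" "(\<lambda>n. seminorm (\<lambda>x. G n x - g x)) \<longlonglongrightarrow> 0"
  shows "(\<lambda>n. q (F n) (G n)) \<longlonglongrightarrow> q f g"
proof -
  let ?a = "\<lambda>n. seminorm (\<lambda>x. F n x - f x)" and ?b = "\<lambda>n. seminorm (\<lambda>x. G n x - g x)"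
  have "(\<lambda>n. ?a n * (seminorm g + ?b n) + seminorm f * ?b n) \<longlonglongrightarrow> 0 * (seminorm g + 0) + seminorm f * 0"
    by (intro tendsto_intros F G)
  then have lim: "(\<lambda>n. ?a n * (seminorm g + ?b n) + seminorm f * ?b n) \<longlonglongrightarrow> 0" by simp
  have "cmod (q (F n) (G n) - q f g) \<le> ?a n * (seminorm g + ?b n) + seminorm f * ?b n" for n
  proof -
    have "q (F n) (G n) - q f g = q (\<lambda>x. F n x - f x) (G n) + q f (\<lambda>x. G n x - g x)"
      using F G by (simp add: diff_left diff_right mem)
    also have "cmod \<dots> \<le> cmod (q (\<lambda>x. F n x - f x) (G n)) + cmod (q f (\<lambda>x. G n x - g x))"
      by (rule norm_triangle_ineq)
    also have "cmod (q (\<lambda>x. F n x - f x) (G n)) \<le> ?a n * seminorm (G n)"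
      using F G by (intro Cauchy_Schwarz mem)
    also have "cmod (q f (\<lambda>x. G n x - g x)) \<le> seminorm f * ?b n"
      using F G by (intro Cauchy_Schwarz mem)
    also have "?a n * seminorm (G n) \<le> ?a n * (seminorm g + ?b n)"
      using F G by (intro mult_left_mono seminorm_le_diff) (auto simp: mem)
    finally show ?thesis by simp
  qed
  then have "(\<lambda>n. q (F n) (G n) - q f g) \<longlonglongrightarrow> 0"
    by (intro Lim_null_comparison[OF _ lim]) auto
  then show ?thesis by (simp add: LIM_zero_iff)
qed

lemma seminorm_tendsto:
  assumes F: "\<And>n. F n \<in> V" "f \<in> V" "(\<lambda>n. seminorm (\<lambda>x. F n x - f x)) \<longlonglongrightarrow> 0"
  shows "(\<lambda>n. seminorm (F n)) \<longlonglongrightarrow> seminorm f"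
  unfolding seminorm_def by (intro tendsto_intros tendsto_form F)

lemma polarization:
  assumes f: "f \<in> V" and g: "g \<in> V"
  shows "q f g = (\<Sum>k<4. \<i> ^ k * q (\<lambda>x. f x + \<i> ^ k * g x) (\<lambda>x. f x + \<i> ^ k * g x)) / 4"
proof -
  have q: "q (\<lambda>x. f x + c * g x) (\<lambda>x. f x + c * g x)
      = q f f + cnj c * q f g + (c * q g f + c * cnj c * q g g)" for c
    using f g by (simp add: lin_left lin_right mem algebra_simps)
  show ?thesis
    unfolding q by (simp add: eval_nat_numeral algebra_simps)
qed

end

section \<open>The Hilbert space\<close>

definition delta :: "'x \<Rightarrow> 'x \<Rightarrow> complex" where
  "delta x = (\<lambda>y. if y = x then 1 else 0)"

locale weights =
  fixes m :: "'x \<Rightarrow> real"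
  assumes m_pos: "0 < m x"
begin

lemma m_nonneg [simp]: "0 \<le> m x" and m_nz [simp]: "m x \<noteq> 0"
  using m_pos[of x] by auto

lemma ell2_lin:
  assumes "f \<in> ell2 m" "g \<in> ell2 m" shows "(\<lambda>x. f x + c * g x) \<in> ell2 m"
proof -
  have "(\<lambda>x. 2 * ((cmod (f x))\<^sup>2 * m x) + 2 * (cmod c)\<^sup>2 * ((cmod (g x))\<^sup>2 * m x)) summable_on UNIV"
    using assms by (intro summable_on_add summable_on_cmult_right) (auto simp: ell2_def)
  then show ?thesis unfolding ell2_def mem_Collect_eq
  proof (rule summable_on_comparison_test)
    fix x
    have "(cmod (f x + c * g x))\<^sup>2 \<le> (cmod (f x) + cmod c * cmod (g x))\<^sup>2"
      by (metis norm_ge_zero norm_mult norm_triangle_ineq power_mono)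
    also have "\<dots> \<le> 2 * (cmod (f x))\<^sup>2 + 2 * (cmod c)\<^sup>2 * (cmod (g x))\<^sup>2"
      using sum_squares_ge_zero[of "cmod (f x) - cmod c * cmod (g x)" 0]
      by (simp add: power2_eq_square algebra_simps)
    finally show "(cmod (f x + c * g x))\<^sup>2 * m x
        \<le> 2 * ((cmod (f x))\<^sup>2 * m x) + 2 * (cmod c)\<^sup>2 * ((cmod (g x))\<^sup>2 * m x)"
      by (metis (no_types, lifting) distrib_right m_nonneg mult.assoc mult_right_mono)
  qed auto
qed

lemma ell2_inner_abs_summable:
  assumes "f \<in> ell2 m" "g \<in> ell2 m"
  shows "(\<lambda>x. norm (f x * cnj (g x) * of_real (m x))) summable_on UNIV"
proof -
  have "(\<lambda>x. (cmod (f x))\<^sup>2 * m x + (cmod (g x))\<^sup>2 * m x) summable_on UNIV"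
    using assms by (intro summable_on_add) (auto simp: ell2_def)
  then show ?thesis
  proof (rule summable_on_comparison_test)
    fix x
    have "cmod (f x) * cmod (g x) \<le> (cmod (f x))\<^sup>2 + (cmod (g x))\<^sup>2"
      using sum_squares_bound[of "cmod (f x)" "cmod (g x)"] mult_nonneg_nonneg[OF norm_ge_zero norm_ge_zero, of "f x" "g x"]
      by linarith
    then show "norm (f x * cnj (g x) * of_real (m x)) \<le> (cmod (f x))\<^sup>2 * m x + (cmod (g x))\<^sup>2 * m x"
      by (simp add: norm_mult distrib_right[symmetric] mult_right_mono)
  qed auto
qed

lemma ell2_inner_summable:
  assumes "f \<in> ell2 m" "g \<in> ell2 m"
  shows "(\<lambda>x. f x * cnj (g x) * of_real (m x)) summable_on UNIV"
  by (rule abs_summable_summable[OF ell2_inner_abs_summable[OF assms]])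

lemma ell2_inner_self:
  "ell2_inner m f f = of_real (\<Sum>\<^sub>\<infinity>x. (cmod (f x))\<^sup>2 * m x)"
proof -
  have "ell2_inner m f f = (\<Sum>\<^sub>\<infinity>x. of_real ((cmod (f x))\<^sup>2 * m x))"
    unfolding ell2_inner_def
    by (intro infsum_cong) (simp only: complex_norm_square of_real_mult)
  also have "\<dots> = of_real (\<Sum>\<^sub>\<infinity>x. (cmod (f x))\<^sup>2 * m x)"
  proof (rule infsum_bounded_linear_strong[where h = complex_of_real])
    show "(\<lambda>x. complex_of_real ((cmod (f x))\<^sup>2 * m x)) summable_on UNIV
        \<longleftrightarrow> (\<lambda>x. (cmod (f x))\<^sup>2 * m x) summable_on UNIV"
      by (metis (no_types, lifting) Re_complex_of_real summable_on_Re summable_on_cong summable_on_of_real)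
  qed (rule bounded_linear_of_real)
  finally show ?thesis .
qed

sublocale semi_inner "ell2 m" "ell2_inner m"
proof
  show "(\<lambda>_. 0) \<in> ell2 m" by (simp add: ell2_def)
  show "(\<lambda>x. f x + c * g x) \<in> ell2 m" if "f \<in> ell2 m" "g \<in> ell2 m" for f g c
    using that by (rule ell2_lin)
  show "ell2_inner m (\<lambda>x. f x + c * g x) h = ell2_inner m f h + c * ell2_inner m g h"
    if "f \<in> ell2 m" "g \<in> ell2 m" "h \<in> ell2 m" for f g h c
  proof -
    have "ell2_inner m (\<lambda>x. f x + c * g x) h
        = (\<Sum>\<^sub>\<infinity>x. f x * cnj (h x) * of_real (m x) + c * (g x * cnj (h x) * of_real (m x)))"
      unfolding ell2_inner_def by (intro infsum_cong) (simp add: algebra_simps)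
    also have "\<dots> = ell2_inner m f h + (\<Sum>\<^sub>\<infinity>x. c * (g x * cnj (h x) * of_real (m x)))"
      unfolding ell2_inner_def using that
      by (intro infsum_add summable_on_cmult_right ell2_inner_summable)
    finally show ?thesis by (simp add: ell2_inner_def infsum_cmult_right')
  qed
  show "ell2_inner m g f = cnj (ell2_inner m f g)" for f g
    unfolding ell2_inner_def by (subst infsum_cnj[symmetric]) (simp add: mult.commute)
  show "0 \<le> Re (ell2_inner m f f)" for f
    unfolding ell2_inner_self by (simp add: infsum_nonneg)
qed

lemma seminorm_eq [simp]: "seminorm f = ell2_norm m f"
  unfolding seminorm_def ell2_inner_self ell2_norm_def by simp

lemma norm_nonneg [simp]: "0 \<le> ell2_norm m f"
  by (simp add: ell2_norm_def infsum_nonneg)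

lemma norm_sq: "f \<in> ell2 m \<Longrightarrow> (ell2_norm m f)\<^sup>2 = Re (ell2_inner m f f)"
  using seminorm_sq by simp

lemma inner_self: "f \<in> ell2 m \<Longrightarrow> ell2_inner m f f = of_real ((ell2_norm m f)\<^sup>2)"
  using self_eq by simp

lemmas CS = Cauchy_Schwarz[unfolded seminorm_eq]
lemmas norm_add = seminorm_add[unfolded seminorm_eq]
lemmas norm_scale = seminorm_scale[unfolded seminorm_eq]
lemmas norm_diff_commute = seminorm_diff_commute[unfolded seminorm_eq]
lemmas norm_triangle = seminorm_triangle[unfolded seminorm_eq]
lemmas tendsto_inner = tendsto_form[unfolded seminorm_eq]
lemmas tendsto_ell2_norm = seminorm_tendsto[unfolded seminorm_eq]

lemma finitely_supported_ell2: "f \<in> finitely_supported \<Longrightarrow> f \<in> ell2 m"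
proof -
  assume "f \<in> finitely_supported"
  then have "finite {x. (cmod (f x))\<^sup>2 * m x \<noteq> 0}" by (simp add: finitely_supported_def)
  then show ?thesis unfolding ell2_def mem_Collect_eq
    by (intro finite_nonzero_values_imp_summable_on) simp
qed

lemma delta_fs [simp]: "delta x \<in> finitely_supported"
  by (simp add: finitely_supported_def delta_def)

lemma delta_ell2 [simp]: "delta x \<in> ell2 m"
  by (simp add: finitely_supported_ell2)

lemma inner_finite_right:
  assumes "finite S" "\<And>x. x \<notin> S \<Longrightarrow> g x = 0"
  shows "ell2_inner m f g = (\<Sum>x\<in>S. f x * cnj (g x) * of_real (m x))"
proof -
  have "ell2_inner m f g = infsum (\<lambda>x. f x * cnj (g x) * of_real (m x)) S"
    unfolding ell2_inner_def using assms by (intro infsum_cong_neutral) auto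
  then show ?thesis using assms by simp
qed

lemma inner_delta [simp]: "ell2_inner m f (delta x) = f x * of_real (m x)"
  by (subst inner_finite_right[of "{x}"]) (auto simp: delta_def)

lemma coordinate_bound:
  assumes "f \<in> ell2 m" shows "(cmod (f x))\<^sup>2 * m x \<le> (ell2_norm m f)\<^sup>2"
proof -
  have "(\<Sum>x\<in>{x}. (cmod (f x))\<^sup>2 * m x) \<le> (\<Sum>\<^sub>\<infinity>x. (cmod (f x))\<^sup>2 * m x)"
    using assms by (intro finite_sum_le_infsum) (auto simp: ell2_def)
  then show ?thesis by (simp add: ell2_norm_def infsum_nonneg)
qed

lemma norm_zero_imp: "f \<in> ell2 m \<Longrightarrow> ell2_norm m f = 0 \<Longrightarrow> f = (\<lambda>_. 0)"
proof
  fix x assume "f \<in> ell2 m" "ell2_norm m f = 0"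
  then have "(cmod (f x))\<^sup>2 * m x \<le> 0" using coordinate_bound[of f x] by simp
  then have "(cmod (f x))\<^sup>2 \<le> 0" using m_pos[of x] by (simp add: mult_le_0_iff)
  then show "f x = 0" by simp
qed

lemma eq_by_delta: "(\<And>x. ell2_inner m f (delta x) = ell2_inner m g (delta x)) \<Longrightarrow> f = g"
  by (auto simp: fun_eq_iff)

lemma norm_le_imp_ell2:
  assumes "\<And>S. finite S \<Longrightarrow> (\<Sum>x\<in>S. (cmod (f x))\<^sup>2 * m x) \<le> C\<^sup>2" "0 \<le> C"
  shows "f \<in> ell2 m" "ell2_norm m f \<le> C"
proof -
  show f: "f \<in> ell2 m" unfolding ell2_def mem_Collect_eq
    by (rule nonneg_bounded_partial_sums_imp_summable_on[of UNIV _ "C\<^sup>2"])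
       (use assms in \<open>auto simp: eventually_finite_subsets_at_top_finite\<close>)
  have "(\<Sum>\<^sub>\<infinity>x. (cmod (f x))\<^sup>2 * m x) \<le> C\<^sup>2"
    using f assms by (intro infsum_le_finite_sums) (auto simp: ell2_def)
  then show "ell2_norm m f \<le> C"
    unfolding ell2_norm_def using assms(2) real_le_lsqrt by (simp add: real_sqrt_le_iff real_le_lsqrt)
qed

lemma norm_finite:
  assumes "finite S" "\<And>x. x \<notin> S \<Longrightarrow> g x = 0"
  shows "(ell2_norm m g)\<^sup>2 = (\<Sum>x\<in>S. (cmod (g x))\<^sup>2 * m x)"
proof -
  have "(\<Sum>\<^sub>\<infinity>x. (cmod (g x))\<^sup>2 * m x) = infsum (\<lambda>x. (cmod (g x))\<^sup>2 * m x) S"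
    using assms by (intro infsum_cong_neutral) auto
  then show ?thesis using assms by (simp add: ell2_norm_def sum_nonneg)
qed

lemma fs_approx:
  assumes f: "f \<in> ell2 m" and e: "e > 0"
  obtains g where "g \<in> finitely_supported" "ell2_norm m (\<lambda>x. f x - g x) \<le> e" 
proof -
  let ?w = "\<lambda>x. (cmod (f x))\<^sup>2 * m x"
  have sm: "?w summable_on UNIV" using f by (simp add: ell2_def)
  have "\<exists>S. finite S \<and> S \<subseteq> UNIV \<and> dist (sum ?w S) (infsum ?w UNIV) \<le> e\<^sup>2"
    by (rule infsum_finite_approximation[OF sm]) (use e in auto)
  then obtain S where S: "finite S" "dist (sum ?w S) (infsum ?w UNIV) \<le> e\<^sup>2" by auto
  define g where "g = (\<lambda>x. if x \<in> S then f x else 0)"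
  have g: "g \<in> finitely_supported"
    using S(1) by (auto simp: finitely_supported_def g_def intro: finite_subset[of _ S])
  have "(\<Sum>x\<in>T. (cmod (f x - g x))\<^sup>2 * m x) \<le> e\<^sup>2" if T: "finite T" for T
  proof -
    have "(\<Sum>x\<in>T. (cmod (f x - g x))\<^sup>2 * m x) = (\<Sum>x\<in>T - S. ?w x)"
      using T by (intro sum.mono_neutral_cong_right) (auto simp: g_def)
    also have "\<dots> = sum ?w (S \<union> T) - sum ?w S"
      using S T by (subst sum_diff[symmetric]) (auto intro!: sum.cong)
    also have "\<dots> \<le> infsum ?w UNIV - sum ?w S"
      using S T sm by (simp add: finite_sum_le_infsum)
    also have "\<dots> \<le> e\<^sup>2" using S(2) by (simp add: dist_real_def)
    finally show ?thesis .
  qed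
  then have "ell2_norm m (\<lambda>x. f x - g x) \<le> e" using e by (intro norm_le_imp_ell2(2)) auto
  then show ?thesis using g that by blast
qed

lemma finite_support_sum:
  assumes "finite S" "\<And>x. x \<notin> S \<Longrightarrow> g x = 0"
  shows "g = (\<lambda>y. \<Sum>x\<in>S. g x * delta x y)"
proof
  fix y show "g y = (\<Sum>x\<in>S. g x * delta x y)"
    using assms by (cases "y \<in> S") (auto simp: delta_def if_distrib cong: if_cong)
qed

text \<open>The representing vector is read off from the values on the point masses; testing with its own
  restrictions to finite sets shows that it is square summable.\<close>

lemma Riesz:
  fixes B :: "('x \<Rightarrow> complex) \<Rightarrow> complex"
  assumes bdd: "\<And>g. g \<in> ell2 m \<Longrightarrow> cmod (B g) \<le> M * ell2_norm m g" and M: "0 \<le> M"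
    and add: "\<And>c g g'. g \<in> ell2 m \<Longrightarrow> g' \<in> ell2 m \<Longrightarrow> B (\<lambda>x. g x + c * g' x) = B g + cnj c * B g'"
  defines "h \<equiv> (\<lambda>x. B (delta x) / of_real (m x))"
  shows "h \<in> ell2 m" "ell2_norm m h \<le> M" "g \<in> ell2 m \<Longrightarrow> ell2_inner m h g = B g"
proof -
  have B0: "B (\<lambda>_. 0) = 0" using add[of "\<lambda>_. 0" "\<lambda>_. 0" 1] zero_mem by simp
  have Bsum: "B (\<lambda>y. \<Sum>x\<in>S. g x * delta x y) = (\<Sum>x\<in>S. cnj (g x) * B (delta x))" if "finite S" for S g
    using that
  proof induction
    case (insert x S)
    have "(\<lambda>y. \<Sum>x\<in>S. g x * delta x y) \<in> ell2 m"
      by (intro sum_mem scale_mem delta_ell2)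
    then show ?case using insert add[of "\<lambda>y. \<Sum>x\<in>S. g x * delta x y" "delta x" "g x"]
      by (simp add: add.commute)
  qed (simp add: B0)
  have fin: "B g = ell2_inner m h g" if S: "finite S" "\<And>x. x \<notin> S \<Longrightarrow> g x = 0" for S g
  proof -
    have "B g = (\<Sum>x\<in>S. cnj (g x) * B (delta x))"
      using Bsum[OF S(1), of g] finite_support_sum[OF S] by simp
    then show ?thesis using inner_finite_right[OF S, where f = h] by (simp add: h_def mult.commute)
  qed
  have bd: "(\<Sum>x\<in>S. (cmod (h x))\<^sup>2 * m x) \<le> M\<^sup>2" if S: "finite S" for S
  proof -
    define g where "g = (\<lambda>x. if x \<in> S then h x else 0)"
    have g0: "\<And>x. x \<notin> S \<Longrightarrow> g x = 0" by (simp add: g_def)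
    have g2: "g \<in> ell2 m"
      using S by (intro finitely_supported_ell2)
        (auto simp: finitely_supported_def g_def intro: finite_subset[of _ S])
    have n: "(ell2_norm m g)\<^sup>2 = (\<Sum>x\<in>S. (cmod (h x))\<^sup>2 * m x)"
      by (subst norm_finite[OF S g0]) (auto simp: g_def)
    have "B g = (\<Sum>x\<in>S. of_real ((cmod (h x))\<^sup>2 * m x))"
      by (subst fin[OF S g0], assumption, subst inner_finite_right[OF S g0], assumption, intro sum.cong)
         (auto simp only: g_def complex_norm_square of_real_mult if_True)
    then have "B g = of_real ((ell2_norm m g)\<^sup>2)" using n by simp
    then have "(ell2_norm m g)\<^sup>2 \<le> M * ell2_norm m g" using bdd[OF g2] by (simp add: norm_power)
    then have "ell2_norm m g \<le> M" using M
      by (cases "ell2_norm m g = 0") (auto simp: power2_eq_square dest: mult_right_le_imp_le)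
    then show ?thesis unfolding n[symmetric] by (intro power_mono) auto
  qed
  show h: "h \<in> ell2 m" "ell2_norm m h \<le> M" using norm_le_imp_ell2[OF bd M] by auto
  show "ell2_inner m h g = B g" if g: "g \<in> ell2 m"
  proof -
    have le: "cmod (ell2_inner m h g - B g) \<le> 2 * M * e" if e: "e > 0" for e
    proof -
      obtain k where k: "k \<in> finitely_supported" "ell2_norm m (\<lambda>x. g x - k x) \<le> e"
        using fs_approx[OF g e] by blast
      have k2: "k \<in> ell2 m" using k finitely_supported_ell2 by blast
      define d where "d = (\<lambda>x. g x - k x)"
      have d: "d \<in> ell2 m" unfolding d_def using g k2 by (rule diff_mem)
      have gd: "g = (\<lambda>x. k x + 1 * d x)" by (simp add: d_def)
      have "B k = ell2_inner m h k"
        using k by (intro fin[of "{x. k x \<noteq> 0}"]) (auto simp: finitely_supported_def)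
      then have "ell2_inner m h g - B g = ell2_inner m h d - B d"
        unfolding gd using add[OF k2 d, of 1] lin_right[OF k2 d h(1), of 1] by simp
      also have "cmod \<dots> \<le> ell2_norm m h * ell2_norm m d + M * ell2_norm m d"
        by (rule order_trans[OF norm_triangle_ineq4 add_mono[OF CS[OF h(1) d] bdd[OF d]]])
      also have "\<dots> \<le> M * ell2_norm m d + M * ell2_norm m d"
        using h(2) by (intro add_mono mult_right_mono) auto
      also have "\<dots> = 2 * M * ell2_norm m d" by simp
      also have "\<dots> \<le> 2 * M * e" using k M by (intro mult_left_mono) (auto simp: d_def)
      finally show ?thesis .
    qed
    have "cmod (ell2_inner m h g - B g) \<le> 0 + e" if "e > 0" for e
      using that M le[of "e / (2 * M)"] le[of 1] by (cases "M = 0") auto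
    then have "cmod (ell2_inner m h g - B g) \<le> 0" by (rule field_le_epsilon)
    then show ?thesis by simp
  qed
qed

text \<open>A Cauchy sequence converges at every point. Its Cauchy estimates pass to the pointwise limit on each
  finite set, and then to all of the space.\<close>

lemma ell2_complete:
  assumes F: "\<And>n. F n \<in> ell2 m"
    and Cauchy: "\<And>e. e > 0 \<Longrightarrow> \<exists>N. \<forall>j\<ge>N. \<forall>k\<ge>N. ell2_norm m (\<lambda>x. F j x - F k x) < e"
  obtains f where "f \<in> ell2 m" "(\<lambda>n. ell2_norm m (\<lambda>x. F n x - f x)) \<longlonglongrightarrow> 0"
proof -
  have conv: "convergent (\<lambda>n. F n x)" for x
  proof (rule Cauchy_convergent, rule metric_CauchyI)
    fix e :: real assume e: "e > 0"
    have "e * sqrt (m x) > 0" using e m_pos[of x] by simp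
    then obtain N where N: "\<forall>j\<ge>N. \<forall>k\<ge>N. ell2_norm m (\<lambda>x. F j x - F k x) < e * sqrt (m x)"
      using Cauchy by blast
    show "\<exists>N. \<forall>j\<ge>N. \<forall>k\<ge>N. dist (F j x) (F k x) < e"
    proof (intro exI allI impI)
      fix j k assume jk: "j \<ge> N" "k \<ge> N"
      have "(cmod (F j x - F k x))\<^sup>2 * m x \<le> (ell2_norm m (\<lambda>x. F j x - F k x))\<^sup>2"
        using coordinate_bound[OF diff_mem[OF F F]] by simp
      also have "\<dots> < (e * sqrt (m x))\<^sup>2"
        using N jk by (intro power_strict_mono) auto
      also have "\<dots> = e\<^sup>2 * m x" by (simp add: power_mult_distrib)
      finally have "(cmod (F j x - F k x))\<^sup>2 < e\<^sup>2" using m_pos[of x] by (simp add: mult_less_cancel_right)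
      then show "dist (F j x) (F k x) < e"
        using e by (metis dist_norm power2_less_imp_less less_eq_real_def)
    qed
  qed
  define f where "f x = lim (\<lambda>n. F n x)" for x
  have lim: "(\<lambda>n. F n x) \<longlonglongrightarrow> f x" for x
    using conv by (simp add: f_def convergent_LIMSEQ_iff)
  have est: "(\<Sum>x\<in>S. (cmod (F j x - f x))\<^sup>2 * m x) \<le> e\<^sup>2"
    if S: "finite S" and N: "\<forall>j\<ge>N. \<forall>k\<ge>N. ell2_norm m (\<lambda>x. F j x - F k x) < e" and j: "j \<ge> N" for S N e j
  proof (rule tendsto_upperbound)
    show "(\<lambda>k. \<Sum>x\<in>S. (cmod (F j x - F k x))\<^sup>2 * m x) \<longlonglongrightarrow> (\<Sum>x\<in>S. (cmod (F j x - f x))\<^sup>2 * m x)"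
      by (intro tendsto_intros lim)
    have "(\<Sum>x\<in>S. (cmod (F j x - F k x))\<^sup>2 * m x) \<le> e\<^sup>2" if k: "k \<ge> N" for k
    proof -
      have "(\<Sum>x\<in>S. (cmod (F j x - F k x))\<^sup>2 * m x) \<le> (\<Sum>\<^sub>\<infinity>x. (cmod (F j x - F k x))\<^sup>2 * m x)"
        using S diff_mem[OF F F, of j k] by (intro finite_sum_le_infsum) (auto simp: ell2_def)
      also have "\<dots> = (ell2_norm m (\<lambda>x. F j x - F k x))\<^sup>2"
        by (simp add: ell2_norm_def infsum_nonneg)
      also have "\<dots> \<le> e\<^sup>2" using N j k by (intro power_mono) (auto intro: less_imp_le)
      finally show ?thesis .
    qed
    then show "\<forall>\<^sub>F k in sequentially. (\<Sum>x\<in>S. (cmod (F j x - F k x))\<^sup>2 * m x) \<le> e\<^sup>2"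
      unfolding eventually_sequentially by blast
  qed simp
  have nrm: "(\<lambda>x. F j x - f x) \<in> ell2 m" "ell2_norm m (\<lambda>x. F j x - f x) \<le> e"
    if "e > 0" "\<forall>j\<ge>N. \<forall>k\<ge>N. ell2_norm m (\<lambda>x. F j x - F k x) < e" "j \<ge> N" for N e j
    using norm_le_imp_ell2[OF est[OF _ that(2,3)]] that(1) by auto
  obtain N where N: "\<forall>j\<ge>N. \<forall>k\<ge>N. ell2_norm m (\<lambda>x. F j x - F k x) < 1" using Cauchy[of 1] by auto
  have "(\<lambda>x. F N x - (F N x - f x)) \<in> ell2 m"
    by (intro diff_mem F nrm(1)[OF _ N]) auto
  then have f: "f \<in> ell2 m" by simp
  have "(\<lambda>n. ell2_norm m (\<lambda>x. F n x - f x)) \<longlonglongrightarrow> 0"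
  proof (rule LIMSEQ_I)
    fix r :: real assume r: "r > 0"
    obtain N where N: "\<forall>j\<ge>N. \<forall>k\<ge>N. ell2_norm m (\<lambda>x. F j x - F k x) < r / 2"
      using Cauchy[of "r / 2"] r by auto
    have "ell2_norm m (\<lambda>x. F n x - f x) \<le> r / 2" if "n \<ge> N" for n
      using nrm(2)[OF _ N that] r by auto
    then have "\<forall>n\<ge>N. norm (ell2_norm m (\<lambda>x. F n x - f x) - 0) < r"
      using r by fastforce
    then show "\<exists>no. \<forall>n\<ge>no. norm (ell2_norm m (\<lambda>x. F n x - f x) - 0) < r" by blast
  qed
  then show ?thesis using f that by blast
qed

lemma tendsto_coordinate:
  assumes "\<And>n. F n \<in> ell2 m" "f \<in> ell2 m" "(\<lambda>n. ell2_norm m (\<lambda>x. F n x - f x)) \<longlonglongrightarrow> 0"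
  shows "(\<lambda>n. F n x) \<longlonglongrightarrow> f x"
proof -
  have "(\<lambda>n. ell2_inner m (F n) (delta x)) \<longlonglongrightarrow> ell2_inner m f (delta x)"
    by (rule tendsto_inner[OF assms]) (auto simp: ell2_norm_def)
  then have "(\<lambda>n. F n x * of_real (m x) / of_real (m x)) \<longlonglongrightarrow> f x * of_real (m x) / of_real (m x)"
    by (intro tendsto_divide tendsto_const) auto
  then show ?thesis by simp
qed

end

section \<open>Functional calculus of a projection-valued measure\<close>

definition bounded_borel :: "(real \<Rightarrow> complex) \<Rightarrow> bool" where
  "bounded_borel \<phi> \<longleftrightarrow> \<phi> \<in> borel_measurable borel \<and> (\<exists>M. \<forall>s. cmod (\<phi> s) \<le> M)"

lemma bounded_borelI: "\<phi> \<in> borel_measurable borel \<Longrightarrow> (\<And>s. cmod (\<phi> s) \<le> M) \<Longrightarrow> bounded_borel \<phi>"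
  by (auto simp: bounded_borel_def)

lemma bounded_borel_measurable [measurable_dest]: "bounded_borel \<phi> \<Longrightarrow> \<phi> \<in> borel_measurable borel"
  by (simp add: bounded_borel_def)

lemma bounded_borel_bound:
  assumes "bounded_borel \<phi>" obtains M where "0 \<le> M" "\<And>s. cmod (\<phi> s) \<le> M"
  using assms unfolding bounded_borel_def by (metis norm_ge_zero order_trans)

lemma bounded_borel_const [simp]: "bounded_borel (\<lambda>_. c)"
  by (rule bounded_borelI[of _ "cmod c"]) auto

lemma bounded_borel_indicator [simp]: "B \<in> sets borel \<Longrightarrow> bounded_borel (\<lambda>s. indicator B s)"
  by (rule bounded_borelI[of _ 1]) (auto simp: indicator_def)

lemma bounded_borel_mult:
  assumes "bounded_borel \<phi>" "bounded_borel \<psi>" shows "bounded_borel (\<lambda>s. \<phi> s * \<psi> s)"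
proof -
  obtain M N where "0 \<le> M" "\<And>s. cmod (\<phi> s) \<le> M" "0 \<le> N" "\<And>s. cmod (\<psi> s) \<le> N"
    using assms by (metis bounded_borel_bound)
  moreover have "(\<lambda>s. \<phi> s * \<psi> s) \<in> borel_measurable borel"
    using assms[THEN bounded_borel_measurable] by measurable
  ultimately show ?thesis
    by (intro bounded_borelI[of _ "M * N"]) (auto simp: norm_mult intro: mult_mono)
qed

lemma bounded_borel_lin:
  assumes "bounded_borel \<phi>" "bounded_borel \<psi>" shows "bounded_borel (\<lambda>s. \<phi> s + c * \<psi> s)"
proof -
  obtain M N where MN: "\<And>s. cmod (\<phi> s) \<le> M" "\<And>s. cmod (\<psi> s) \<le> N"
    using assms by (metis bounded_borel_bound)
  have "cmod (\<phi> s + c * \<psi> s) \<le> M + cmod c * N" for s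
    using norm_triangle_ineq[of "\<phi> s" "c * \<psi> s"] MN(1)[of s] mult_left_mono[OF MN(2)[of s], of "cmod c"]
    by (simp add: norm_mult)
  moreover have "(\<lambda>s. \<phi> s + c * \<psi> s) \<in> borel_measurable borel"
    using assms[THEN bounded_borel_measurable] by measurable
  ultimately show ?thesis by (intro bounded_borelI)
qed

lemma bounded_borel_cnj: "bounded_borel \<phi> \<Longrightarrow> bounded_borel (\<lambda>s. cnj (\<phi> s))"
  unfolding bounded_borel_def by (auto intro: borel_measurable_continuous_onI[THEN measurable_compose_rev] continuous_intros)

lemma bounded_borel_power: "bounded_borel \<phi> \<Longrightarrow> bounded_borel (\<lambda>s. \<phi> s ^ n)"
  by (induction n) (auto intro: bounded_borel_mult)

text \<open>Bounded Borel functions are bounded pointwise limits of simple functions. By dominated convergence, an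
  identity between integrals that is linear in the integrand holds as soon as it holds for indicators.\<close>

lemma bounded_borel_induct [consumes 1, case_names indicator lin lim]:
  fixes P :: "(real \<Rightarrow> complex) \<Rightarrow> bool"
  assumes bb: "bounded_borel \<phi>"
    and ind: "\<And>B. B \<in> sets borel \<Longrightarrow> P (\<lambda>s. indicator B s)"
    and lin: "\<And>\<phi> \<psi> c. \<lbrakk>bounded_borel \<phi>; bounded_borel \<psi>; P \<phi>; P \<psi>\<rbrakk> \<Longrightarrow> P (\<lambda>s. \<phi> s + c * \<psi> s)"
    and lim: "\<And>\<Phi> \<phi> M. \<lbrakk>\<And>n. bounded_borel (\<Phi> n); bounded_borel \<phi>; \<And>n s. cmod (\<Phi> n s) \<le> M;
      \<And>s. (\<lambda>n. \<Phi> n s) \<longlonglongrightarrow> \<phi> s; \<And>n. P (\<Phi> n)\<rbrakk> \<Longrightarrow> P \<phi>"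
  shows "P \<phi>"
proof -
  have zero: "P (\<lambda>_. 0)" using ind[of "{}"] by simp
  have fin: "bounded_borel (\<lambda>s. \<Sum>y\<in>Y. y * indicator (G y) s) \<and> P (\<lambda>s. \<Sum>y\<in>Y. y * indicator (G y) s)"
    if "finite Y" "\<And>y. y \<in> Y \<Longrightarrow> G y \<in> sets borel" for Y :: "complex set" and G
    using that
  proof (induction Y)
    case (insert y Y)
    let ?f = "\<lambda>s. \<Sum>y\<in>Y. y * indicator (G y) s"
    have "bounded_borel ?f \<and> P ?f" "G y \<in> sets borel" using insert by auto
    then have "bounded_borel (\<lambda>s. ?f s + y * indicator (G y) s)" "P (\<lambda>s. ?f s + y * indicator (G y) s)"
      by (auto intro!: bounded_borel_lin lin ind)
    moreover have "(\<lambda>s. \<Sum>y\<in>insert y Y. y * indicator (G y) s) = (\<lambda>s. ?f s + y * indicator (G y) s)"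
      unfolding sum.insert[OF insert(1,2)] by (simp only: add.commute)
    ultimately show ?case by simp
  qed (simp add: zero)
  have simple: "P F \<and> bounded_borel F" if F: "simple_function borel F" for F :: "real \<Rightarrow> complex"
  proof -
    have "F = (\<lambda>s. \<Sum>y\<in>range F. y * indicator (F -` {y}) s)"
      using simple_functionD(1)[OF F] by (auto simp: fun_eq_iff indicator_def if_distrib cong: if_cong)
    moreover have "finite (range F)" "F -` {y} \<in> sets borel" for y
      using simple_functionD[OF F] by (auto simp: space_borel)
    ultimately show ?thesis using fin[of "range F" "\<lambda>y. F -` {y}"] by simp
  qed
  obtain M where M: "0 \<le> M" "\<And>s. cmod (\<phi> s) \<le> M" using bounded_borel_bound[OF bb] by blast
  obtain F where F: "\<And>i. simple_function borel (F i)" "\<And>s. (\<lambda>i. F i s) \<longlonglongrightarrow> \<phi> s"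
    "\<And>i s. dist (F i s) 0 \<le> 2 * dist (\<phi> s) 0"
    using borel_measurable_implies_sequence_metric[OF bounded_borel_measurable[OF bb], of 0] by auto
  show ?thesis
  proof (rule lim[of F \<phi> "2 * M"])
    show "cmod (F n s) \<le> 2 * M" for n s
      using F(3)[of n s] M(2)[of s] by simp
  qed (use simple F bb in auto)
qed

lemma integral_indicator_complex:
  assumes "B \<in> sets M" shows "(\<integral>s. indicator B s \<partial>M) = (of_real (measure M B) :: complex)"
proof -
  have "(\<integral>s. indicator B s \<partial>M) = (\<integral>s. complex_of_real (indicator B s) \<partial>M)"
    by (simp add: indicator_def if_distrib[of complex_of_real] of_bool_def cong: if_cong)
  also have "\<dots> = of_real (\<integral>s. indicator B s \<partial>M)" by (rule integral_complex_of_real)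
  also have "(\<integral>s. indicator B s \<partial>M) = measure M B"
    using sets.sets_into_space[OF assms] by (simp add: Int_absorb2)
  finally show ?thesis .
qed

locale spectral_calc = weights m for m :: "'x \<Rightarrow> real" +
  fixes E :: "real set \<Rightarrow> ('x \<Rightarrow> complex) \<Rightarrow> 'x \<Rightarrow> complex"
  assumes pvm: "projection_valued_measure m E"
begin

abbreviation \<mu> where "\<mu> \<equiv> scalar_spectral_measure m E"
abbreviation pairing where "pairing \<equiv> spectral_pairing m E"

context
  fixes B :: "real set" assumes B: "B \<in> sets borel"
begin

lemma proj: "orthogonal_projection m (E B)"
  using pvm B by (simp add: projection_valued_measure_def)

lemma E_mem: "f \<in> ell2 m \<Longrightarrow> E B f \<in> ell2 m"
  and E_idem: "f \<in> ell2 m \<Longrightarrow> E B (E B f) = E B f"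
  and E_sym: "f \<in> ell2 m \<Longrightarrow> g \<in> ell2 m \<Longrightarrow> ell2_inner m (E B f) g = ell2_inner m f (E B g)"
  using proj by (simp_all add: orthogonal_projection_def)

lemma E_lin: "f \<in> ell2 m \<Longrightarrow> g \<in> ell2 m \<Longrightarrow> E B (\<lambda>x. f x + c * g x) = (\<lambda>x. E B f x + c * E B g x)"
proof -
  assume "f \<in> ell2 m" "g \<in> ell2 m"
  then have "E B (\<lambda>x. 1 * f x + c * g x) = (\<lambda>x. 1 * E B f x + c * E B g x)"
    using proj unfolding orthogonal_projection_def by blast
  then show ?thesis by simp
qed

lemma E_self: "f \<in> ell2 m \<Longrightarrow> ell2_inner m (E B f) f = of_real ((ell2_norm m (E B f))\<^sup>2)"
  using E_sym[of "E B f" f] E_idem[of f] E_mem[of f] inner_self[of "E B f"] by simp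

lemma E_contract: "f \<in> ell2 m \<Longrightarrow> ell2_norm m (E B f) \<le> ell2_norm m f"
proof -
  assume f: "f \<in> ell2 m"
  have "ell2_norm m (E B f) * ell2_norm m (E B f) \<le> ell2_norm m (E B f) * ell2_norm m f"
    using CS[OF E_mem[OF f] f] unfolding E_self[OF f] norm_of_real by (simp add: power2_eq_square)
  then show ?thesis
    by (cases "ell2_norm m (E B f) = 0") (auto simp: order.strict_iff_order dest: mult_left_le_imp_le)
qed

lemma E_form: "semi_inner (ell2 m) (\<lambda>f g. ell2_inner m (E B f) g)"
proof
  show "ell2_inner m (E B g) f = cnj (ell2_inner m (E B f) g)" if "f \<in> ell2 m" "g \<in> ell2 m" for f g
    using that herm[of "E B f" g] by (simp add: E_sym E_mem)
qed (auto simp: mem E_lin E_mem lin_left E_self)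

end

lemma E_UNIV [simp]: "f \<in> ell2 m \<Longrightarrow> E UNIV f = f"
  using pvm by (simp add: projection_valued_measure_def)

lemma E_countable:
  assumes "\<And>n. A n \<in> sets borel" "disjoint_family A" "f \<in> ell2 m"
  shows "(\<lambda>N. ell2_norm m (\<lambda>x. E (\<Union>n. A n) f x - (\<Sum>n<N. E (A n) f x))) \<longlonglongrightarrow> 0"
  using pvm assms unfolding projection_valued_measure_def by blast

lemma E_empty [simp]: "f \<in> ell2 m \<Longrightarrow> E {} f = (\<lambda>_. 0)"
proof -
  assume f: "f \<in> ell2 m"
  let ?F = "\<lambda>N x. \<Sum>n<N. E {} f x"
  have mem': "?F N \<in> ell2 m" for N
    using sum_mem[of "{..<N}" "\<lambda>_. E {} f"] E_mem[OF _ f] by simp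
  have *: "(\<lambda>N. ell2_norm m (\<lambda>x. E {} f x - ?F N x)) \<longlonglongrightarrow> 0"
    using E_countable[of "\<lambda>_. {}" f] f by (simp add: disjoint_family_on_def)
  have **: "(\<lambda>N. ell2_norm m (\<lambda>x. ?F N x - E {} f x)) \<longlonglongrightarrow> 0"
    using * by (subst norm_diff_commute[OF mem' E_mem]) (use f in auto)
  have "(\<lambda>N. ?F N x) \<longlonglongrightarrow> E {} f x" for x
    by (rule tendsto_coordinate[OF mem' _ **]) (use f E_mem in auto)
  then have lim: "(\<lambda>N. of_nat N * E {} f x) \<longlonglongrightarrow> E {} f x" for x by simp
  show ?thesis
  proof
    fix x
    have "(\<lambda>N. of_nat (Suc N) * E {} f x - of_nat N * E {} f x) \<longlonglongrightarrow> E {} f x - E {} f x"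
      by (rule tendsto_diff[OF LIMSEQ_Suc[OF lim] lim])
    then have "(\<lambda>N::nat. E {} f x) \<longlonglongrightarrow> 0" by (simp add: algebra_simps)
    then show "E {} f x = 0" by (simp add: LIMSEQ_const_iff)
  qed
qed

lemma E_Un:
  assumes A: "A \<in> sets borel" and B: "B \<in> sets borel" and dis: "A \<inter> B = {}" and f: "f \<in> ell2 m"
  shows "E (A \<union> B) f = (\<lambda>x. E A f x + E B f x)"
proof -
  let ?A = "binaryset A B"
  have sum: "(\<Sum>n<N. E (?A n) f x) = E A f x + E B f x" if "N \<ge> 2" for N x
  proof -
    have "(\<Sum>n<N. E (?A n) f x) = (\<Sum>n\<in>{0,1}. E (?A n) f x)"
      using that f by (intro sum.mono_neutral_right) (auto simp: binaryset_def)
    then show ?thesis by (simp add: binaryset_def)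
  qed
  have "(\<lambda>N. ell2_norm m (\<lambda>x. E (\<Union>n. ?A n) f x - (\<Sum>n<N. E (?A n) f x))) \<longlonglongrightarrow> 0"
    using A B dis f by (intro E_countable) (auto simp: binaryset_def disjoint_family_on_def)
  then have "(\<lambda>N. ell2_norm m (\<lambda>x. E (A \<union> B) f x - (\<Sum>n<N + 2. E (?A n) f x))) \<longlonglongrightarrow> 0"
    by (subst (asm) UN_binaryset_eq) (rule LIMSEQ_ignore_initial_segment)
  then have "(\<lambda>N::nat. ell2_norm m (\<lambda>x. E (A \<union> B) f x - (E A f x + E B f x))) \<longlonglongrightarrow> 0"
    by (simp only: sum)
  then have "ell2_norm m (\<lambda>x. E (A \<union> B) f x - (E A f x + E B f x)) = 0"
    by (simp add: LIMSEQ_const_iff)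
  moreover have "(\<lambda>x. E (A \<union> B) f x - (E A f x + E B f x)) \<in> ell2 m"
    using A B f by (intro diff_mem add_mem E_mem) auto
  ultimately have "(\<lambda>x. E (A \<union> B) f x - (E A f x + E B f x)) = (\<lambda>_. 0)"
    by (intro norm_zero_imp)
  then show ?thesis by (simp add: fun_eq_iff)
qed

text \<open>On the range of \<open>E A\<close> the contraction \<open>E (A \<union> B) = E A + E B\<close> already has full norm because of \<open>E A\<close>.\<close>

lemma E_orth:
  assumes A: "A \<in> sets borel" and B: "B \<in> sets borel" and dis: "A \<inter> B = {}" and f: "f \<in> ell2 m"
  shows "E B (E A f) = (\<lambda>_. 0)"
proof -
  let ?g = "E A f"
  have g: "?g \<in> ell2 m" using E_mem A f by blast
  have "ell2_inner m (E (A \<union> B) ?g) ?g = ell2_inner m (E A ?g) ?g + ell2_inner m (E B ?g) ?g"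
    unfolding E_Un[OF A B dis g] by (intro add_left E_mem A B g)
  then have "(ell2_norm m (E (A \<union> B) ?g))\<^sup>2 = (ell2_norm m ?g)\<^sup>2 + (ell2_norm m (E B ?g))\<^sup>2"
    unfolding E_self[OF sets.Un[OF A B] g] E_self[OF B g] E_idem[OF A f] inner_self[OF g]
      of_real_add[symmetric] of_real_eq_iff .
  moreover have "(ell2_norm m (E (A \<union> B) ?g))\<^sup>2 \<le> (ell2_norm m ?g)\<^sup>2"
    using A B g by (intro power_mono E_contract) auto
  ultimately have "(ell2_norm m (E B ?g))\<^sup>2 \<le> 0" by simp
  then show ?thesis using norm_zero_imp[OF E_mem[OF B g]] by simp
qed

lemma E_Int:
  assumes A: "A \<in> sets borel" and B: "B \<in> sets borel" and f: "f \<in> ell2 m"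
  shows "E A (E B f) = E (A \<inter> B) f"
proof -
  have s: "A \<inter> B \<in> sets borel" "B - A \<in> sets borel" "A - B \<in> sets borel" using A B by auto
  let ?g = "E (A \<inter> B) f"
  have g: "?g \<in> ell2 m" using E_mem s f by blast
  have "E ((A \<inter> B) \<union> (B - A)) f = (\<lambda>x. ?g x + 1 * E (B - A) f x)"
    using E_Un[OF s(1,2) _ f] by auto
  also have "(A \<inter> B) \<union> (B - A) = B" by auto
  finally have "E A (E B f) = (\<lambda>x. E A ?g x + 1 * E A (E (B - A) f) x)"
    using E_lin[OF A g E_mem[OF s(2) f], of 1] by simp
  also have "E A (E (B - A) f) = (\<lambda>_. 0)" using E_orth[OF s(2) A _ f] by auto
  also have "E A ?g = E ((A \<inter> B) \<union> (A - B)) ?g" by (simp add: Int_Diff_Un)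
  also have "\<dots> = (\<lambda>x. E (A \<inter> B) ?g x + E (A - B) ?g x)" by (rule E_Un[OF s(1,3) _ g]) auto
  also have "E (A - B) ?g = (\<lambda>_. 0)" by (rule E_orth[OF s(1,3) _ f]) auto
  also have "E (A \<inter> B) ?g = ?g" by (rule E_idem[OF s(1) f])
  finally show ?thesis by simp
qed

lemma space_\<mu> [simp]: "space (\<mu> f) = UNIV" and sets_\<mu> [simp, measurable_cong]: "sets (\<mu> f) = sets borel"
  unfolding scalar_spectral_measure_def
  by (simp add: space_measure_of_conv, metis sets.sigma_sets_eq sets_measure_of space_borel subset_UNIV Pow_UNIV)

lemma emeasure_\<mu>:
  assumes f: "f \<in> ell2 m" and B: "B \<in> sets borel"
  shows "emeasure (\<mu> f) B = ennreal ((ell2_norm m (E B f))\<^sup>2)"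
proof -
  let ?\<nu> = "\<lambda>B. ennreal (Re (ell2_inner m (E B f) f))"
  have "emeasure (\<mu> f) B = ?\<nu> B"
  proof (rule emeasure_measure_of[of _ UNIV "sets borel"])
    show "positive (sets (\<mu> f)) ?\<nu>" using f by (simp add: positive_def)
    show "countably_additive (sets (\<mu> f)) ?\<nu>"
    proof (rule countably_additiveI)
      fix A :: "nat \<Rightarrow> real set"
      assume A: "range A \<subseteq> sets (\<mu> f)" "disjoint_family A" "(\<Union>i. A i) \<in> sets (\<mu> f)"
      then have An: "A n \<in> sets borel" and Au: "(\<Union>i. A i) \<in> sets borel" for n by auto
      let ?S = "\<lambda>N x. \<Sum>n<N. E (A n) f x"
      have S: "?S N \<in> ell2 m" for N by (intro sum_mem E_mem An f)
      have "(\<lambda>N. ell2_norm m (\<lambda>x. ?S N x - E (\<Union>n. A n) f x)) \<longlonglongrightarrow> 0"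
        using E_countable[OF An A(2) f] norm_diff_commute[OF S E_mem[OF Au f]] by simp
      then have "(\<lambda>N. ell2_inner m (?S N) f) \<longlonglongrightarrow> ell2_inner m (E (\<Union>n. A n) f) f"
        using S E_mem[OF Au f] f by (intro tendsto_inner) (auto simp: ell2_norm_def)
      then have "(\<lambda>N. Re (ell2_inner m (?S N) f)) \<longlonglongrightarrow> Re (ell2_inner m (E (\<Union>n. A n) f) f)"
        by (rule tendsto_Re)
      also have "(\<lambda>N. Re (ell2_inner m (?S N) f)) = (\<lambda>N. \<Sum>n<N. Re (ell2_inner m (E (A n) f) f))"
        using f An by (subst sum_left) (auto simp: E_mem)
      finally have "(\<lambda>n. Re (ell2_inner m (E (A n) f) f)) sums Re (ell2_inner m (E (\<Union>n. A n) f) f)"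
        by (simp add: sums_def)
      then have "(\<lambda>n. ?\<nu> (A n)) sums ?\<nu> (\<Union>n. A n)"
        by (subst sums_ennreal) (auto simp: E_self An Au f)
      then show "(\<Sum>i. ?\<nu> (A i)) = ?\<nu> (\<Union>i. A i)" by (simp add: sums_iff)
    qed
  qed (use B in \<open>auto simp: scalar_spectral_measure_def\<close>)
  then show ?thesis using E_self[OF B f] by simp
qed

lemma finite_\<mu>: "f \<in> ell2 m \<Longrightarrow> finite_measure (\<mu> f)"
  by (rule finite_measureI) (simp add: emeasure_\<mu>)

lemma measure_\<mu>:
  "f \<in> ell2 m \<Longrightarrow> B \<in> sets borel \<Longrightarrow> measure (\<mu> f) B = (ell2_norm m (E B f))\<^sup>2"
  by (simp add: measure_def emeasure_\<mu>)

lemma integrable_bounded: "f \<in> ell2 m \<Longrightarrow> bounded_borel \<phi> \<Longrightarrow> integrable (\<mu> f) \<phi>"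
proof -
  assume f: "f \<in> ell2 m" and b: "bounded_borel \<phi>"
  interpret finite_measure "\<mu> f" by (rule finite_\<mu>[OF f])
  obtain M where "\<And>s. cmod (\<phi> s) \<le> M" using bounded_borel_bound[OF b] by blast
  then show ?thesis using bounded_borel_measurable[OF b]
    by (intro integrable_const_bound[of _ M]) auto
qed

lemma integral_bound:
  assumes f: "f \<in> ell2 m" and b: "bounded_borel \<phi>" and M: "\<And>s. cmod (\<phi> s) \<le> M"
  shows "cmod (\<integral>s. \<phi> s \<partial>\<mu> f) \<le> M * (ell2_norm m f)\<^sup>2"
proof -
  interpret finite_measure "\<mu> f" by (rule finite_\<mu>[OF f])
  have "cmod (\<integral>s. \<phi> s \<partial>\<mu> f) \<le> (\<integral>s. M \<partial>\<mu> f)"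
    using integrable_bounded[OF f b] M by (intro Bochner_Integration.integral_norm_bound_integral) auto
  also have "\<dots> = M * (ell2_norm m f)\<^sup>2" using measure_\<mu>[OF f, of UNIV] f by simp
  finally show ?thesis .
qed

lemma pairing_indicator:
  assumes B: "B \<in> sets borel" and f: "f \<in> ell2 m" and g: "g \<in> ell2 m"
  shows "pairing (\<lambda>s. indicator B s) f g = ell2_inner m (E B f) g"
proof -
  interpret B: semi_inner "ell2 m" "\<lambda>f g. ell2_inner m (E B f) g" by (rule E_form[OF B])
  have "(\<integral>s. indicator B s \<partial>\<mu> h) = ell2_inner m (E B h) h" if h: "h \<in> ell2 m" for h
  proof -
    interpret finite_measure "\<mu> h" by (rule finite_\<mu>[OF h])
    have "(\<integral>s. indicator B s \<partial>\<mu> h) = (of_real (measure (\<mu> h) B) :: complex)"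
      using B by (intro integral_indicator_complex) auto
    then show ?thesis by (simp add: measure_\<mu> h B E_self)
  qed
  then show ?thesis using f g
    unfolding spectral_pairing_def by (subst B.polarization) (auto simp: mem)
qed

lemma pairing_lin:
  assumes "f \<in> ell2 m" "g \<in> ell2 m" "bounded_borel \<phi>" "bounded_borel \<psi>"
  shows "pairing (\<lambda>s. \<phi> s + c * \<psi> s) f g = pairing \<phi> f g + c * pairing \<psi> f g"
proof -
  have "(\<integral>s. \<phi> s + c * \<psi> s \<partial>\<mu> (\<lambda>x. f x + d * g x))
      = (\<integral>s. \<phi> s \<partial>\<mu> (\<lambda>x. f x + d * g x)) + c * (\<integral>s. \<psi> s \<partial>\<mu> (\<lambda>x. f x + d * g x))" for d
    using assms integrable_bounded[OF lin_mem[OF assms(1,2)]]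
    by (subst Bochner_Integration.integral_add) auto
  then show ?thesis
    unfolding spectral_pairing_def
    by (simp only: sum_distrib_left sum.distrib[symmetric] add_divide_distrib[symmetric] times_divide_eq_right)
       (simp only: distrib_left mult.left_commute)
qed

lemma pairing_lim:
  assumes f: "f \<in> ell2 m" and g: "g \<in> ell2 m"
    and \<Phi>: "\<And>n. bounded_borel (\<Phi> n)" "bounded_borel \<phi>" "\<And>n s. cmod (\<Phi> n s) \<le> M"
    and lim: "\<And>s. (\<lambda>n. \<Phi> n s) \<longlonglongrightarrow> \<phi> s"
  shows "(\<lambda>n. pairing (\<Phi> n) f g) \<longlonglongrightarrow> pairing \<phi> f g"
proof -
  have "(\<lambda>n. \<integral>s. \<Phi> n s \<partial>\<mu> h) \<longlonglongrightarrow> (\<integral>s. \<phi> s \<partial>\<mu> h)" if h: "h \<in> ell2 m" for h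
  proof (rule integral_dominated_convergence[where w = "\<lambda>_. M"])
    interpret finite_measure "\<mu> h" by (rule finite_\<mu>[OF h])
    show "integrable (\<mu> h) (\<lambda>_. M)" by simp
  qed (use \<Phi> lim in \<open>auto dest: bounded_borel_measurable\<close>)
  then show ?thesis unfolding spectral_pairing_def
    by (intro tendsto_intros) (auto intro!: mem f g)
qed

lemma pairing_lin_left:
  assumes "bounded_borel \<phi>" "f \<in> ell2 m" "g \<in> ell2 m" "h \<in> ell2 m"
  shows "pairing \<phi> (\<lambda>x. f x + c * g x) h = pairing \<phi> f h + c * pairing \<phi> g h"
  using assms(1)
proof (induction rule: bounded_borel_induct)
  case (indicator B)
  then show ?case using assms by (simp add: pairing_indicator mem E_lin lin_left E_mem)
next
  case (lin \<phi> \<psi> d)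
  then show ?case using assms by (simp add: pairing_lin mem algebra_simps)
next
  case (lim \<Phi> \<phi> M)
  have "(\<lambda>n. pairing (\<Phi> n) (\<lambda>x. f x + c * g x) h) \<longlonglongrightarrow> pairing \<phi> f h + c * pairing \<phi> g h"
    unfolding lim(5) using assms by (intro tendsto_intros pairing_lim[OF _ _ lim(1-4)]) auto
  moreover have "(\<lambda>n. pairing (\<Phi> n) (\<lambda>x. f x + c * g x) h) \<longlonglongrightarrow> pairing \<phi> (\<lambda>x. f x + c * g x) h"
    using assms by (intro pairing_lim[OF _ _ lim(1-4)] mem) auto
  ultimately show ?case by (rule LIMSEQ_unique[rotated])
qed

lemma pairing_herm:
  assumes "bounded_borel \<phi>" "f \<in> ell2 m" "g \<in> ell2 m"
  shows "pairing (\<lambda>s. cnj (\<phi> s)) g f = cnj (pairing \<phi> f g)"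
  using assms(1)
proof (induction rule: bounded_borel_induct)
  case (indicator B)
  then have "pairing (\<lambda>s. indicator B s) g f = cnj (pairing (\<lambda>s. indicator B s) f g)"
    using assms herm[of f "E B g"] by (simp add: pairing_indicator E_mem E_sym)
  moreover have "(\<lambda>s. cnj (indicator B s)) = indicator B" by (auto simp: indicator_def)
  ultimately show ?case by simp
next
  case (lin \<phi> \<psi> d)
  then show ?case using assms by (simp add: pairing_lin bounded_borel_cnj)
next
  case (lim \<Phi> \<phi> M)
  have "(\<lambda>n. pairing (\<lambda>s. cnj (\<Phi> n s)) g f) \<longlonglongrightarrow> cnj (pairing \<phi> f g)"
    unfolding lim(5) using assms by (intro tendsto_intros pairing_lim[OF _ _ lim(1-4)]) auto
  moreover have "(\<lambda>n. pairing (\<lambda>s. cnj (\<Phi> n s)) g f) \<longlonglongrightarrow> pairing (\<lambda>s. cnj (\<phi> s)) g f"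
    using assms lim(1-4)
    by (intro pairing_lim[where M = M]) (auto intro!: bounded_borel_cnj tendsto_intros)
  ultimately show ?case by (rule LIMSEQ_unique[rotated])
qed

lemma pairing_lin_right:
  assumes "bounded_borel \<phi>" "f \<in> ell2 m" "g \<in> ell2 m" "h \<in> ell2 m"
  shows "pairing \<phi> h (\<lambda>x. f x + c * g x) = pairing \<phi> h f + cnj c * pairing \<phi> h g"
  using pairing_herm[OF bounded_borel_cnj[OF assms(1)], of "\<lambda>x. f x + c * g x" h]
    pairing_herm[OF bounded_borel_cnj[OF assms(1)], of f h]
    pairing_herm[OF bounded_borel_cnj[OF assms(1)], of g h] assms
  by (simp add: pairing_lin_left bounded_borel_cnj mem)

lemma pairing_self:
  assumes "bounded_borel \<phi>" "f \<in> ell2 m"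
  shows "pairing \<phi> f f = (\<integral>s. \<phi> s \<partial>\<mu> f)"
  using assms(1)
proof (induction rule: bounded_borel_induct)
  case (indicator B)
  interpret finite_measure "\<mu> f" by (rule finite_\<mu>[OF assms(2)])
  have "(\<integral>s. indicator B s \<partial>\<mu> f) = (of_real (measure (\<mu> f) B) :: complex)"
    using indicator by (intro integral_indicator_complex) auto
  then show ?case using assms(2) indicator by (simp add: pairing_indicator measure_\<mu> E_self)
next
  case (lin \<phi> \<psi> d)
  then have "(\<integral>s. \<phi> s + d * \<psi> s \<partial>\<mu> f) = (\<integral>s. \<phi> s \<partial>\<mu> f) + d * (\<integral>s. \<psi> s \<partial>\<mu> f)"
    using integrable_bounded[OF assms(2)] by (subst Bochner_Integration.integral_add) auto
  then show ?case using assms lin by (simp add: pairing_lin)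
next
  case (lim \<Phi> \<phi> M)
  have "(\<lambda>n. \<integral>s. \<Phi> n s \<partial>\<mu> f) \<longlonglongrightarrow> (\<integral>s. \<phi> s \<partial>\<mu> f)"
  proof (rule integral_dominated_convergence[where w = "\<lambda>_. M"])
    interpret finite_measure "\<mu> f" by (rule finite_\<mu>[OF assms(2)])
    show "integrable (\<mu> f) (\<lambda>_. M)" by simp
  qed (use lim in \<open>auto dest: bounded_borel_measurable\<close>)
  then have "(\<lambda>n. pairing (\<Phi> n) f f) \<longlonglongrightarrow> (\<integral>s. \<phi> s \<partial>\<mu> f)" unfolding lim(5) .
  moreover have "(\<lambda>n. pairing (\<Phi> n) f f) \<longlonglongrightarrow> pairing \<phi> f f"
    using assms by (intro pairing_lim[OF _ _ lim(1-4)]) auto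
  ultimately show ?case by (rule LIMSEQ_unique[rotated])
qed

text \<open>The polarization identity gives the bound \<open>M (\<parallel>f\<parallel> + \<parallel>g\<parallel>)\<^sup>2\<close>, and rescaling to unit vectors turns it into
  a product. The constant \<open>4\<close> is not sharp.\<close>

lemma pairing_bound:
  assumes b: "bounded_borel \<phi>" and M: "\<And>s. cmod (\<phi> s) \<le> M" and f: "f \<in> ell2 m" and g: "g \<in> ell2 m"
  shows "cmod (pairing \<phi> f g) \<le> 4 * M * ell2_norm m f * ell2_norm m g"
proof -
  have M0: "0 \<le> M" using M[of 0] norm_ge_zero order_trans by blast
  have crude: "cmod (pairing \<phi> f g) \<le> M * (ell2_norm m f + ell2_norm m g)\<^sup>2"
    if f: "f \<in> ell2 m" and g: "g \<in> ell2 m" for f g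
  proof -
    have "cmod (\<i> ^ k * (\<integral>s. \<phi> s \<partial>\<mu> (\<lambda>x. f x + \<i> ^ k * g x))) \<le> M * (ell2_norm m f + ell2_norm m g)\<^sup>2" for k
    proof -
      have "ell2_norm m (\<lambda>x. f x + \<i> ^ k * g x) \<le> ell2_norm m f + ell2_norm m g"
        using norm_add[OF f scale_mem[OF g, of "\<i> ^ k"]] norm_scale[OF g, of "\<i> ^ k"] by (simp add: norm_power)
      then have "M * (ell2_norm m (\<lambda>x. f x + \<i> ^ k * g x))\<^sup>2 \<le> M * (ell2_norm m f + ell2_norm m g)\<^sup>2"
        using M0 by (intro mult_left_mono power_mono) auto
      then show ?thesis
        using integral_bound[OF lin_mem[OF f g, of "\<i> ^ k"] b M] by (simp add: norm_mult norm_power)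
    qed
    then have "cmod (\<Sum>k<4. \<i> ^ k * (\<integral>s. \<phi> s \<partial>\<mu> (\<lambda>x. f x + \<i> ^ k * g x)))
        \<le> (\<Sum>k<4::nat. M * (ell2_norm m f + ell2_norm m g)\<^sup>2)"
      by (intro sum_norm_le) auto
    then show ?thesis unfolding spectral_pairing_def by (simp add: norm_divide)
  qed
  have z: "(\<lambda>_. 0) \<in> ell2 m" by (rule zero_mem)
  consider "ell2_norm m f = 0" | "ell2_norm m g = 0" | "ell2_norm m f > 0" "ell2_norm m g > 0"
    using norm_nonneg by (metis less_eq_real_def)
  then show ?thesis
  proof cases
    case 1
    then have "f = (\<lambda>_. 0)" using f norm_zero_imp by blast
    then show ?thesis using pairing_lin_left[OF b z z g, of 1] by (simp add: ell2_norm_def)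
  next
    case 2
    then have "g = (\<lambda>_. 0)" using g norm_zero_imp by blast
    then show ?thesis using pairing_lin_right[OF b z z f, of 1] by (simp add: ell2_norm_def)
  next
    case 3
    let ?a = "1 / ell2_norm m f" and ?b = "1 / ell2_norm m g"
    have sl: "pairing \<phi> (\<lambda>x. c * f x) h = c * pairing \<phi> f h" if "h \<in> ell2 m" for c h
      using pairing_lin_left[OF b z f that, of c] pairing_lin_left[OF b z z that, of 1] by simp
    have sr: "pairing \<phi> f (\<lambda>x. c * g x) = cnj c * pairing \<phi> f g" for c
      using pairing_lin_right[OF b z g f, of c] pairing_lin_right[OF b z z f, of 1] by simp
    have "pairing \<phi> (\<lambda>x. of_real ?a * f x) (\<lambda>x. of_real ?b * g x) = of_real (?a * ?b) * pairing \<phi> f g"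
      unfolding sl[OF scale_mem[OF g]] sr by simp
    moreover have "cmod (pairing \<phi> (\<lambda>x. of_real ?a * f x) (\<lambda>x. of_real ?b * g x)) \<le> M * (1 + 1)\<^sup>2"
      using crude[OF scale_mem[OF f] scale_mem[OF g], of "of_real ?a" "of_real ?b"] 3
      unfolding norm_scale[OF f] norm_scale[OF g] by (simp add: norm_divide)
    ultimately have "?a * ?b * cmod (pairing \<phi> f g) \<le> 4 * M"
      using 3 by (simp add: norm_mult norm_divide)
    then show ?thesis using 3 by (simp add: field_simps)
  qed
qed

text \<open>The operator \<open>\<integral>\<phi> dE\<close> for bounded \<open>\<phi>\<close>, read off from the values of its sesquilinear form on point masses.\<close>

definition calc :: "(real \<Rightarrow> complex) \<Rightarrow> ('x \<Rightarrow> complex) \<Rightarrow> 'x \<Rightarrow> complex" where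
  "calc \<phi> f = (\<lambda>x. pairing \<phi> f (delta x) / of_real (m x))"

lemma
  assumes b: "bounded_borel \<phi>" and f: "f \<in> ell2 m"
  shows calc_mem: "calc \<phi> f \<in> ell2 m"
    and calc_inner: "g \<in> ell2 m \<Longrightarrow> ell2_inner m (calc \<phi> f) g = pairing \<phi> f g"
proof -
  obtain M where M: "0 \<le> M" "\<And>s. cmod (\<phi> s) \<le> M" using bounded_borel_bound[OF b] by blast
  have 1: "cmod (pairing \<phi> f g) \<le> (4 * M * ell2_norm m f) * ell2_norm m g" if "g \<in> ell2 m" for g
    by (rule pairing_bound[OF b M(2) f that])
  have 2: "0 \<le> 4 * M * ell2_norm m f" using M by simp
  have 3: "pairing \<phi> f (\<lambda>x. g x + c * h x) = pairing \<phi> f g + cnj c * pairing \<phi> f h"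
    if "g \<in> ell2 m" "h \<in> ell2 m" for g h c
    by (rule pairing_lin_right[OF b that f])
  note R = Riesz[of "pairing \<phi> f", OF 1 2 3]
  show "calc \<phi> f \<in> ell2 m" unfolding calc_def by (rule R(1))
  show "g \<in> ell2 m \<Longrightarrow> ell2_inner m (calc \<phi> f) g = pairing \<phi> f g"
    unfolding calc_def by (rule R(3))
qed

lemma calc_adjoint:
  assumes b: "bounded_borel \<phi>" and f: "f \<in> ell2 m" and g: "g \<in> ell2 m"
  shows "ell2_inner m f (calc (\<lambda>s. cnj (\<phi> s)) g) = pairing \<phi> f g"
  using pairing_herm[OF b f g] calc_inner[OF bounded_borel_cnj[OF b] g f]
    herm[OF calc_mem[OF bounded_borel_cnj[OF b] g] f] by simp

text \<open>Multiplicativity of the calculus. For \<open>\<psi>\<close> an indicator it follows by approximation of \<open>\<phi>\<close>. For general \<open>\<psi>\<close>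
  the operator of \<open>\<phi>\<close> is moved to the right-hand side as its adjoint, so that \<open>\<psi>\<close> alone is approximated.\<close>

lemma pairing_calc:
  assumes b: "bounded_borel \<phi>" and b': "bounded_borel \<psi>" and f: "f \<in> ell2 m" and g: "g \<in> ell2 m"
  shows "pairing \<phi> (calc \<psi> f) g = pairing (\<lambda>s. \<phi> s * \<psi> s) f g"
proof -
  have E: "pairing \<phi> (E B f) g = pairing (\<lambda>s. \<phi> s * indicator B s) f g"
    if B: "B \<in> sets borel" and f: "f \<in> ell2 m" and g: "g \<in> ell2 m" for B f g
    using b
  proof (induction rule: bounded_borel_induct)
    case (indicator A)
    have "(\<lambda>s. indicator A s * indicator B s :: complex) = indicator (A \<inter> B)"
      by (auto simp: indicator_def)
    then show ?case using indicator B f g by (simp add: pairing_indicator E_mem E_Int)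
  next
    case (lin \<phi>' \<psi>' c)
    have "(\<lambda>s. (\<phi>' s + c * \<psi>' s) * indicator B s) = (\<lambda>s. \<phi>' s * indicator B s + c * (\<psi>' s * indicator B s))"
      by (simp add: algebra_simps)
    then show ?case using lin B f g by (simp add: pairing_lin E_mem bounded_borel_mult)
  next
    case (lim \<Phi> \<phi>' M)
    have M: "0 \<le> M" using lim(3) norm_ge_zero order_trans by blast
    have "(\<lambda>n. pairing (\<lambda>s. \<Phi> n s * indicator B s) f g) \<longlonglongrightarrow> pairing (\<lambda>s. \<phi>' s * indicator B s) f g"
    proof (rule pairing_lim[where M = M])
      show "cmod (\<Phi> n s * indicator B s) \<le> M" for n s
        using lim(3)[of n s] M by (simp add: indicator_def)
    qed (use lim B f g in \<open>auto intro!: bounded_borel_mult tendsto_intros\<close>)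
    moreover have "(\<lambda>n. pairing (\<Phi> n) (E B f) g) \<longlonglongrightarrow> pairing \<phi>' (E B f) g"
      using B f g by (intro pairing_lim[OF _ _ lim(1-4)] E_mem)
    ultimately show ?case unfolding lim(5) by (rule LIMSEQ_unique[rotated])
  qed
  let ?g = "calc (\<lambda>s. cnj (\<phi> s)) g"
  have g': "?g \<in> ell2 m" by (intro calc_mem bounded_borel_cnj b g)
  have "pairing \<psi> f ?g = pairing (\<lambda>s. \<phi> s * \<psi> s) f g" using b'
  proof (induction rule: bounded_borel_induct)
    case (indicator B)
    have "pairing (\<lambda>s. indicator B s) f ?g = ell2_inner m (E B f) ?g"
      by (rule pairing_indicator[OF indicator f g'])
    also have "\<dots> = pairing \<phi> (E B f) g" by (rule calc_adjoint[OF b E_mem[OF indicator f] g])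
    finally show ?case using E[OF indicator f g] by simp
  next
    case (lin \<phi>' \<psi>' c)
    have "(\<lambda>s. \<phi> s * (\<phi>' s + c * \<psi>' s)) = (\<lambda>s. \<phi> s * \<phi>' s + c * (\<phi> s * \<psi>' s))"
      by (simp add: algebra_simps)
    then show ?case using lin b f g g' by (simp add: pairing_lin bounded_borel_mult)
  next
    case (lim \<Phi> \<phi>' M)
    obtain N where N: "0 \<le> N" "\<And>s. cmod (\<phi> s) \<le> N" using bounded_borel_bound[OF b] by blast
    have "cmod (\<phi> s * \<Phi> n s) \<le> N * M" for n s
      using N lim(3) by (auto simp: norm_mult intro: mult_mono)
    then have "(\<lambda>n. pairing (\<lambda>s. \<phi> s * \<Phi> n s) f g) \<longlonglongrightarrow> pairing (\<lambda>s. \<phi> s * \<phi>' s) f g"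
      using lim b f g by (intro pairing_lim[where M = "N * M"])
        (auto intro!: bounded_borel_mult tendsto_intros)
    moreover have "(\<lambda>n. pairing (\<Phi> n) f ?g) \<longlonglongrightarrow> pairing \<phi>' f ?g"
      by (intro pairing_lim[OF _ _ lim(1-4)] f g')
    ultimately show ?case unfolding lim(5) by (rule LIMSEQ_unique[rotated])
  qed
  moreover have "pairing \<phi> (calc \<psi> f) g = ell2_inner m (calc \<psi> f) ?g"
    using calc_adjoint[OF b calc_mem[OF b' f] g] by simp
  ultimately show ?thesis using calc_inner[OF b' f g'] by simp
qed

lemma calc_calc:
  assumes b: "bounded_borel \<phi>" and b': "bounded_borel \<psi>" and f: "f \<in> ell2 m"
  shows "calc \<phi> (calc \<psi> f) = calc (\<lambda>s. \<phi> s * \<psi> s) f"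
  using pairing_calc[OF b b' f] by (simp add: calc_def)

lemma pairing_one: "f \<in> ell2 m \<Longrightarrow> g \<in> ell2 m \<Longrightarrow> pairing (\<lambda>_. 1) f g = ell2_inner m f g"
  using pairing_indicator[of UNIV f g] by simp

lemma calc_one: "f \<in> ell2 m \<Longrightarrow> calc (\<lambda>_. 1) f = f"
  by (rule eq_by_delta) (simp add: calc_inner pairing_one del: inner_delta)

lemma calc_lin_fun:
  assumes "bounded_borel \<phi>" "bounded_borel \<psi>" "f \<in> ell2 m"
  shows "calc (\<lambda>s. \<phi> s + c * \<psi> s) f = (\<lambda>x. calc \<phi> f x + c * calc \<psi> f x)"
  using assms by (simp add: calc_def pairing_lin add_divide_distrib)

lemma norm_calc_sq:
  assumes b: "bounded_borel \<phi>" and f: "f \<in> ell2 m"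
  shows "(ell2_norm m (calc \<phi> f))\<^sup>2 = (\<integral>s. (cmod (\<phi> s))\<^sup>2 \<partial>\<mu> f)"
proof -
  have c: "calc \<phi> f \<in> ell2 m" by (rule calc_mem[OF b f])
  note b' = bounded_borel_cnj[OF b]
  have "of_real ((ell2_norm m (calc \<phi> f))\<^sup>2) = ell2_inner m (calc \<phi> f) (calc (\<lambda>s. cnj (cnj (\<phi> s))) f)"
    using inner_self[OF c] by simp
  also have "\<dots> = pairing (\<lambda>s. cnj (\<phi> s)) (calc \<phi> f) f"
    by (rule calc_adjoint[OF b' c f])
  also have "\<dots> = pairing (\<lambda>s. cnj (\<phi> s) * \<phi> s) f f"
    by (rule pairing_calc[OF b' b f f])
  also have "\<dots> = (\<integral>s. cnj (\<phi> s) * \<phi> s \<partial>\<mu> f)"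
    by (rule pairing_self[OF bounded_borel_mult[OF b' b] f])
  also have "(\<lambda>s. cnj (\<phi> s) * \<phi> s) = (\<lambda>s. of_real ((cmod (\<phi> s))\<^sup>2))"
    by (simp only: complex_norm_square mult.commute)
  also have "(\<integral>s. of_real ((cmod (\<phi> s))\<^sup>2) \<partial>\<mu> f) = (of_real (\<integral>s. (cmod (\<phi> s))\<^sup>2 \<partial>\<mu> f) :: complex)"
    by (rule integral_complex_of_real)
  finally show ?thesis by (simp only: of_real_eq_iff)
qed

end

section \<open>The operator of a projection-valued measure\<close>

context spectral_calc
begin

text \<open>Truncations of the identity function. They reduce statements about the unbounded operator to the bounded
  calculus.\<close>

abbreviation (input) cut :: "nat \<Rightarrow> real \<Rightarrow> complex" where
  "cut N \<equiv> (\<lambda>s. of_real (s * indicator {- real N..real N} s))"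

lemma bounded_borel_cut [simp]: "bounded_borel (cut N)"
proof (rule bounded_borelI[of _ "real N"])
  show "cmod (cut N s) \<le> real N" for s by (auto simp: indicator_def)
qed measurable

lemma cut_tendsto: "(\<lambda>N. cut N s) \<longlonglongrightarrow> of_real s"
proof (rule tendsto_eventually)
  obtain N0 :: nat where "\<bar>s\<bar> \<le> real N0" using real_arch_simple by blast
  then have "cut N s = of_real s" if "N \<ge> N0" for N
  proof -
    have "\<bar>s\<bar> \<le> real N" using \<open>\<bar>s\<bar> \<le> real N0\<close> that by linarith
    then show ?thesis by (auto simp: indicator_def abs_le_iff)
  qed
  then show "\<forall>\<^sub>F N in sequentially. cut N s = of_real s"
    unfolding eventually_sequentially by blast
qed

lemma norm_cut_le: "cmod (cut N s) \<le> \<bar>s\<bar>"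
  by (auto simp: indicator_def)

abbreviation dom where "dom \<equiv> spectral_domain m E (\<lambda>s. of_real s)"

lemma dom_iff: "f \<in> dom \<longleftrightarrow> f \<in> ell2 m \<and> integrable (\<mu> f) (\<lambda>s. s\<^sup>2)"
  by (simp add: spectral_domain_def)

lemma dom_ell2: "f \<in> dom \<Longrightarrow> f \<in> ell2 m"
  by (simp add: dom_iff)

text \<open>Membership in the domain is a uniform bound for the truncated operators; in this form the
  triangle inequality shows that the domain is a linear space.\<close>

lemma dom_iff_bounded:
  assumes f: "f \<in> ell2 m"
  shows "f \<in> dom \<longleftrightarrow> (\<exists>C. \<forall>N. ell2_norm m (calc (cut N) f) \<le> C)"
proof -
  interpret finite_measure "\<mu> f" by (rule finite_\<mu>[OF f])
  have n: "(ell2_norm m (calc (cut N) f))\<^sup>2 = (\<integral>s. s\<^sup>2 * indicator {- real N..real N} s \<partial>\<mu> f)" for N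
  proof -
    have "(\<lambda>s. (cmod (cut N s))\<^sup>2) = (\<lambda>s. s\<^sup>2 * indicator {- real N..real N} s)"
      by (auto simp: indicator_def)
    then show ?thesis using norm_calc_sq[OF bounded_borel_cut f] by simp
  qed
  have int: "integrable (\<mu> f) (\<lambda>s. s\<^sup>2 * indicator {- real N..real N} s)" for N
  proof (rule integrable_const_bound[of _ "(real N)\<^sup>2"])
    show "AE s in \<mu> f. norm (s\<^sup>2 * indicator {- real N..real N} s) \<le> (real N)\<^sup>2"
      by (auto simp: indicator_def abs_le_square_iff[symmetric])
  qed measurable
  show ?thesis
  proof
    assume "f \<in> dom"
    then have i: "integrable (\<mu> f) (\<lambda>s. s\<^sup>2)" by (simp add: dom_iff)
    have "ell2_norm m (calc (cut N) f) \<le> sqrt (\<integral>s. s\<^sup>2 \<partial>\<mu> f)" for N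
    proof (rule real_le_rsqrt)
      show "(ell2_norm m (calc (cut N) f))\<^sup>2 \<le> (\<integral>s. s\<^sup>2 \<partial>\<mu> f)"
        unfolding n by (rule integral_mono[OF int i]) (auto simp: indicator_def)
    qed
    then show "\<exists>C. \<forall>N. ell2_norm m (calc (cut N) f) \<le> C" by blast
  next
    assume "\<exists>C. \<forall>N. ell2_norm m (calc (cut N) f) \<le> C"
    then obtain C where C: "\<And>N. ell2_norm m (calc (cut N) f) \<le> C" by blast
    have C2: "(\<integral>s. s\<^sup>2 * indicator {- real N..real N} s \<partial>\<mu> f) \<le> C\<^sup>2" for N
      unfolding n[symmetric] by (rule power_mono[OF C]) simp
    have inc: "incseq (\<lambda>N. \<integral>s. s\<^sup>2 * indicator {- real N..real N} s \<partial>\<mu> f)"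
      by (rule incseq_SucI, rule integral_mono[OF int int]) (auto simp: indicator_def)
    obtain L where L: "(\<lambda>N. \<integral>s. s\<^sup>2 * indicator {- real N..real N} s \<partial>\<mu> f) \<longlonglongrightarrow> L"
      using incseq_convergent[OF inc] C2 by blast
    have "integrable (\<mu> f) (\<lambda>s. s\<^sup>2)"
    proof (rule integrable_monotone_convergence[OF int _ _ L])
      show "AE s in \<mu> f. mono (\<lambda>N. s\<^sup>2 * indicator {- real N..real N} s)"
        by (intro always_eventually allI monoI) (auto simp: indicator_def)
      show "AE s in \<mu> f. (\<lambda>N. s\<^sup>2 * indicator {- real N..real N} s) \<longlonglongrightarrow> s\<^sup>2"
      proof (intro always_eventually allI)
        fix s
        have "(\<lambda>N. s * Re (cut N s)) \<longlonglongrightarrow> s * Re (of_real s)"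
          by (intro tendsto_intros cut_tendsto)
        then show "(\<lambda>N. s\<^sup>2 * indicator {- real N..real N} s) \<longlonglongrightarrow> s\<^sup>2"
          by (simp add: power2_eq_square mult.assoc)
      qed
    qed measurable
    then show "f \<in> dom" using f by (simp add: dom_iff)
  qed
qed

lemma calc_lin: "bounded_borel \<phi> \<Longrightarrow> f \<in> ell2 m \<Longrightarrow> g \<in> ell2 m \<Longrightarrow>
  calc \<phi> (\<lambda>x. f x + c * g x) = (\<lambda>x. calc \<phi> f x + c * calc \<phi> g x)"
  by (simp add: calc_def pairing_lin_left add_divide_distrib)

lemma dom_lin: assumes "f \<in> dom" "g \<in> dom" shows "(\<lambda>x. f x + c * g x) \<in> dom"
proof -
  note fg = assms[THEN dom_ell2]
  obtain C D where C: "\<And>N. ell2_norm m (calc (cut N) f) \<le> C" and D: "\<And>N. ell2_norm m (calc (cut N) g) \<le> D"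
    using assms dom_iff_bounded fg by metis
  have "ell2_norm m (calc (cut N) (\<lambda>x. f x + c * g x)) \<le> C + cmod c * D" for N
  proof -
    have "ell2_norm m (calc (cut N) (\<lambda>x. f x + c * g x)) \<le> ell2_norm m (calc (cut N) f) + cmod c * ell2_norm m (calc (cut N) g)"
      using norm_add[OF calc_mem[OF bounded_borel_cut fg(1)] scale_mem[OF calc_mem[OF bounded_borel_cut fg(2)]], of N c N]
        norm_scale[OF calc_mem[OF bounded_borel_cut fg(2)], of c N]
      by (simp add: calc_lin fg del: of_real_mult)
    also have "\<dots> \<le> C + cmod c * D" by (intro add_mono mult_left_mono C D) auto
    finally show ?thesis .
  qed
  then show ?thesis using dom_iff_bounded[OF lin_mem[OF fg]] by blast
qed

lemma pairing_id_lim: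
  assumes "f \<in> dom" "g \<in> dom"
  shows "(\<lambda>N. pairing (cut N) f g) \<longlonglongrightarrow> pairing (\<lambda>s. of_real s) f g"
proof -
  have "(\<lambda>N. \<integral>s. cut N s \<partial>\<mu> h) \<longlonglongrightarrow> (\<integral>s. of_real s \<partial>\<mu> h)" if h: "h \<in> dom" for h
  proof (rule integral_dominated_convergence[where w = "\<lambda>s. 1 + s\<^sup>2"])
    interpret finite_measure "\<mu> h" by (rule finite_\<mu>[OF dom_ell2[OF h]])
    show "integrable (\<mu> h) (\<lambda>s. 1 + s\<^sup>2)" using h by (auto simp: dom_iff)
    have "\<bar>s\<bar> \<le> 1 + s\<^sup>2" for s :: real
      using sum_squares_bound[of "\<bar>s\<bar>" 1] by simp
    then show "AE s in \<mu> h. norm (cut N s) \<le> 1 + s\<^sup>2" for N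
      using norm_cut_le order_trans by blast
  qed (use cut_tendsto in auto)
  then show ?thesis unfolding spectral_pairing_def
    by (intro tendsto_intros) (auto intro!: dom_lin assms simp del: of_real_mult)
qed

lemma pairing_id_herm:
  assumes "f \<in> dom" "g \<in> dom"
  shows "pairing (\<lambda>s. of_real s) g f = cnj (pairing (\<lambda>s. of_real s) f g)"
proof (rule LIMSEQ_unique)
  show "(\<lambda>N. pairing (cut N) g f) \<longlonglongrightarrow> pairing (\<lambda>s. of_real s) g f"
    by (rule pairing_id_lim[OF assms(2,1)])
  have "pairing (cut N) g f = cnj (pairing (cut N) f g)" for N
    using pairing_herm[OF bounded_borel_cut, of f g N] assms[THEN dom_ell2] by simp
  then show "(\<lambda>N. pairing (cut N) g f) \<longlonglongrightarrow> cnj (pairing (\<lambda>s. of_real s) f g)"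
    using pairing_id_lim[OF assms] by (simp add: lim_cnj)
qed

text \<open>If \<open>\<psi>\<close> and \<open>s \<psi>(s)\<close> are bounded, \<open>\<psi>(L)\<close> maps into the domain of \<open>L\<close>, and \<open>L \<psi>(L)\<close> is given by
  \<open>s \<psi>(s)\<close>.\<close>

lemma calc_in_spectral_integral:
  assumes \<psi>: "bounded_borel \<psi>" and s\<psi>: "bounded_borel (\<lambda>s. of_real s * \<psi> s)" and f: "f \<in> ell2 m"
  shows "(calc \<psi> f, calc (\<lambda>s. of_real s * \<psi> s) f) \<in> spectral_integral m E (\<lambda>s. of_real s)"
proof -
  let ?u = "calc \<psi> f" and ?h = "calc (\<lambda>s. of_real s * \<psi> s) f"
  have u: "?u \<in> ell2 m" and h: "?h \<in> ell2 m" using \<psi> s\<psi> f by (auto intro: calc_mem)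
  obtain M where M: "0 \<le> M" "\<And>s. cmod (of_real s * \<psi> s) \<le> M" using bounded_borel_bound[OF s\<psi>] by blast
  have b: "cmod (cut N s * \<psi> s) \<le> M" for N s
    using M by (auto simp: indicator_def)
  have bb: "bounded_borel (\<lambda>s. cut N s * \<psi> s)" for N
    by (intro bounded_borel_mult \<psi> bounded_borel_cut)
  have dom: "?u \<in> dom"
  proof (subst dom_iff_bounded[OF u], intro exI allI)
    interpret finite_measure "\<mu> f" by (rule finite_\<mu>[OF f])
    fix N
    have "(ell2_norm m (calc (cut N) ?u))\<^sup>2 = (\<integral>s. (cmod (cut N s * \<psi> s))\<^sup>2 \<partial>\<mu> f)"
      unfolding calc_calc[OF bounded_borel_cut \<psi> f] by (rule norm_calc_sq[OF bb f])
    also have "\<dots> \<le> (\<integral>s. M\<^sup>2 \<partial>\<mu> f)"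
    proof (rule integral_mono)
      have [measurable]: "\<psi> \<in> borel_measurable borel" by (rule bounded_borel_measurable[OF \<psi>])
      show "integrable (\<mu> f) (\<lambda>s. (cmod (cut N s * \<psi> s))\<^sup>2)"
        using power_mono[OF b norm_ge_zero, of _ _ 2] by (intro integrable_const_bound[of _ "M\<^sup>2"]) auto
      show "(cmod (cut N s * \<psi> s))\<^sup>2 \<le> M\<^sup>2" for s by (rule power_mono[OF b]) simp
    qed auto
    also have "\<dots> = M\<^sup>2 * measure (\<mu> f) UNIV" by simp
    finally show "ell2_norm m (calc (cut N) ?u) \<le> sqrt (M\<^sup>2 * measure (\<mu> f) UNIV)"
      by (rule real_le_rsqrt)
  qed
  have "ell2_inner m ?h g = pairing (\<lambda>s. of_real s) ?u g" if g: "g \<in> dom" for g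
  proof -
    have g2: "g \<in> ell2 m" by (rule dom_ell2[OF g])
    have "(\<lambda>N. pairing (cut N) ?u g) \<longlonglongrightarrow> pairing (\<lambda>s. of_real s) ?u g"
      by (rule pairing_id_lim[OF dom g])
    moreover have "(\<lambda>N. pairing (cut N) ?u g) \<longlonglongrightarrow> pairing (\<lambda>s. of_real s * \<psi> s) f g"
      unfolding pairing_calc[OF bounded_borel_cut \<psi> f g2]
      by (intro pairing_lim[OF f g2 bb s\<psi> b] tendsto_intros cut_tendsto)
    ultimately have "pairing (\<lambda>s. of_real s) ?u g = pairing (\<lambda>s. of_real s * \<psi> s) f g"
      by (rule LIMSEQ_unique)
    then show ?thesis using calc_inner[OF s\<psi> f g2] by simp
  qed
  then show ?thesis unfolding spectral_integral_def using dom h by simp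
qed

text \<open>Functions that agree almost everywhere with a bounded one have the same, everywhere defined, operator.\<close>

lemma spectral_integral_AE_bounded:
  assumes \<phi>: "\<phi> \<in> borel_measurable borel" and b: "bounded_borel \<phi>'"
    and ae: "\<And>f. f \<in> ell2 m \<Longrightarrow> AE s in \<mu> f. \<phi> s = \<phi>' s"
  shows "spectral_integral m E \<phi> = {(f, calc \<phi>' f) | f. f \<in> ell2 m}"
proof -
  have int: "(\<integral>s. \<phi> s \<partial>\<mu> f) = (\<integral>s. \<phi>' s \<partial>\<mu> f)" if "f \<in> ell2 m" for f
    using \<phi> bounded_borel_measurable[OF b] ae[OF that] by (intro integral_cong_AE) auto
  have p: "pairing \<phi> f g = pairing \<phi>' f g" if "f \<in> ell2 m" "g \<in> ell2 m" for f g
    unfolding spectral_pairing_def by (simp add: int that mem)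
  have d: "spectral_domain m E \<phi> = ell2 m"
  proof -
    have "integrable (\<mu> f) (\<lambda>s. (cmod (\<phi> s))\<^sup>2)" if f: "f \<in> ell2 m" for f
    proof -
      interpret finite_measure "\<mu> f" by (rule finite_\<mu>[OF f])
      obtain M where M: "\<And>s. cmod (\<phi>' s) \<le> M" using bounded_borel_bound[OF b] by blast
      have "AE s in \<mu> f. norm ((cmod (\<phi> s))\<^sup>2) \<le> M\<^sup>2"
        using ae[OF f] by eventually_elim (auto intro!: power_mono M)
      then show ?thesis using \<phi> by (intro integrable_const_bound) auto
    qed
    then show ?thesis by (auto simp: spectral_domain_def)
  qed
  show ?thesis
  proof safe
    fix f h assume "(f, h) \<in> spectral_integral m E \<phi>"
    then have f: "f \<in> ell2 m" and h: "h \<in> ell2 m" "\<And>g. g \<in> ell2 m \<Longrightarrow> ell2_inner m h g = pairing \<phi>' f g"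
      by (auto simp: spectral_integral_def d p)
    then have "h = calc \<phi>' f"
      by (intro eq_by_delta) (simp add: calc_inner[OF b f] del: inner_delta)
    then show "\<exists>f'. (f, h) = (f', calc \<phi>' f') \<and> f' \<in> ell2 m" using f by auto
  next
    fix f assume "f \<in> ell2 m"
    then show "(f, calc \<phi>' f) \<in> spectral_integral m E \<phi>"
      by (auto simp: spectral_integral_def d p calc_mem[OF b] calc_inner[OF b])
  qed
qed

text \<open>A bounded operator determines its kernel by its action on point masses, and the kernel
  represents the operator because \<open>A f(x)\<close> is the inner product of \<open>f\<close> with the adjoint applied to a
  point mass.\<close>

lemma integral_kernel_calc:
  assumes b: "bounded_borel \<phi>" and A: "\<And>f. f \<in> ell2 m \<Longrightarrow> A f = calc \<phi> f"
  shows "integral_kernel m A = (\<lambda>x y. pairing \<phi> (delta y) (delta x) / of_real (m x * m y))"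
  unfolding integral_kernel_def
proof (rule the_equality)
  show "\<forall>f\<in>ell2 m. \<forall>x. ((\<lambda>y. pairing \<phi> (delta y) (delta x) / of_real (m x * m y) * f y * of_real (m y))
      has_sum A f x) UNIV"
  proof (intro ballI allI)
    fix f x assume f: "f \<in> ell2 m"
    let ?g = "calc (\<lambda>s. cnj (\<phi> s)) (delta x)"
    have g: "?g \<in> ell2 m" by (intro calc_mem bounded_borel_cnj b delta_ell2)
    have gy: "cnj (?g y) = pairing \<phi> (delta y) (delta x) / of_real (m y)" for y
      unfolding calc_def using pairing_herm[OF b, of "delta y" "delta x"] by simp
    have "((\<lambda>y. f y * cnj (?g y) * of_real (m y)) has_sum ell2_inner m f ?g) UNIV"
      unfolding ell2_inner_def by (rule has_sum_infsum[OF ell2_inner_summable[OF f g]])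
    then have "((\<lambda>y. f y * cnj (?g y) * of_real (m y) * inverse (of_real (m x)))
        has_sum ell2_inner m f ?g * inverse (of_real (m x))) UNIV"
      by (rule has_sum_cmult_left)
    moreover have "ell2_inner m f ?g * inverse (of_real (m x)) = A f x"
      using calc_adjoint[OF b f delta_ell2, of x] by (simp add: A[OF f] calc_def divide_inverse)
    ultimately show "((\<lambda>y. pairing \<phi> (delta y) (delta x) / of_real (m x * m y) * f y * of_real (m y))
        has_sum A f x) UNIV"
      unfolding gy by (simp add: field_simps)
  qed
next
  fix k assume k: "\<forall>f\<in>ell2 m. \<forall>x. ((\<lambda>y. k x y * f y * of_real (m y)) has_sum A f x) UNIV"
  show "k = (\<lambda>x y. pairing \<phi> (delta y) (delta x) / of_real (m x * m y))"
  proof (intro ext)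
    fix x y
    have "((\<lambda>z. k x z * delta y z * of_real (m z)) has_sum A (delta y) x) UNIV" using k by simp
    moreover have "((\<lambda>z. k x z * delta y z * of_real (m z)) has_sum k x y * of_real (m y)) UNIV"
      by (rule has_sum_finite_neutralI[of "{y}"]) (auto simp: delta_def)
    ultimately have "k x y * of_real (m y) = A (delta y) x" by (rule has_sum_unique[rotated])
    also have "\<dots> = pairing \<phi> (delta y) (delta x) / of_real (m x)" by (simp add: A calc_def)
    finally show "k x y = pairing \<phi> (delta y) (delta x) / of_real (m x * m y)"
      by (simp add: field_simps)
  qed
qed

end

section \<open>The Hausdorff moment problem\<close>

text \<open>Iterating \<open>d k l = d (k + 1) l + d k (l + 1)\<close> distributes \<open>d k l\<close> according to Pascal's triangle.\<close>

lemma pascal_expansion: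
  fixes d :: "nat \<Rightarrow> nat \<Rightarrow> real"
  assumes rec: "\<And>k l. d k l = d (Suc k) l + d k (Suc l)"
  shows "(\<Sum>i\<le>n. of_nat (n choose i) * d (k + i) (l + (n - i))) = d k l"
proof (induction n arbitrary: k l)
  case (Suc n)
  have "(\<Sum>i\<le>Suc n. of_nat (Suc n choose i) * d (k + i) (l + (Suc n - i)))
      = d k (l + Suc n) + (\<Sum>i\<le>n. of_nat (Suc n choose Suc i) * d (k + Suc i) (l + (n - i)))"
    by (subst sum.atMost_Suc_shift) simp
  also have "(\<Sum>i\<le>n. of_nat (Suc n choose Suc i) * d (k + Suc i) (l + (n - i)))
      = (\<Sum>i\<le>n. of_nat (n choose i) * d (Suc k + i) (l + (n - i)))
        + (\<Sum>i\<le>n. of_nat (n choose Suc i) * d (k + Suc i) (l + (n - i)))"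
    by (simp add: sum.distrib[symmetric] algebra_simps)
  also have "(\<Sum>i\<le>n. of_nat (n choose i) * d (Suc k + i) (l + (n - i))) = d (Suc k) l"
    by (rule Suc.IH)
  also have "d k (l + Suc n) + (d (Suc k) l + (\<Sum>i\<le>n. of_nat (n choose Suc i) * d (k + Suc i) (l + (n - i))))
      = d (Suc k) l + (\<Sum>i\<le>Suc n. of_nat (n choose i) * d (k + i) (Suc l + (n - i)))"
  proof -
    have "(\<Sum>i\<le>Suc n. of_nat (n choose i) * d (k + i) (Suc l + (n - i)))
        = d k (Suc l + n) + (\<Sum>i\<le>n. of_nat (n choose Suc i) * d (k + Suc i) (Suc l + (n - Suc i)))"
      by (subst sum.atMost_Suc_shift) simp
    also have "(\<Sum>i\<le>n. of_nat (n choose Suc i) * d (k + Suc i) (Suc l + (n - Suc i)))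
        = (\<Sum>i\<le>n. of_nat (n choose Suc i) * d (k + Suc i) (l + (n - i)))"
    proof (rule sum.cong)
      fix i assume "i \<in> {..n}"
      then show "of_nat (n choose Suc i) * d (k + Suc i) (Suc l + (n - Suc i))
          = of_nat (n choose Suc i) * d (k + Suc i) (l + (n - i))"
        by (cases "i = n") (auto simp: Suc_diff_Suc le_neq_implies_less)
    qed simp
    finally show ?thesis by simp
  qed
  also have "(\<Sum>i\<le>Suc n. of_nat (n choose i) * d (k + i) (Suc l + (n - i))) = d k (Suc l)"
    using Suc.IH[of k "Suc l"] by simp
  finally show ?case using rec[of k l] by simp
qed simp

lemma abs_prod_diff_le:
  fixes f g :: "nat \<Rightarrow> real"
  assumes "\<And>i. i < j \<Longrightarrow> \<bar>f i\<bar> \<le> 1" "\<And>i. i < j \<Longrightarrow> \<bar>g i\<bar> \<le> 1"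
  shows "\<bar>(\<Prod>i<j. f i) - (\<Prod>i<j. g i)\<bar> \<le> (\<Sum>i<j. \<bar>f i - g i\<bar>)"
  using norm_prod_diff[of "{..<j}" f g] assms by simp

lemma choose_ratio:
  assumes "j \<le> n" shows "real (k choose j) / real (n choose j) = (\<Prod>i<j. (real k - real i) / (real n - real i))"
proof -
  have "real (k choose j) / real (n choose j)
      = (\<Prod>i<j. real k - real i) / (\<Prod>i<j. real n - real i)"
    unfolding binomial_gbinomial gbinomial_prod_rev by (simp add: atLeast0LessThan)
  then show ?thesis by (simp add: prod_dividef)
qed

text \<open>The ratio is a product of factors \<open>(k - i) / (n - i)\<close>, each within \<open>2 j / n\<close> of \<open>k / n\<close>.\<close>

lemma choose_ratio_approx:
  assumes k: "k \<le> n" and n: "2 * j < n"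
  shows "\<bar>real (k choose j) / real (n choose j) - (real k / real n) ^ j\<bar> \<le> real j * real j * 2 / real n"
proof (cases "j \<le> k")
  case True
  have b1: "\<bar>(real k - real i) / (real n - real i)\<bar> \<le> 1" if "i < j" for i
    using that True k n by (auto simp: divide_simps)
  have b2: "\<bar>real k / real n\<bar> \<le> 1" using k n by auto
  have d: "\<bar>(real k - real i) / (real n - real i) - real k / real n\<bar> \<le> real j * 2 / real n" if i: "i < j" for i
  proof -
    have p: "real n - real i \<ge> real n / 2" "real n > 0" "real n - real i > 0" using i n by linarith+
    have "(real k - real i) / (real n - real i) - real k / real n
        = - (real i * (real n - real k) / (real n * (real n - real i)))"
      using p by (simp add: field_simps)
    then have "\<bar>(real k - real i) / (real n - real i) - real k / real n\<bar>
        = real i * (real n - real k) / (real n * (real n - real i))"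
      using p k by (simp add: abs_mult)
    also have "\<dots> \<le> real j * real n / (real n * (real n / 2))"
      using p k i by (intro frac_le mult_mono mult_pos_pos) auto
    also have "\<dots> = real j * 2 / real n" using p by simp
    finally show ?thesis .
  qed
  have "(real k / real n) ^ j = (\<Prod>i<j. real k / real n)" by simp
  then have "\<bar>real (k choose j) / real (n choose j) - (real k / real n) ^ j\<bar>
      = \<bar>(\<Prod>i<j. (real k - real i) / (real n - real i)) - (\<Prod>i<j. real k / real n)\<bar>"
    using choose_ratio[of j n k] n by simp
  also have "\<dots> \<le> (\<Sum>i<j. \<bar>(real k - real i) / (real n - real i) - real k / real n\<bar>)"
    using b1 b2 by (intro abs_prod_diff_le) auto
  also have "\<dots> \<le> (\<Sum>i<j. real j * 2 / real n)" by (intro sum_mono d) auto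
  finally show ?thesis by simp
next
  case False
  then have kj: "k < j" by simp
  have "(real k / real n) ^ j \<le> (real k / real n) ^ 1"
    using kj k n by (intro power_decreasing) auto
  also have "\<dots> \<le> real j * real j * 2 / real n"
  proof -
    have "real k \<le> real j * 1" using kj by simp
    also have "real j * 1 \<le> real j * (real j * 2)" using kj by (intro mult_left_mono) auto
    finally show ?thesis using n by (simp add: divide_right_mono mult.assoc)
  qed
  finally show ?thesis using kj k n by (simp add: binomial_eq_0)
qed

text \<open>Place the mass \<open>C(n,k) d k (n - k)\<close> at \<open>k/n\<close>. The factorial moments of these distributions are
  exactly the numbers \<open>d j 0\<close>, and for large \<open>n\<close> they are close to the moments. A weak limit exists
  by tightness.\<close>

lemma Hausdorff_moment_normalized:
  fixes d :: "nat \<Rightarrow> nat \<Rightarrow> real"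
  assumes rec: "\<And>k l. d k l = d (Suc k) l + d k (Suc l)" and pos: "\<And>k l. 0 \<le> d k l" and one: "d 0 0 = 1"
  shows "\<exists>M. real_distribution M \<and> (AE x in M. x \<in> {0..1}) \<and> (\<forall>j. (\<integral>x. x ^ j \<partial>M) = d j 0)"
proof -
  define w where "w n k = of_nat (n choose k) * d k (n - k)" for n k
  have w0: "0 \<le> w n k" for n k using pos by (simp add: w_def)
  have fm: "(\<Sum>k\<le>n. w n k * (real (k choose j) / real (n choose j))) = d j 0" if j: "j \<le> n" for n j
  proof -
    have "(\<Sum>k\<le>n. w n k * (real (k choose j) / real (n choose j)))
        = (\<Sum>k\<in>{j..n}. w n k * (real (k choose j) / real (n choose j)))"
      by (rule sum.mono_neutral_right) auto
    also have "\<dots> = (\<Sum>k\<in>{j..n}. real ((n - j) choose (k - j)) * d k (n - k))"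
    proof (rule sum.cong)
      fix k assume k: "k \<in> {j..n}"
      have "(n choose k) * (k choose j) = (n choose j) * ((n - j) choose (k - j))"
        using k by (intro choose_mult) auto
      then have "real (n choose k) * real (k choose j) = real (n choose j) * real ((n - j) choose (k - j))"
        by (metis of_nat_mult)
      moreover have "real (n choose j) \<noteq> 0" using j by simp
      ultimately show "w n k * (real (k choose j) / real (n choose j)) = real ((n - j) choose (k - j)) * d k (n - k)"
        unfolding w_def by (simp add: divide_simps) 
    qed simp
    also have "\<dots> = (\<Sum>i\<le>n - j. real ((n - j) choose i) * d (j + i) (0 + (n - j - i)))"
      by (rule sum.reindex_bij_witness[of _ "\<lambda>i. i + j" "\<lambda>k. k - j"]) (use j in auto)
    also have "\<dots> = d j 0" by (rule pascal_expansion[of d, OF rec])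
    finally show ?thesis .
  qed
  define M where "M n = distr (point_measure {..n} (\<lambda>k. ennreal (w n k))) borel (\<lambda>k. real k / real n)" for n
  have meas: "(\<lambda>k. real k / real n) \<in> measurable (point_measure {..n} (\<lambda>k. ennreal (w n k))) borel" for n
    by (simp add: measurable_point_measure_eq1)
  have int: "(\<integral>x. h x \<partial>M n) = (\<Sum>k\<le>n. w n k * h (real k / real n))"
    if [measurable]: "h \<in> borel_measurable borel" for h :: "real \<Rightarrow> real" and n
    unfolding M_def by (subst integral_distr[OF meas that], subst lebesgue_integral_point_measure_finite) (auto simp: w0)
  have em: "emeasure (M n) UNIV = 1" for n
  proof -
    have "emeasure (M n) UNIV = (\<Sum>k\<le>n. ennreal (w n k))"
      unfolding M_def by (subst emeasure_distr[OF meas])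
        (auto simp: space_point_measure emeasure_point_measure_finite)
    also have "\<dots> = ennreal (\<Sum>k\<le>n. w n k)" using w0 by (rule sum_ennreal)
    also have "(\<Sum>k\<le>n. w n k) = 1" using fm[of 0 n] one by simp
    finally show ?thesis by simp
  qed
  have rd: "real_distribution (M n)" for n
    by (intro real_distribution.intro prob_spaceI real_distribution_axioms.intro) (use em in \<open>auto simp: M_def\<close>)
  have "tight M" unfolding tight_def
  proof (intro conjI allI impI rd)
    fix e :: real assume e: "e > 0"
    have "measure (M n) {-1<..1} = 1" for n
    proof -
      interpret real_distribution "M n" by (rule rd)
      have "measure (M n) {-1<..1} = (\<integral>x. indicator {-1<..1} x \<partial>M n)" by simp
      also have "\<dots> = (\<Sum>k\<le>n. w n k * indicator {-1<..1} (real k / real n))"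
        by (rule int) measurable
      also have "\<dots> = (\<Sum>k\<le>n. w n k)"
        by (intro sum.cong) (auto simp: indicator_def divide_le_eq intro: less_le_trans[of "-1" 0])
      finally show ?thesis using fm[of 0 n] one by simp
    qed
    then show "\<exists>a b. a < b \<and> (\<forall>n. measure (M n) {a<..b} > 1 - e)"
      using e by (intro exI[of _ "-1"] exI[of _ 1]) auto
  qed
  from tight_imp_convergent_subsubsequence[OF this strict_mono_id]
  obtain r N where r: "strict_mono r" and N: "real_distribution N" and wc: "weak_conv_m (M \<circ> id \<circ> r) N"
    by blast
  interpret N: real_distribution N by (rule N)
  have wlim: "(\<lambda>n. \<integral>x. h x \<partial>M (r n)) \<longlonglongrightarrow> (\<integral>x. h x \<partial>N)"
    if "\<And>x. isCont h x" "\<And>x. \<bar>h x\<bar> \<le> B" for h :: "real \<Rightarrow> real" and B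
    using weak_conv_imp_integral_bdd_continuous_conv[OF _ N wc, of h B] rd that by simp
  define c where "c x = max 0 (min 1 x)" for x :: real
  have cc: "isCont c x" for x unfolding c_def by (intro continuous_intros)
  have cm [measurable]: "c \<in> borel_measurable borel" unfolding c_def by measurable
  have ck: "c (real k / real n) = real k / real n" if "k \<le> n" for k n
    using that by (auto simp: c_def divide_le_eq)
  have supp: "AE x in N. x \<in> {0..1}"
  proof -
    define h where "h x = min 1 \<bar>x - c x\<bar>" for x
    have hm [measurable]: "h \<in> borel_measurable borel" unfolding h_def by measurable
    have "(\<lambda>n. \<integral>x. h x \<partial>M (r n)) \<longlonglongrightarrow> (\<integral>x. h x \<partial>N)"
      by (rule wlim[of _ 1]) (auto simp: h_def intro!: continuous_intros cc)
    moreover have "(\<integral>x. h x \<partial>M n) = 0" for n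
      unfolding int[OF hm] using ck by (intro sum.neutral) (auto simp: h_def)
    ultimately have "(\<integral>x. h x \<partial>N) = 0" by (simp add: LIMSEQ_const_iff)
    moreover have "integrable N h"
      by (rule N.integrable_const_bound[of _ 1]) (auto simp: h_def)
    ultimately have "AE x in N. h x = 0"
      by (subst (asm) integral_nonneg_eq_0_iff_AE) (auto simp: h_def)
    then show ?thesis by eventually_elim (auto simp: h_def c_def split: if_splits)
  qed
  have mom: "(\<integral>x. x ^ j \<partial>N) = d j 0" for j
  proof -
    have b: "\<bar>c x ^ j\<bar> \<le> 1" for x by (auto simp: c_def power_abs intro!: power_le_one)
    have "(\<integral>x. x ^ j \<partial>N) = (\<integral>x. c x ^ j \<partial>N)"
      by (rule integral_cong_AE) (use supp in \<open>auto simp: c_def\<close>)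
    moreover have "(\<lambda>n. \<integral>x. c x ^ j \<partial>M (r n)) \<longlonglongrightarrow> (\<integral>x. c x ^ j \<partial>N)"
      by (rule wlim[OF _ b]) (intro continuous_intros cc)
    moreover have "(\<lambda>n. \<integral>x. c x ^ j \<partial>M (r n)) \<longlonglongrightarrow> d j 0"
    proof -
      have bound: "\<bar>(\<integral>x. c x ^ j \<partial>M n) - d j 0\<bar> \<le> real j * real j * 2 / real n" if n: "2 * j < n" for n
      proof -
        have "(\<integral>x. c x ^ j \<partial>M n) = (\<Sum>k\<le>n. w n k * c (real k / real n) ^ j)"
          by (rule int) measurable
        also have "\<dots> = (\<Sum>k\<le>n. w n k * (real k / real n) ^ j)"
          by (rule sum.cong) (auto simp: ck)
        finally have "\<bar>(\<integral>x. c x ^ j \<partial>M n) - d j 0\<bar>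
            = \<bar>\<Sum>k\<le>n. w n k * ((real k / real n) ^ j - real (k choose j) / real (n choose j))\<bar>"
          using fm[of j n] n by (simp add: sum_subtractf right_diff_distrib)
        also have "\<dots> \<le> (\<Sum>k\<le>n. \<bar>w n k * ((real k / real n) ^ j - real (k choose j) / real (n choose j))\<bar>)"
          by (rule sum_abs)
        also have "\<dots> \<le> (\<Sum>k\<le>n. w n k * (real j * real j * 2 / real n))"
        proof (rule sum_mono)
          fix k assume "k \<in> {..n}"
          then show "\<bar>w n k * ((real k / real n) ^ j - real (k choose j) / real (n choose j))\<bar>
              \<le> w n k * (real j * real j * 2 / real n)"
            using choose_ratio_approx[of k n j] n w0[of n k]
            unfolding abs_mult abs_of_nonneg[OF w0] by (intro mult_left_mono) (auto simp: abs_minus_commute)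
        qed
        also have "\<dots> = (\<Sum>k\<le>n. w n k) * (real j * real j * 2 / real n)"
          by (rule sum_distrib_right[symmetric])
        also have "(\<Sum>k\<le>n. w n k) = 1" using fm[of 0 n] one by simp
        finally show ?thesis by simp
      qed
      have "(\<lambda>n. real j * real j * 2 / real n) \<longlonglongrightarrow> 0" by (rule lim_const_over_n)
      then have "(\<lambda>n. (\<integral>x. c x ^ j \<partial>M n) - d j 0) \<longlonglongrightarrow> 0"
        by (rule Lim_null_comparison[rotated])
           (use bound in \<open>auto simp: eventually_sequentially intro!: exI[of _ "Suc (2 * j)"]\<close>)
      then have "(\<lambda>n. \<integral>x. c x ^ j \<partial>M n) \<longlonglongrightarrow> d j 0" by (simp add: LIM_zero_iff)
      from LIMSEQ_subseq_LIMSEQ[OF this r] show ?thesis by (simp add: comp_def)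
    qed
    ultimately show ?thesis by (metis LIMSEQ_unique)
  qed
  show ?thesis using N supp mom by blast
qed

theorem Hausdorff_moment:
  fixes d :: "nat \<Rightarrow> nat \<Rightarrow> real"
  assumes rec: "\<And>k l. d k l = d (Suc k) l + d k (Suc l)" and pos: "\<And>k l. 0 \<le> d k l"
  shows "\<exists>M. finite_measure M \<and> sets M = sets borel \<and> (AE x in M. x \<in> {0..1}) \<and> (\<forall>j. (\<integral>x. x ^ j \<partial>M) = d j 0)"
proof (cases "d 0 0 = 0")
  case True
  have "d j 0 = 0" for j
  proof (induction j)
    case (Suc j)
    then show ?case using rec[of j 0] pos[of "Suc j" 0] pos[of j "Suc 0"] by simp
  qed (rule True)
  moreover have "finite_measure (null_measure (borel :: real measure))"
    by (rule finite_measureI) simp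
  moreover have "AE x in null_measure borel. x \<in> {0..1::real}"
    by (rule AE_I[of _ _ UNIV]) auto
  moreover have "integral\<^sup>L (null_measure borel) f = 0" for f :: "real \<Rightarrow> real"
  proof -
    have "AE x in null_measure (borel :: real measure). f x = 0" by (rule AE_I[of _ _ UNIV]) auto
    then show ?thesis by (rule integral_eq_zero_AE)
  qed
  ultimately show ?thesis by (intro exI[of _ "null_measure borel"]) simp
next
  case False
  define c where "c = d 0 0"
  have c: "c > 0" using False pos[of 0 0] by (simp add: c_def)
  have "\<exists>M. real_distribution M \<and> (AE x in M. x \<in> {0..1}) \<and> (\<forall>j. (\<integral>x. x ^ j \<partial>M) = d j 0 / c)"
    using c pos by (intro Hausdorff_moment_normalized[of "\<lambda>k l. d k l / c"])
      (auto simp: c_def add_divide_distrib[symmetric] rec[symmetric])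
  then obtain M where M: "real_distribution M" "AE x in M. x \<in> {0..1}" "\<And>j. (\<integral>x. x ^ j \<partial>M) = d j 0 / c"
    by blast
  interpret M: real_distribution M by (rule M)
  let ?M = "density M (\<lambda>_. ennreal c)"
  have "finite_measure ?M"
  proof (rule finite_measureI)
    show "emeasure ?M (space ?M) \<noteq> \<infinity>"
      using M.emeasure_space_1 by (simp add: emeasure_density nn_integral_cmult_indicator)
  qed
  moreover have "AE x in ?M. x \<in> {0..1}" using M(2) by (subst AE_density) auto
  moreover have "(\<integral>x. x ^ j \<partial>?M) = d j 0" for j
    using c M(3) by (subst integral_density) auto
  ultimately show ?thesis by (intro exI[of _ ?M]) simp
qed

text \<open>Polynomials are dense in the continuous functions on \<open>[0, 1]\<close>, these approximate indicators of
  half-lines, and the half-lines generate the Borel sets.\<close>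

lemma moments_determine:
  fixes \<mu> :: "'j \<Rightarrow> real measure" and w :: "'j \<Rightarrow> real \<Rightarrow> complex"
  assumes J: "finite J"
    and fin: "\<And>j. j \<in> J \<Longrightarrow> finite_measure (\<mu> j)" and sets: "\<And>j. j \<in> J \<Longrightarrow> sets (\<mu> j) = sets borel"
    and ae: "\<And>j. j \<in> J \<Longrightarrow> AE x in \<mu> j. x \<in> {0..1}" and w: "\<And>j. j \<in> J \<Longrightarrow> bounded_borel (w j)"
    and mom: "\<And>n. (\<Sum>j\<in>J. \<integral>x. of_real x ^ n * w j x \<partial>\<mu> j) = 0"
    and B: "B \<in> sets borel"
  shows "(\<Sum>j\<in>J. \<integral>x. indicator B x * w j x \<partial>\<mu> j) = 0"
proof -
  define S where "S \<phi> = (\<Sum>j\<in>J. \<integral>x. of_real (\<phi> x) * w j x \<partial>\<mu> j)" for \<phi> :: "real \<Rightarrow> real"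
  have msr: "(\<lambda>x. of_real (\<phi> x) * w j x) \<in> borel_measurable (\<mu> j)"
    if "j \<in> J" "\<phi> \<in> borel_measurable borel" for j and \<phi> :: "real \<Rightarrow> real"
  proof -
    have [measurable]: "w j \<in> borel_measurable borel" "\<phi> \<in> borel_measurable borel"
      using bounded_borel_measurable[OF w[OF that(1)]] that(2) by auto
    have "(\<lambda>x. of_real (\<phi> x) * w j x) \<in> borel_measurable borel" by measurable
    then show ?thesis using measurable_cong_sets[OF sets[OF that(1)] refl] by blast
  qed
  have bnd: "\<exists>W\<ge>0. \<forall>j\<in>J. \<forall>x. cmod (w j x) \<le> W"
  proof -
    have "\<forall>j\<in>J. \<exists>W. 0 \<le> W \<and> (\<forall>x. cmod (w j x) \<le> W)" using w bounded_borel_bound by metis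
    then obtain W where W: "\<And>j. j \<in> J \<Longrightarrow> 0 \<le> W j \<and> (\<forall>x. cmod (w j x) \<le> W j)" by metis
    have "cmod (w j x) \<le> (\<Sum>j\<in>J. W j)" if "j \<in> J" for j x
      using W[OF that] member_le_sum[of j J W] W J that by (meson DiffD1 order_trans)
    moreover have "0 \<le> (\<Sum>j\<in>J. W j)" using W by (intro sum_nonneg) auto
    ultimately show ?thesis by blast
  qed
  then obtain W where W: "W \<ge> 0" "\<And>j x. j \<in> J \<Longrightarrow> cmod (w j x) \<le> W" by blast
  have intg: "integrable (\<mu> j) (\<lambda>x. of_real (\<phi> x) * w j x)"
    if "j \<in> J" "\<phi> \<in> borel_measurable borel" "\<And>x. x \<in> {0..1} \<Longrightarrow> \<bar>\<phi> x\<bar> \<le> K" for j K and \<phi> :: "real \<Rightarrow> real"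
  proof -
    interpret finite_measure "\<mu> j" by (rule fin[OF that(1)])
    have K: "0 \<le> K" using that(3)[of 0] by auto
    have "AE x in \<mu> j. norm (of_real (\<phi> x) * w j x) \<le> K * W"
      using ae[OF that(1)] by eventually_elim (use that W K in \<open>auto simp: norm_mult intro!: mult_mono\<close>)
    then show ?thesis by (rule integrable_const_bound) (rule msr[OF that(1,2)])
  qed
  have S_diff: "S (\<lambda>x. \<phi> x - \<psi> x) = S \<phi> - S \<psi>"
    if "\<phi> \<in> borel_measurable borel" "\<And>x. x \<in> {0..1} \<Longrightarrow> \<bar>\<phi> x\<bar> \<le> K"
      "\<psi> \<in> borel_measurable borel" "\<And>x. x \<in> {0..1} \<Longrightarrow> \<bar>\<psi> x\<bar> \<le> K" for \<phi> \<psi> K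
    unfolding S_def sum_subtractf[symmetric]
  proof (rule sum.cong)
    fix j assume j: "j \<in> J"
    show "(\<integral>x. of_real (\<phi> x - \<psi> x) * w j x \<partial>\<mu> j)
        = (\<integral>x. of_real (\<phi> x) * w j x \<partial>\<mu> j) - (\<integral>x. of_real (\<psi> x) * w j x \<partial>\<mu> j)"
      using Bochner_Integration.integral_diff[OF intg[OF j that(1,2)] intg[OF j that(3,4)]]
      by (simp add: algebra_simps)
  qed simp
  have S_sum: "S (\<lambda>x. \<Sum>i\<in>I. \<phi> i x) = (\<Sum>i\<in>I. S (\<phi> i))"
    if "\<And>i. i \<in> I \<Longrightarrow> \<phi> i \<in> borel_measurable borel" "\<And>i x. i \<in> I \<Longrightarrow> x \<in> {0..1} \<Longrightarrow> \<bar>\<phi> i x\<bar> \<le> K i"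
    for \<phi> :: "nat \<Rightarrow> real \<Rightarrow> real" and I K
    unfolding S_def
  proof (subst sum.swap, rule sum.cong)
    fix j assume j: "j \<in> J"
    have "(\<integral>x. (\<Sum>i\<in>I. of_real (\<phi> i x) * w j x) \<partial>\<mu> j) = (\<Sum>i\<in>I. \<integral>x. of_real (\<phi> i x) * w j x \<partial>\<mu> j)"
      using intg[OF j that] by (intro Bochner_Integration.integral_sum)
    then show "(\<integral>x. of_real (\<Sum>i\<in>I. \<phi> i x) * w j x \<partial>\<mu> j) = (\<Sum>i\<in>I. \<integral>x. of_real (\<phi> i x) * w j x \<partial>\<mu> j)"
      by (simp add: sum_distrib_right)
  qed simp
  have S_lim: "(\<lambda>n. S (\<Phi> n)) \<longlonglongrightarrow> S \<phi>"
    if "\<And>n. \<Phi> n \<in> borel_measurable borel" "\<phi> \<in> borel_measurable borel" "\<And>n x. \<bar>\<Phi> n x\<bar> \<le> K"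
      "\<And>x. (\<lambda>n. \<Phi> n x) \<longlonglongrightarrow> \<phi> x" for \<Phi> \<phi> K
    unfolding S_def
  proof (intro tendsto_sum)
    fix j assume j: "j \<in> J"
    interpret finite_measure "\<mu> j" by (rule fin[OF j])
    have K: "0 \<le> K" using that(3)[of 0 0] by linarith
    show "(\<lambda>n. \<integral>x. of_real (\<Phi> n x) * w j x \<partial>\<mu> j) \<longlonglongrightarrow> (\<integral>x. of_real (\<phi> x) * w j x \<partial>\<mu> j)"
    proof (rule integral_dominated_convergence[where w = "\<lambda>_. K * W"])
      show "AE x in \<mu> j. norm (of_real (\<Phi> n x) * w j x) \<le> K * W" for n
        using that(3) W j K by (auto simp: norm_mult intro!: mult_mono)
    qed (use msr[OF j] that in \<open>auto intro!: tendsto_intros\<close>)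
  qed
  have S_bound: "cmod (S \<phi>) \<le> K * (\<Sum>j\<in>J. W * measure (\<mu> j) UNIV)"
    if "\<phi> \<in> borel_measurable borel" "\<And>x. x \<in> {0..1} \<Longrightarrow> \<bar>\<phi> x\<bar> \<le> K" for \<phi> K
    unfolding S_def sum_distrib_left
  proof (rule sum_norm_le)
    fix j assume j: "j \<in> J"
    interpret finite_measure "\<mu> j" by (rule fin[OF j])
    have K: "0 \<le> K" using that(2)[of 0] by auto
    have i: "integrable (\<mu> j) (\<lambda>x. norm (of_real (\<phi> x) * w j x))"
      using intg[OF j that] by (rule integrable_norm)
    have "norm (\<integral>x. of_real (\<phi> x) * w j x \<partial>\<mu> j) \<le> (\<integral>x. norm (of_real (\<phi> x) * w j x) \<partial>\<mu> j)"
      by (rule integral_norm_bound)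
    also have "\<dots> \<le> (\<integral>x. K * W \<partial>\<mu> j)"
    proof (rule integral_mono_AE[OF i])
      show "AE x in \<mu> j. norm (of_real (\<phi> x) * w j x) \<le> K * W"
        using ae[OF j] by eventually_elim (use that W j K in \<open>auto simp: norm_mult intro!: mult_mono\<close>)
    qed simp
    also have "\<dots> = K * (W * measure (\<mu> j) UNIV)"
      using sets_eq_imp_space_eq[OF sets[OF j]] by simp
    finally show "norm (\<integral>x. of_real (\<phi> x) * w j x \<partial>\<mu> j) \<le> K * (W * measure (\<mu> j) UNIV)" .
  qed
  have S_power: "S (\<lambda>x. a * x ^ n) = 0" for a n
    using mom[of n] unfolding S_def by (simp add: mult.assoc sum_distrib_left[symmetric])
  have S_poly: "S (\<lambda>x. \<Sum>i\<le>n. a i * x ^ i) = 0" for a :: "nat \<Rightarrow> real" and n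
    by (subst S_sum[where K = "\<lambda>i. \<bar>a i\<bar>"])
       (auto simp: S_power abs_mult power_abs intro!: mult_left_le power_le_one)
  have S_cont: "S f = 0" if f: "continuous_on UNIV f" for f
  proof -
    have fm: "f \<in> borel_measurable borel" using f by (rule borel_measurable_continuous_onI)
    have bd: "\<exists>K. \<forall>x\<in>{0..1::real}. \<bar>g x\<bar> \<le> K" if "continuous_on {0..1} g" for g :: "real \<Rightarrow> real"
    proof -
      have "bounded (g ` {0..1})" using that by (intro compact_imp_bounded compact_continuous_image) auto
      then show ?thesis by (auto simp: bounded_iff)
    qed
    have "cmod (S f) \<le> 0 + e" if e: "e > 0" for e
    proof -
      define T where "T = (\<Sum>j\<in>J. W * measure (\<mu> j) UNIV)"
      have T: "T \<ge> 0" using W unfolding T_def by (intro sum_nonneg) auto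
      have f01: "continuous_on {0..1} f" using f by (rule continuous_on_subset) simp
      obtain g where g: "real_polynomial_function g" "\<And>x. x \<in> {0..1} \<Longrightarrow> \<bar>f x - g x\<bar> < e / (T + 1)"
        using Stone_Weierstrass_real_polynomial_function[OF _ f01, of "e / (T + 1)"] e T by auto
      obtain a n where ga: "g = (\<lambda>x. \<Sum>i\<le>n. a i * x ^ i)"
        using g(1) real_polynomial_function_iff_sum by blast
      have gm: "g \<in> borel_measurable borel" unfolding ga by measurable
      have gc: "continuous_on {0..1} g" unfolding ga by (intro continuous_intros)
      obtain K where K: "\<And>x. x \<in> {0..1} \<Longrightarrow> \<bar>f x\<bar> \<le> K" using bd[OF f01] by blast
      obtain L where L: "\<And>x. x \<in> {0..1} \<Longrightarrow> \<bar>g x\<bar> \<le> L" using bd[OF gc] by blast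
      have "S f = S (\<lambda>x. f x - g x)"
      proof -
        have "S (\<lambda>x. f x - g x) = S f - S g"
          using fm gm K L by (intro S_diff[of _ "max K L"]) (auto simp: le_max_iff_disj)
        then show ?thesis using S_poly unfolding ga by simp
      qed
      also have "cmod \<dots> \<le> e / (T + 1) * T"
        unfolding T_def by (rule S_bound) (use fm gm g(2) in \<open>auto simp: T_def intro: less_imp_le\<close>)
      also have "\<dots> \<le> e" using e T by (simp add: field_simps)
      finally show ?thesis by simp
    qed
    then show ?thesis using field_le_epsilon[of "cmod (S f)" 0] by auto
  qed
  have S_half: "S (indicator {..a}) = 0" for a
  proof -
    have c: "continuous_on UNIV (cts_step a (a + 1 / real (Suc n)))" for n
      by (intro uniformly_continuous_imp_continuous cts_step_uniformly_continuous) simp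
    have "(\<lambda>n. S (cts_step a (a + 1 / real (Suc n)))) \<longlonglongrightarrow> S (indicator {..a})"
    proof (rule S_lim[of _ _ 1])
      show "cts_step a (a + 1 / real (Suc n)) \<in> borel_measurable borel" for n
        using c by (rule borel_measurable_continuous_onI)
      show "\<bar>cts_step a (a + 1 / real (Suc n)) x\<bar> \<le> 1" for n x
        by (auto simp: cts_step_def divide_simps)
      show "(\<lambda>n. cts_step a (a + 1 / real (Suc n)) x) \<longlonglongrightarrow> indicator {..a} x" for x
      proof (cases "x \<le> a")
        case False
        then obtain n0 where "1 / real (Suc n0) < x - a"
          using nat_approx_posE[of "x - a"] by auto
        then have "cts_step a (a + 1 / real (Suc n)) x = 0" if "n \<ge> n0" for n
          using that False frac_le[of 1 1 "real (Suc n0)" "real (Suc n)"] by (auto simp: cts_step_def)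
        then show ?thesis using False
          by (intro tendsto_eventually) (auto simp: eventually_sequentially indicator_def)
      qed (simp add: cts_step_def)
    qed simp
    then show ?thesis using S_cont[OF c] by (simp add: LIMSEQ_const_iff)
  qed
  have "Int_stable (range (\<lambda>a::real. {..a}))" by (auto simp: Int_stable_def)
  moreover have "range (\<lambda>a::real. {..a}) \<subseteq> Pow UNIV" by simp
  moreover have "B \<in> sigma_sets UNIV (range (\<lambda>a::real. {..a}))"
    using B by (simp add: borel_eq_atMost)
  ultimately have "S (indicator B) = 0"
  proof (induction rule: sigma_sets_induct_disjoint)
    case (basic A)
    then show ?case using S_half by auto
  next
    case empty
    show ?case by (simp add: S_def)
  next
    case (compl A)
    have A: "A \<in> sets borel" using compl(1) by (simp add: borel_eq_atMost)
    have "S (\<lambda>x. 1 - indicator A x) = S (\<lambda>_. 1) - S (indicator A)"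
      by (rule S_diff[of _ 1]) (use A in \<open>auto simp: indicator_def\<close>)
    moreover have "(\<lambda>x. 1 - indicator A x) = (indicator (UNIV - A) :: real \<Rightarrow> real)"
      by (auto simp: indicator_def)
    ultimately show ?case using compl(2) S_power[of 1 0] by simp
  next
    case (union A)
    have A: "A i \<in> sets borel" for i using union(2) by (auto simp: borel_eq_atMost)
    have "(\<lambda>n. S (\<lambda>x. \<Sum>i<n. indicator (A i) x)) \<longlonglongrightarrow> S (indicator (\<Union>i. A i))"
    proof (rule S_lim[of _ _ 1])
      have ind: "(\<Sum>i<n. indicator (A i) x) = (indicator (\<Union>i<n. A i) x :: real)" for n x
        using union(1) by (subst indicator_UN_disjoint) (auto simp: disjoint_family_on_def)
      show "\<bar>\<Sum>i<n. indicator (A i) x\<bar> \<le> (1::real)" for n x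
        unfolding ind by (simp add: indicator_def)
      show "(\<lambda>n. \<Sum>i<n. indicator (A i) x) \<longlonglongrightarrow> (indicator (\<Union>i. A i) x :: real)" for x
        unfolding ind by (rule LIMSEQ_indicator_UN)
    qed (use A in auto)
    moreover have "S (\<lambda>x. \<Sum>i<n. indicator (A i) x) = 0" for n
    proof -
      have "S (\<lambda>x. \<Sum>i<n. indicator (A i) x) = (\<Sum>i<n. S (indicator (A i)))"
        by (rule S_sum[where K = "\<lambda>_. 1"]) (use A in \<open>auto simp: indicator_def\<close>)
      then show ?thesis using union(3) by simp
    qed
    ultimately show ?case by (simp add: LIMSEQ_const_iff)
  qed
  moreover have "(\<lambda>x. complex_of_real (indicator B x)) = indicator B" by (auto simp: indicator_def)
  ultimately show ?thesis unfolding S_def by (simp add: fun_eq_iff)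
qed

section \<open>The spectral measure of a positive contraction\<close>

locale positive_contraction = weights m for m :: "'x \<Rightarrow> real" +
  fixes R :: "('x \<Rightarrow> complex) \<Rightarrow> 'x \<Rightarrow> complex"
  assumes R_mem: "f \<in> ell2 m \<Longrightarrow> R f \<in> ell2 m"
    and R_sym: "f \<in> ell2 m \<Longrightarrow> g \<in> ell2 m \<Longrightarrow> ell2_inner m (R f) g = ell2_inner m f (R g)"
    and R_pos: "f \<in> ell2 m \<Longrightarrow> 0 \<le> Re (ell2_inner m (R f) f)"
    and R_le: "f \<in> ell2 m \<Longrightarrow> Re (ell2_inner m (R f) f) \<le> (ell2_norm m f)\<^sup>2"
begin

lemma R_lin:
  assumes "f \<in> ell2 m" "g \<in> ell2 m"
  shows "R (\<lambda>x. f x + c * g x) = (\<lambda>x. R f x + c * R g x)"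
  by (rule eq_by_delta) (use assms in \<open>simp add: R_sym lin_left R_mem mem del: inner_delta\<close>)

lemma pow_mem: "f \<in> ell2 m \<Longrightarrow> (R ^^ n) f \<in> ell2 m"
  by (induction n) (auto simp: R_mem)

lemma pow_lin:
  assumes "f \<in> ell2 m" "g \<in> ell2 m"
  shows "(R ^^ n) (\<lambda>x. f x + c * g x) = (\<lambda>x. (R ^^ n) f x + c * (R ^^ n) g x)"
  using assms by (induction n) (auto simp: R_lin pow_mem)

lemma pow_sym:
  assumes "f \<in> ell2 m" "g \<in> ell2 m"
  shows "ell2_inner m ((R ^^ n) f) g = ell2_inner m f ((R ^^ n) g)"
  using assms(2)
proof (induction n arbitrary: g)
  case (Suc n)
  have "ell2_inner m ((R ^^ Suc n) f) g = ell2_inner m ((R ^^ n) f) (R g)"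
    using assms(1) Suc.prems by (simp add: R_sym pow_mem)
  also have "\<dots> = ell2_inner m f ((R ^^ n) (R g))" by (rule Suc.IH[OF R_mem[OF Suc.prems]])
  also have "(R ^^ n) (R g) = (R ^^ Suc n) g" by (simp add: funpow_swap1)
  finally show ?case .
qed simp

definition co :: "('x \<Rightarrow> complex) \<Rightarrow> 'x \<Rightarrow> complex" where
  "co f = (\<lambda>x. f x - R f x)"

lemma co_mem: "f \<in> ell2 m \<Longrightarrow> co f \<in> ell2 m"
  unfolding co_def by (intro diff_mem R_mem)

lemma co_pow_mem: "f \<in> ell2 m \<Longrightarrow> (co ^^ n) f \<in> ell2 m"
  by (induction n) (auto simp: co_mem)

lemma co_sym: "f \<in> ell2 m \<Longrightarrow> g \<in> ell2 m \<Longrightarrow> ell2_inner m (co f) g = ell2_inner m f (co g)"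
  by (simp add: co_def diff_left diff_right R_mem R_sym)

lemma R_co: "f \<in> ell2 m \<Longrightarrow> R (co f) = co (R f)"
  using R_lin[of f "R f" "-1"] by (simp add: co_def R_mem)

lemma R_co_pow: "f \<in> ell2 m \<Longrightarrow> R ((co ^^ n) f) = (co ^^ n) (R f)"
  by (induction n) (auto simp: R_co co_pow_mem)

lemma co_R_pow: "f \<in> ell2 m \<Longrightarrow> (R ^^ n) (co f) = co ((R ^^ n) f)"
  by (induction n) (auto simp: R_co pow_mem)

text \<open>The moment sequence \<open>moments f k 0\<close> is that of the sought measure \<open>\<langle>E(\<cdot>)f, f\<rangle>\<close> on \<open>[0, 1]\<close>.\<close>

definition moments :: "('x \<Rightarrow> complex) \<Rightarrow> nat \<Rightarrow> nat \<Rightarrow> real" where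
  "moments f k l = Re (ell2_inner m ((R ^^ k) ((co ^^ l) f)) f)"

lemma moments_rec:
  assumes f: "f \<in> ell2 m" shows "moments f k l = moments f (Suc k) l + moments f k (Suc l)"
proof -
  let ?g = "(co ^^ l) f"
  have g: "?g \<in> ell2 m" by (rule co_pow_mem[OF f])
  have "(R ^^ k) (co ?g) = (\<lambda>x. (R ^^ k) ?g x - (R ^^ Suc k) ?g x)"
    using co_R_pow[OF g] by (simp add: co_def)
  then show ?thesis
    unfolding moments_def using f g pow_mem[OF g, of "Suc k"]
    by (simp add: diff_left pow_mem)
qed

text \<open>\<open>R\<^sup>2\<close> and \<open>(1 - R)\<^sup>2\<close> can be absorbed into the vector, and
  \<open>R (1 - R) = R (1 - R) R + (1 - R) R (1 - R)\<close>.\<close>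

lemma moments_nonneg: "f \<in> ell2 m \<Longrightarrow> 0 \<le> moments f k l"
proof (induction "k + l" arbitrary: k l f rule: less_induct)
  case less
  note f = less(2)
  have kk: "moments f (Suc (Suc k)) l = moments (R f) k l" for k l
  proof -
    have "moments f (Suc (Suc k)) l = Re (ell2_inner m ((R ^^ k) (R ((co ^^ l) f))) (R f))"
    proof -
      have "(R ^^ Suc (Suc k)) ((co ^^ l) f) = R ((R ^^ k) (R ((co ^^ l) f)))"
        by (simp add: funpow_swap1)
      then show ?thesis
        unfolding moments_def using f by (simp only: R_sym pow_mem co_pow_mem R_mem)
    qed
    then show ?thesis by (simp add: moments_def R_co_pow[OF f])
  qed
  have ll: "moments f k (Suc (Suc l)) = moments (co f) k l" for k l
  proof -
    have "moments f k (Suc (Suc l)) = Re (ell2_inner m (co ((R ^^ k) ((co ^^ l) (co f)))) f)"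
      unfolding moments_def using f co_R_pow[OF co_pow_mem[OF co_mem[OF f]], of k l]
      by (simp add: funpow_swap1)
    also have "\<dots> = moments (co f) k l"
      using f by (simp add: moments_def co_sym pow_mem co_pow_mem co_mem)
    finally show ?thesis .
  qed
  have m10: "0 \<le> moments g 1 0" and m01: "0 \<le> moments g 0 1" if g: "g \<in> ell2 m" for g
    using R_pos[OF g] R_le[OF g] norm_sq[OF g] by (simp_all add: moments_def co_def diff_left R_mem g)
  have m11: "0 \<le> moments f 1 1"
  proof -
    have "moments f 1 1 = moments f 2 1 + moments f 1 2"
      using moments_rec[OF f, of 1 1] by (simp add: numeral_2_eq_2)
    also have "\<dots> = moments (R f) 0 1 + moments (co f) 1 0"
      using kk[of 0 1] ll[of 1 0] by (simp add: numeral_2_eq_2)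
    finally show ?thesis using m01[OF R_mem[OF f]] m10[OF co_mem[OF f]] by simp
  qed
  consider k' where "k = Suc (Suc k')" | l' where "l = Suc (Suc l')" | "k \<in> {0,1}" "l \<in> {0,1}"
  proof -
    have "(\<exists>k'. n = Suc (Suc k')) \<or> n \<in> {0,1}" for n
      by (cases n; cases "n - 1") auto
    then show thesis using that by blast
  qed
  then show ?case
  proof cases
    case 1
    then show ?thesis using less(1)[of k' l "R f"] R_mem[OF f] kk by simp
  next
    case 2
    then show ?thesis using less(1)[of k l' "co f"] co_mem[OF f] ll by simp
  next
    case 3
    have "0 \<le> moments f 0 0" using pos[OF f] by (simp add: moments_def)
    then show ?thesis using 3 m10[OF f] m01[OF f] m11 by auto
  qed
qed

definition \<nu> :: "('x \<Rightarrow> complex) \<Rightarrow> real measure" where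
  "\<nu> f = (SOME M. finite_measure M \<and> sets M = sets borel \<and> (AE x in M. x \<in> {0..1}) \<and>
      (\<forall>j. (\<integral>x. x ^ j \<partial>M) = moments f j 0))"

lemma
  assumes "f \<in> ell2 m"
  shows finite_\<nu>: "finite_measure (\<nu> f)" and sets_\<nu>: "sets (\<nu> f) = sets borel"
    and AE_\<nu>: "AE x in \<nu> f. x \<in> {0..1}" and moments_\<nu>: "(\<integral>x. x ^ j \<partial>\<nu> f) = moments f j 0"
  using someI_ex[OF Hausdorff_moment[of "moments f", OF moments_rec[OF assms] moments_nonneg[OF assms]]]
  unfolding \<nu>_def[symmetric] by auto

lemma AE_\<nu>_bounds: "f \<in> ell2 m \<Longrightarrow> AE x in \<nu> f. 0 \<le> x" "f \<in> ell2 m \<Longrightarrow> AE x in \<nu> f. x \<le> 1"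
  using AE_\<nu>[of f] by auto

lemma space_\<nu>: "f \<in> ell2 m \<Longrightarrow> space (\<nu> f) = UNIV"
  using sets_eq_imp_space_eq[OF sets_\<nu>] by simp

lemma pow_real: "f \<in> ell2 m \<Longrightarrow> ell2_inner m ((R ^^ n) f) f = of_real (moments f n 0)"
  using pow_sym[of f f n] herm[of f "(R ^^ n) f"] pow_mem[of f n]
  by (simp add: moments_def complex_eq_iff)

lemma moments_\<nu>_complex: "f \<in> ell2 m \<Longrightarrow> (\<integral>x. of_real x ^ n \<partial>\<nu> f) = ell2_inner m ((R ^^ n) f) f"
proof -
  assume f: "f \<in> ell2 m"
  have "(\<integral>x. of_real x ^ n \<partial>\<nu> f) = (\<integral>x. complex_of_real (x ^ n) \<partial>\<nu> f)" by simp
  also have "\<dots> = of_real (\<integral>x. x ^ n \<partial>\<nu> f)" by (rule integral_complex_of_real)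
  finally show ?thesis by (simp only: moments_\<nu>[OF f] pow_real[OF f])
qed

text \<open>The integral of \<open>w\<close> with respect to the complex measure \<open>\<langle>E(\<cdot>)u, v\<rangle>\<close> that is to be constructed.\<close>

definition pp :: "(real \<Rightarrow> complex) \<Rightarrow> 'x form" where
  "pp w u v = (\<Sum>k<4. \<i> ^ k * (\<integral>x. w x \<partial>\<nu> (\<lambda>x. u x + \<i> ^ k * v x))) / 4"

lemma pp_scale: "pp (\<lambda>x. c * w x) u v = c * pp w u v"
  unfolding pp_def by (simp add: sum_distrib_left mult.left_commute)

lemma pp_moment: "u \<in> ell2 m \<Longrightarrow> v \<in> ell2 m \<Longrightarrow> pp (\<lambda>x. of_real x ^ n) u v = ell2_inner m ((R ^^ n) u) v"
proof -
  assume u: "u \<in> ell2 m" and v: "v \<in> ell2 m"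
  interpret n: semi_inner "ell2 m" "\<lambda>f g. ell2_inner m ((R ^^ n) f) g"
  proof
    show "ell2_inner m ((R ^^ n) g) f = cnj (ell2_inner m ((R ^^ n) f) g)" if "f \<in> ell2 m" "g \<in> ell2 m" for f g
      using that herm[of "(R ^^ n) f" g] by (simp add: pow_sym pow_mem)
    show "0 \<le> Re (ell2_inner m ((R ^^ n) f) f)" if "f \<in> ell2 m" for f
      using moments_nonneg[OF that, of n 0] by (simp add: moments_def)
  qed (auto simp: mem pow_lin pow_mem lin_left)
  show ?thesis unfolding pp_def by (subst n.polarization[OF u v]) (simp add: moments_\<nu>_complex mem u v)
qed

lemma pp_cong:
  assumes u: "u \<in> ell2 m" and v: "v \<in> ell2 m" and w: "w \<in> borel_measurable borel" "w' \<in> borel_measurable borel"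
    and eq: "\<And>x. x \<in> {0..1} \<Longrightarrow> w x = w' x"
  shows "pp w u v = pp w' u v"
proof -
  have "(\<integral>x. w x \<partial>\<nu> h) = (\<integral>x. w' x \<partial>\<nu> h)" if h: "h \<in> ell2 m" for h
  proof (rule integral_cong_AE)
    show "AE x in \<nu> h. w x = w' x" using AE_\<nu>[OF h] by eventually_elim (rule eq)
  qed (use w measurable_cong_sets[OF sets_\<nu>[OF h] refl] in blast)+
  then show ?thesis unfolding pp_def using u v by (simp add: mem)
qed

text \<open>Powers, cut off to the support of the measures so that they are bounded.\<close>

definition clamped :: "nat \<Rightarrow> real \<Rightarrow> complex" where
  "clamped n x = of_real x ^ n * indicator {0..1} x"

lemma bounded_clamped [simp]: "bounded_borel (clamped n)"
proof (rule bounded_borelI[of _ 1])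
  show "cmod (clamped n x) \<le> 1" for x
    by (auto simp: clamped_def indicator_def norm_mult norm_power intro: power_le_one)
qed (unfold clamped_def, measurable)

lemmas clamped_measurable [measurable] = bounded_borel_measurable[OF bounded_clamped]

text \<open>Linear relations between the measures \<open>\<langle>E(\<cdot>)u, v\<rangle>\<close>, with weights, may be verified on monomials, where they
  are identities between powers of \<open>R\<close>. All algebraic properties of \<open>E\<close> are obtained from this.\<close>

lemma pp_determine:
  assumes J: "finite J" and u: "\<And>j. j \<in> J \<Longrightarrow> u j \<in> ell2 m" and v: "\<And>j. j \<in> J \<Longrightarrow> v j \<in> ell2 m"
    and w: "\<And>j. j \<in> J \<Longrightarrow> bounded_borel (w j)"
    and mom: "\<And>n. (\<Sum>j\<in>J. pp (\<lambda>x. of_real x ^ n * w j x) (u j) (v j)) = 0" and B: "B \<in> sets borel"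
  shows "(\<Sum>j\<in>J. pp (\<lambda>x. indicator B x * w j x) (u j) (v j)) = 0"
proof -
  let ?\<mu> = "\<lambda>(j, k). \<nu> (\<lambda>x. u j x + \<i> ^ k * v j x)" and ?w = "\<lambda>(j, k) x. \<i> ^ k / 4 * w j x"
  have eq: "(\<Sum>j\<in>J. pp (\<lambda>x. h x * w j x) (u j) (v j))
      = (\<Sum>jk\<in>J \<times> {..<4::nat}. \<integral>x. h x * ?w jk x \<partial>?\<mu> jk)" for h
  proof -
    have "(\<Sum>jk\<in>J \<times> {..<4::nat}. \<integral>x. h x * ?w jk x \<partial>?\<mu> jk)
        = (\<Sum>j\<in>J. \<Sum>k<4. \<integral>x. \<i> ^ k / 4 * (h x * w j x) \<partial>\<nu> (\<lambda>x. u j x + \<i> ^ k * v j x))"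
      by (simp add: sum.cartesian_product' case_prod_beta mult_ac)
    then show ?thesis unfolding pp_def by (simp only: integral_mult_right_zero sum_divide_distrib) simp
  qed
  show ?thesis unfolding eq
  proof (rule moments_determine[OF _ _ _ _ _ _ B])
    show "(\<Sum>jk\<in>J \<times> {..<4::nat}. \<integral>x. of_real x ^ n * ?w jk x \<partial>?\<mu> jk) = 0" for n
      unfolding eq[symmetric] by (rule mom)
    show "bounded_borel (?w jk)" if "jk \<in> J \<times> {..<4}" for jk
      using that w bounded_borel_mult[OF bounded_borel_const[of "\<i> ^ snd jk / 4"], of "w (fst jk)"]
      by (auto simp only: case_prod_beta mem_Times_iff)
  qed (use J u v w in \<open>auto simp: mem finite_\<nu> sets_\<nu> AE_\<nu>_bounds\<close>)
qed

lemma pp_eq: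
  assumes mem': "u \<in> ell2 m" "v \<in> ell2 m" "u' \<in> ell2 m" "v' \<in> ell2 m"
    and w: "bounded_borel w" "bounded_borel w'"
    and mom: "\<And>n. pp (\<lambda>x. of_real x ^ n * w x) u v = pp (\<lambda>x. of_real x ^ n * w' x) u' v'"
    and B: "B \<in> sets borel"
  shows "pp (\<lambda>x. indicator B x * w x) u v = pp (\<lambda>x. indicator B x * w' x) u' v'"
proof -
  have neg: "pp (\<lambda>x. - h x) u' v' = - pp h u' v'" for h
    using pp_scale[of "-1" h u' v'] by simp
  have "bounded_borel (\<lambda>x. - w' x)"
    using bounded_borel_mult[OF bounded_borel_const[of "-1"] w(2)] by simp
  then have "(\<Sum>j\<in>{0, 1::nat}. pp (\<lambda>x. indicator B x * (if j = 0 then w x else - w' x))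
      (if j = 0 then u else u') (if j = 0 then v else v')) = 0"
    by (intro pp_determine[OF _ _ _ _ _ B]) (use mem' w mom in \<open>auto simp: neg\<close>)
  then show ?thesis by (simp add: neg)
qed

context
  fixes B :: "real set" assumes B: "B \<in> sets borel"
begin

definition "pB = pp (\<lambda>x. indicator B x)"

lemma pB_lin_left:
  assumes "f \<in> ell2 m" "g \<in> ell2 m" "h \<in> ell2 m"
  shows "pB (\<lambda>x. f x + c * g x) h = pB f h + c * pB g h"
proof -
  let ?w = "\<lambda>j::nat. if j = 0 then 1 else if j = 1 then - 1 else - c"
  let ?u = "\<lambda>j::nat. if j = 0 then (\<lambda>x. f x + c * g x) else if j = 1 then f else g"
  have sc: "pp (\<lambda>x. k x * ?w j) u v = ?w j * pp k u v" for k j u v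
    using pp_scale[of "?w j" k u v] by (simp only: mult.commute)
  have "(\<Sum>j\<in>{0, 1, 2}. pp (\<lambda>x. indicator B x * ?w j) (?u j) h) = 0"
    by (rule pp_determine[OF _ _ _ _ _ B])
       (use assms in \<open>simp_all only: sc, auto simp: mem pp_moment pow_lin pow_mem lin_left\<close>)
  then show ?thesis unfolding sc pB_def by (simp add: algebra_simps)
qed

lemma pB_lin_right:
  assumes "f \<in> ell2 m" "g \<in> ell2 m" "h \<in> ell2 m"
  shows "pB h (\<lambda>x. f x + c * g x) = pB h f + cnj c * pB h g"
proof -
  let ?w = "\<lambda>j::nat. if j = 0 then 1 else if j = 1 then - 1 else - cnj c"
  let ?u = "\<lambda>j::nat. if j = 0 then (\<lambda>x. f x + c * g x) else if j = 1 then f else g"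
  have sc: "pp (\<lambda>x. k x * ?w j) u v = ?w j * pp k u v" for k j u v
    using pp_scale[of "?w j" k u v] by (simp only: mult.commute)
  have "(\<Sum>j\<in>{0, 1, 2}. pp (\<lambda>x. indicator B x * ?w j) h (?u j)) = 0"
    by (rule pp_determine[OF _ _ _ _ _ B])
       (use assms in \<open>simp_all only: sc, auto simp: mem pp_moment pow_mem lin_right\<close>)
  then show ?thesis unfolding sc pB_def by (simp add: algebra_simps)
qed

lemma pB_self:
  assumes f: "f \<in> ell2 m" shows "pB f f = of_real (measure (\<nu> f) B)"
proof -
  let ?w = "\<lambda>j::nat. if j < 4 then \<i> ^ j / 4 else - 1"
  let ?u = "\<lambda>j::nat. if j < 4 then (\<lambda>x. f x + \<i> ^ j * f x) else f"
  have eq: "(\<Sum>j\<in>{..4}. \<integral>x. h x * ?w j \<partial>\<nu> (?u j)) = pp h f f - (\<integral>x. h x \<partial>\<nu> f)" for h :: "real \<Rightarrow> complex"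
    unfolding pp_def by (simp add: eval_nat_numeral atMost_Suc lessThan_Suc add_divide_distrib algebra_simps diff_divide_distrib)
  have "(\<Sum>j\<in>{..4}. \<integral>x. indicator B x * ?w j \<partial>\<nu> (?u j)) = 0"
  proof (rule moments_determine[OF _ _ _ _ _ _ B])
    show "(\<Sum>j\<in>{..4}. \<integral>x. of_real x ^ n * ?w j \<partial>\<nu> (?u j)) = 0" for n
      unfolding eq by (simp add: pp_moment moments_\<nu>_complex f)
  qed (use f in \<open>auto simp: mem finite_\<nu> sets_\<nu> AE_\<nu>_bounds\<close>)
  then have "pB f f = (\<integral>x. indicator B x \<partial>\<nu> f)" unfolding eq pB_def by simp
  also have "\<dots> = of_real (measure (\<nu> f) B)"
    using B by (intro integral_indicator_complex) (simp add: sets_\<nu> f)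
  finally show ?thesis .
qed

text \<open>A sesquilinear form that is real on the diagonal is Hermitian.\<close>

lemma pB_herm: assumes f: "f \<in> ell2 m" and g: "g \<in> ell2 m" shows "pB g f = cnj (pB f g)"
proof -
  have ex: "pB (\<lambda>x. f x + c * g x) (\<lambda>x. f x + c * g x) = pB f f + (cnj c * pB f g + c * pB g f + c * cnj c * pB g g)" for c
    using f g by (simp add: pB_lin_left pB_lin_right mem algebra_simps)
  have im: "Im (pB h h) = 0" if "h \<in> ell2 m" for h using pB_self[OF that] by simp
  have "Im (cnj c * pB f g + c * pB g f + c * cnj c * pB g g) = 0" for c
    using im[OF lin_mem[OF f g, of c]] im[OF f] unfolding ex by (simp only: plus_complex.sel)
  from this[of 1] this[of \<i>] show ?thesis
    using pB_self[OF g] by (simp add: complex_eq_iff)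
qed

lemma pB_semi_inner: "semi_inner (ell2 m) pB"
proof
  show "pB g f = cnj (pB f g)" if "f \<in> ell2 m" "g \<in> ell2 m" for f g by (rule pB_herm[OF that])
qed (auto simp: mem pB_lin_left pB_self)

lemma measure_\<nu>_le: "f \<in> ell2 m \<Longrightarrow> measure (\<nu> f) B \<le> (ell2_norm m f)\<^sup>2"
proof -
  assume f: "f \<in> ell2 m"
  interpret finite_measure "\<nu> f" by (rule finite_\<nu>[OF f])
  have "measure (\<nu> f) B \<le> measure (\<nu> f) UNIV"
    using bounded_measure[of B] space_\<nu>[OF f] by simp
  also have "\<dots> = (\<integral>x. x ^ 0 \<partial>\<nu> f)" using space_\<nu>[OF f] by simp
  also have "\<dots> = (ell2_norm m f)\<^sup>2" by (simp only: moments_\<nu>[OF f]) (simp add: moments_def norm_sq[OF f])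
  finally show ?thesis .
qed

text \<open>The projection \<open>E(B)\<close> is the operator of the bounded form \<open>pB\<close>.\<close>

definition "EB f = (\<lambda>x. pB f (delta x) / of_real (m x))"

lemma
  assumes f: "f \<in> ell2 m"
  shows EB_mem: "EB f \<in> ell2 m" and EB_inner: "g \<in> ell2 m \<Longrightarrow> ell2_inner m (EB f) g = pB f g"
proof -
  interpret b: semi_inner "ell2 m" pB by (rule pB_semi_inner)
  have bd: "b.seminorm f \<le> ell2_norm m f" if "f \<in> ell2 m" for f
    using measure_\<nu>_le[OF that] by (simp add: b.seminorm_def pB_self[OF that] real_le_lsqrt)
  have 1: "cmod (pB f g) \<le> ell2_norm m f * ell2_norm m g" if g: "g \<in> ell2 m" for g
    using b.Cauchy_Schwarz[OF f g] mult_mono[OF bd[OF f] bd[OF g]] g by simp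
  note R = Riesz[of "pB f", OF 1 _ pB_lin_right[OF _ _ f]]
  show "EB f \<in> ell2 m" unfolding EB_def by (rule R(1)) auto
  show "g \<in> ell2 m \<Longrightarrow> ell2_inner m (EB f) g = pB f g" unfolding EB_def by (rule R(3)) auto
qed

lemma EB_lin: "f \<in> ell2 m \<Longrightarrow> g \<in> ell2 m \<Longrightarrow> EB (\<lambda>x. c * f x + d * g x) = (\<lambda>x. c * EB f x + d * EB g x)"
  using pB_lin_left[of "\<lambda>x. c * f x" g _ d] pB_lin_left[of "\<lambda>_. 0" f _ c] pB_lin_left[of "\<lambda>_. 0" "\<lambda>_. 0" _ 1]
  by (simp add: EB_def mem add_divide_distrib)

lemma EB_sym: "f \<in> ell2 m \<Longrightarrow> g \<in> ell2 m \<Longrightarrow> ell2_inner m (EB f) g = ell2_inner m f (EB g)"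
  using herm[of "EB g" f] by (simp add: EB_inner EB_mem pB_herm[of g f])

lemma pB_pow:
  assumes f: "f \<in> ell2 m" and g: "g \<in> ell2 m"
  shows "pB ((R ^^ n) f) g = pp (\<lambda>x. indicator B x * clamped n x) f g"
proof -
  have "pp (\<lambda>x. indicator B x * 1) ((R ^^ n) f) g = pp (\<lambda>x. indicator B x * clamped n x) f g"
  proof (rule pp_eq[OF _ _ _ _ _ _ _ B])
    fix k
    have "pp (\<lambda>x. of_real x ^ k * clamped n x) f g = pp (\<lambda>x. of_real x ^ (k + n)) f g"
      by (rule pp_cong) (use f g in \<open>auto simp: clamped_def power_add\<close>)
    then show "pp (\<lambda>x. of_real x ^ k * 1) ((R ^^ n) f) g = pp (\<lambda>x. of_real x ^ k * clamped n x) f g"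
      using f g by (simp add: pp_moment pow_mem funpow_add)
  qed (use f g in \<open>auto simp: pow_mem\<close>)
  then show ?thesis by (simp add: pB_def)
qed

lemma pow_EB:
  assumes f: "f \<in> ell2 m" and g: "g \<in> ell2 m"
  shows "ell2_inner m ((R ^^ n) (EB f)) g = pB ((R ^^ n) f) g"
proof -
  have "pp (\<lambda>x. indicator B x * 1) f ((R ^^ n) g) = pp (\<lambda>x. indicator B x * 1) ((R ^^ n) f) g"
  proof (rule pp_eq[OF _ _ _ _ _ _ _ B])
    fix k
    have "(R ^^ n) ((R ^^ k) f) = (R ^^ k) ((R ^^ n) f)"
      by (metis add.commute comp_apply funpow_add)
    then show "pp (\<lambda>x. of_real x ^ k * 1) f ((R ^^ n) g) = pp (\<lambda>x. of_real x ^ k * 1) ((R ^^ n) f) g"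
      using f g by (simp add: pp_moment pow_mem pow_sym[symmetric])
  qed (use f g in \<open>auto simp: pow_mem\<close>)
  then show ?thesis using f g by (simp add: pB_def pow_sym EB_mem EB_inner pow_mem)
qed

text \<open>Since \<open>R\<close> commutes with \<open>E(B)\<close>, the measure \<open>\<langle>E(\<cdot>)E(B)f, g\<rangle>\<close> and the restriction of \<open>\<langle>E(\<cdot>)f, g\<rangle>\<close> to \<open>B\<close>
  have the same moments.\<close>

lemma EB_idem: fixes f :: "'x \<Rightarrow> complex" assumes f: "f \<in> ell2 m" shows "EB (EB f) = EB f"
proof (rule eq_by_delta)
  fix x :: 'x
  let ?g = "delta x"
  have "pp (\<lambda>x. indicator B x * 1) (EB f) ?g = pp (\<lambda>x. indicator B x * indicator B x) f ?g"
  proof (rule pp_eq[OF _ _ _ _ _ _ _ B])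
    fix k
    have "pp (\<lambda>x. of_real x ^ k * 1) (EB f) ?g = pp (\<lambda>x. indicator B x * clamped k x) f ?g"
      using f by (simp add: pp_moment EB_mem pow_EB pB_pow del: inner_delta)
    also have "\<dots> = pp (\<lambda>x. of_real x ^ k * indicator B x) f ?g"
      by (rule pp_cong) (use f B in \<open>auto simp: clamped_def\<close>)
    finally show "pp (\<lambda>x. of_real x ^ k * 1) (EB f) ?g = pp (\<lambda>x. of_real x ^ k * indicator B x) f ?g" .
  qed (use f B in \<open>auto simp: EB_mem\<close>)
  moreover have "(\<lambda>x. indicator B x * indicator B x) = (indicator B :: real \<Rightarrow> complex)"
    by (auto simp: indicator_def)
  ultimately show "ell2_inner m (EB (EB f)) ?g = ell2_inner m (EB f) ?g"
    using f by (simp add: EB_inner EB_mem pB_def del: inner_delta)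
qed

lemma EB_projection: "orthogonal_projection m EB"
  by (simp add: orthogonal_projection_def EB_mem EB_lin EB_idem EB_sym)

lemma norm_EB: assumes f: "f \<in> ell2 m" shows "(ell2_norm m (EB f))\<^sup>2 = measure (\<nu> f) B"
proof -
  have "of_real ((ell2_norm m (EB f))\<^sup>2) = ell2_inner m (EB (EB f)) f"
    using inner_self[OF EB_mem[OF f]] EB_sym[OF EB_mem[OF f] f] by simp
  also have "\<dots> = of_real (measure (\<nu> f) B)"
    using EB_inner[OF f f] by (simp only: EB_idem[OF f] pB_self[OF f])
  finally show ?thesis by (simp only: of_real_eq_iff)
qed

lemma pB_measure:
  assumes "f \<in> ell2 m" "g \<in> ell2 m"
  shows "pB f g = (\<Sum>k<4. \<i> ^ k * of_real (measure (\<nu> (\<lambda>x. f x + \<i> ^ k * g x)) B)) / 4"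
proof -
  have "(\<integral>x. indicator B x \<partial>\<nu> h) = complex_of_real (measure (\<nu> h) B)" if "h \<in> ell2 m" for h
    using B that by (intro integral_indicator_complex) (simp add: sets_\<nu>)
  then show ?thesis unfolding pB_def pp_def using assms by (simp add: mem)
qed

end

lemma EB_UNIV: assumes f: "f \<in> ell2 m" shows "EB UNIV f = f"
proof (rule eq_by_delta)
  fix x
  show "ell2_inner m (EB UNIV f) (delta x) = ell2_inner m f (delta x)"
    using pp_moment[OF f delta_ell2, of 0 x] EB_inner[of UNIV f "delta x"] f by (simp add: pB_def)
qed

lemma EB_countable:
  assumes A: "\<And>n. A n \<in> sets borel" and dis: "disjoint_family A" and f: "f \<in> ell2 m"
  shows "(\<lambda>N. ell2_norm m (\<lambda>x. EB (\<Union>n. A n) f x - (\<Sum>n<N. EB (A n) f x))) \<longlonglongrightarrow> 0"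
proof -
  let ?U = "\<Union>n. A n"
  define C where "C N = ?U - (\<Union>n<N. A n)" for N :: nat
  have C: "C N \<in> sets borel" for N unfolding C_def using A by auto
  have U: "?U \<in> sets borel" using A by auto
  have ms: "measure (\<nu> h) (C N) = measure (\<nu> h) ?U - (\<Sum>n<N. measure (\<nu> h) (A n))" if h: "h \<in> ell2 m" for h N
  proof -
    interpret finite_measure "\<nu> h" by (rule finite_\<nu>[OF h])
    have "measure (\<nu> h) (C N) = measure (\<nu> h) ?U - measure (\<nu> h) (\<Union>n<N. A n)"
      unfolding C_def by (rule finite_measure_Diff) (use A U in \<open>auto simp: sets_\<nu>[OF h]\<close>)
    also have "measure (\<nu> h) (\<Union>n<N. A n) = (\<Sum>n<N. measure (\<nu> h) (A n))"
      by (rule finite_measure_finite_Union)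
         (use A dis in \<open>auto simp: sets_\<nu>[OF h] disjoint_family_on_def\<close>)
    finally show ?thesis .
  qed
  have p: "pB (C N) f g = pB ?U f g - (\<Sum>n<N. pB (A n) f g)" if g: "g \<in> ell2 m" for g N
  proof -
    have s: "(\<Sum>n<N. pB (A n) f g)
        = (\<Sum>k<4. \<i> ^ k * (\<Sum>n<N. of_real (measure (\<nu> (\<lambda>x. f x + \<i> ^ k * g x)) (A n)))) / 4"
      unfolding pB_measure[OF A f g] sum_divide_distrib[symmetric] sum_distrib_left
      by (subst sum.swap) simp
    show ?thesis
      unfolding s pB_measure[OF C f g] pB_measure[OF U f g] ms[OF lin_mem[OF f g]]
      by (simp add: diff_divide_distrib sum_subtractf right_diff_distrib)
  qed
  have "(\<lambda>x. EB ?U f x - (\<Sum>n<N. EB (A n) f x)) = EB (C N) f" for N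
    using p[OF delta_ell2, of N] by (auto simp: fun_eq_iff EB_def[OF C] EB_def[OF U] EB_def[OF A] diff_divide_distrib sum_divide_distrib)
  moreover have "(\<lambda>N. ell2_norm m (EB (C N) f)) \<longlonglongrightarrow> 0"
  proof -
    interpret finite_measure "\<nu> f" by (rule finite_\<nu>[OF f])
    have "(\<lambda>n. measure (\<nu> f) (A n)) sums measure (\<nu> f) ?U"
      by (rule finite_measure_UNION) (use A dis in \<open>auto simp: sets_\<nu>[OF f]\<close>)
    then have "(\<lambda>N. measure (\<nu> f) ?U - (\<Sum>n<N. measure (\<nu> f) (A n))) \<longlonglongrightarrow> measure (\<nu> f) ?U - measure (\<nu> f) ?U"
      unfolding sums_def by (intro tendsto_intros)
    then have "(\<lambda>N. sqrt ((ell2_norm m (EB (C N) f))\<^sup>2)) \<longlonglongrightarrow> sqrt 0"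
      unfolding norm_EB[OF C f] ms[OF f] by (intro tendsto_intros) simp
    then show ?thesis by simp
  qed
  ultimately show ?thesis by simp
qed

lemma EB_pvm: "projection_valued_measure m EB"
  unfolding projection_valued_measure_def
  using EB_projection EB_UNIV EB_countable by simp

sublocale calc: spectral_calc m EB
  by unfold_locales (rule EB_pvm)

text \<open>On the range of \<open>E({0})\<close> the operator \<open>R\<close> vanishes.\<close>

lemma no_atom_at_zero:
  assumes inj: "\<And>f. f \<in> ell2 m \<Longrightarrow> R f = (\<lambda>_. 0) \<Longrightarrow> f = (\<lambda>_. 0)" and f: "f \<in> ell2 m"
  shows "AE x in \<nu> f. x \<in> {0<..1}"
proof -
  interpret finite_measure "\<nu> f" by (rule finite_\<nu>[OF f])
  let ?u = "EB {0} f"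
  have u: "?u \<in> ell2 m" by (rule EB_mem[OF _ f]) simp
  interpret u: finite_measure "\<nu> ?u" by (rule finite_\<nu>[OF u])
  have "EB (- {0}) ?u = (\<lambda>_. 0)" by (rule calc.E_orth) (use f in auto)
  then have "measure (\<nu> ?u) (- {0}) = 0"
    using norm_EB[OF _ u, of "- {0}"] by (simp add: ell2_norm_def)
  then have "AE x in \<nu> ?u. x = 0"
    by (intro AE_I[of _ _ "- {0}"]) (auto simp: u.emeasure_eq_measure sets_\<nu>[OF u])
  then have "(\<integral>x. x ^ 2 \<partial>\<nu> ?u) = 0"
    by (intro integral_eq_zero_AE) auto
  then have "moments ?u 2 0 = 0" using moments_\<nu>[OF u, of 2] by simp
  then have "Re (ell2_inner m (R ?u) (R ?u)) = 0"
    using u by (simp add: moments_def numeral_2_eq_2 R_sym R_mem)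
  then have "ell2_norm m (R ?u) = 0" using norm_sq[OF R_mem[OF u]] by simp
  then have "?u = (\<lambda>_. 0)" using inj[OF u] norm_zero_imp[OF R_mem[OF u]] by blast
  then have "measure (\<nu> f) {0} = 0" using norm_EB[OF _ f, of "{0}"] by (simp add: ell2_norm_def)
  then have "AE x in \<nu> f. x \<noteq> 0"
    by (intro AE_I[of _ _ "{0}"]) (auto simp: emeasure_eq_measure sets_\<nu>[OF f])
  then show ?thesis using AE_\<nu>[OF f] by eventually_elim auto
qed

end

context positive_contraction
begin

lemma pp_affine:
  assumes u: "u \<in> ell2 m" and v: "v \<in> ell2 m"
  shows "pp (\<lambda>x. 1 - c * of_real x) u v = ell2_inner m u v - c * ell2_inner m (R u) v"
proof -
  have "(\<integral>x. 1 - c * of_real x \<partial>\<nu> h) = (\<integral>x. of_real x ^ 0 \<partial>\<nu> h) - c * (\<integral>x. of_real x ^ 1 \<partial>\<nu> h)"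
    if h: "h \<in> ell2 m" for h
  proof -
    interpret finite_measure "\<nu> h" by (rule finite_\<nu>[OF h])
    have [measurable_cong]: "sets (\<nu> h) = sets borel" by (rule sets_\<nu>[OF h])
    have "integrable (\<nu> h) (\<lambda>x. complex_of_real x)"
    proof (rule integrable_const_bound[of _ 1])
      show "AE x in \<nu> h. norm (complex_of_real x) \<le> 1" using AE_\<nu>[OF h] by eventually_elim auto
    qed measurable
    then show ?thesis by (subst Bochner_Integration.integral_diff) auto
  qed
  then have "pp (\<lambda>x. 1 - c * of_real x) u v = pp (\<lambda>x. of_real x ^ 0) u v - c * pp (\<lambda>x. of_real x ^ 1) u v"
    unfolding pp_def using u v
    by (simp only: lin_mem sum_distrib_left sum_subtractf[symmetric] diff_divide_distrib[symmetric] times_divide_eq_right right_diff_distrib mult.left_commute)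
  then show ?thesis using u v by (simp only: pp_moment) simp
qed

text \<open>If \<open>R\<close> is injective, then \<open>R\<^sup>-\<^sup>1 - c\<close> has a spectral measure, the image of that of \<open>R\<close> under
  \<open>r \<mapsto> 1/r - c\<close>.\<close>

theorem resolvent_spectral_measure:
  assumes inj: "\<And>f. f \<in> ell2 m \<Longrightarrow> R f = (\<lambda>_. 0) \<Longrightarrow> f = (\<lambda>_. 0)"
  shows "\<exists>E. projection_valued_measure m E \<and>
    spectral_integral m E (\<lambda>s. of_real s) = {(R f, \<lambda>x. f x - of_real c * R f x) | f. f \<in> ell2 m}"
proof -
  define g where "g r = 1 / r - c" for r :: real
  have g [measurable]: "g \<in> borel_measurable borel" unfolding g_def by measurable
  define E where "E B = EB (g -` B)" for B
  have gB: "g -` B \<in> sets borel" if "B \<in> sets borel" for B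
    using measurable_sets_borel[OF g that] .
  have E: "projection_valued_measure m E"
    unfolding projection_valued_measure_def
  proof (intro conjI ballI allI impI)
    show "orthogonal_projection m (E B)" if "B \<in> sets borel" for B
      unfolding E_def by (rule EB_projection[OF gB[OF that]])
    show "E UNIV f = f" if "f \<in> ell2 m" for f using EB_UNIV[OF that] by (simp add: E_def)
    fix A :: "nat \<Rightarrow> real set" and f
    assume A: "\<forall>n. A n \<in> sets borel" "disjoint_family A" "f \<in> ell2 m"
    have "disjoint_family (\<lambda>n. g -` A n)" using A(2) by (auto simp: disjoint_family_on_def)
    then show "(\<lambda>N. ell2_norm m (\<lambda>x. E (\<Union>n. A n) f x - (\<Sum>n<N. E (A n) f x))) \<longlonglongrightarrow> 0"
      unfolding E_def vimage_UN using A gB by (intro EB_countable) auto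
  qed
  interpret S: spectral_calc m E by unfold_locales (rule E)
  have scal: "S.\<mu> f = distr (\<nu> f) borel g" if f: "f \<in> ell2 m" for f
  proof (rule measure_eqI)
    fix B assume "B \<in> sets (S.\<mu> f)"
    then have B: "B \<in> sets borel" by simp
    interpret finite_measure "\<nu> f" by (rule finite_\<nu>[OF f])
    have gm: "g \<in> measurable (\<nu> f) borel" using g measurable_cong_sets[OF sets_\<nu>[OF f] refl] by blast
    show "emeasure (S.\<mu> f) B = emeasure (distr (\<nu> f) borel g) B"
      unfolding S.emeasure_\<mu>[OF f B] E_def norm_EB[OF gB[OF B] f] emeasure_distr[OF gm B] space_\<nu>[OF f]
      by (simp add: emeasure_eq_measure)
  qed simp
  have pair: "S.pairing \<phi> u v = pp w u v"
    if \<phi>: "\<phi> \<in> borel_measurable borel" and w: "w \<in> borel_measurable borel"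
      and eq: "\<And>x. x \<in> {0<..1} \<Longrightarrow> \<phi> (g x) = w x" and u: "u \<in> ell2 m" and v: "v \<in> ell2 m" for \<phi> w u v
  proof -
    have "(\<integral>s. \<phi> s \<partial>S.\<mu> h) = (\<integral>x. w x \<partial>\<nu> h)" if h: "h \<in> ell2 m" for h
    proof -
      have [measurable_cong]: "sets (\<nu> h) = sets borel" by (rule sets_\<nu>[OF h])
      note \<phi>[measurable] w[measurable]
      have "(\<integral>s. \<phi> s \<partial>S.\<mu> h) = (\<integral>x. \<phi> (g x) \<partial>\<nu> h)"
        unfolding scal[OF h] by (rule integral_distr) measurable
      also have "\<dots> = (\<integral>x. w x \<partial>\<nu> h)"
        by (rule integral_cong_AE) (use no_atom_at_zero[OF inj h] eq in auto)
      finally show ?thesis .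
    qed
    then show ?thesis unfolding spectral_pairing_def pp_def using u v by (simp add: mem)
  qed
  define \<psi> :: "real \<Rightarrow> complex" where "\<psi> s = (if s \<ge> 1 - c then 1 / of_real (s + c) else 0)" for s
  have \<psi>m [measurable]: "\<psi> \<in> borel_measurable borel" unfolding \<psi>_def by measurable
  have \<psi>: "bounded_borel \<psi>"
    by (rule bounded_borelI[OF \<psi>m, of 1]) (auto simp: \<psi>_def norm_divide simp flip: of_real_add)
  have s\<psi>: "bounded_borel (\<lambda>s. of_real s * \<psi> s)"
  proof -
    have "(\<lambda>s. of_real s * \<psi> s) = (\<lambda>s. indicator {1 - c..} s + (- of_real c) * \<psi> s)"
      by (auto simp: \<psi>_def fun_eq_iff indicator_def field_simps simp flip: of_real_add)
    then show ?thesis using \<psi> by (simp only:) (intro bounded_borel_lin, auto)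
  qed
  have g01: "g x \<ge> 1 - c" if "x \<in> {0<..1}" for x using that by (auto simp: g_def divide_simps algebra_simps)
  have \<psi>g: "\<psi> (g x) = of_real x ^ 1" if "x \<in> {0<..1}" for x
    using g01[OF that] that by (simp add: \<psi>_def g_def)
  have cR: "S.calc \<psi> f = R f" if f: "f \<in> ell2 m" for f
  proof (rule eq_by_delta)
    fix x
    show "ell2_inner m (S.calc \<psi> f) (delta x) = ell2_inner m (R f) (delta x)"
      using pair[OF \<psi>m _ \<psi>g f delta_ell2, of x] pp_moment[OF f delta_ell2, of 1 x]
        S.calc_inner[OF \<psi> f delta_ell2] by simp
  qed
  have csR: "S.calc (\<lambda>s. of_real s * \<psi> s) f = (\<lambda>x. f x - of_real c * R f x)" if f: "f \<in> ell2 m" for f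
  proof (rule eq_by_delta)
    fix x
    have eq: "of_real (g r) * \<psi> (g r) = 1 - of_real c * of_real r" if "r \<in> {0<..1}" for r
      using \<psi>g[OF that] that by (simp add: g_def left_diff_distrib)
    show "ell2_inner m (S.calc (\<lambda>s. of_real s * \<psi> s) f) (delta x)
        = ell2_inner m (\<lambda>x. f x - of_real c * R f x) (delta x)"
      unfolding S.calc_inner[OF s\<psi> f delta_ell2]
      by (subst pair[of "\<lambda>s. of_real s * \<psi> s" "\<lambda>r. 1 - of_real c * of_real r", OF _ _ eq f delta_ell2])
         (auto simp: pp_affine[OF f] diff_left scale_left f R_mem mem simp del: inner_delta)
  qed
  have sub: "(R f, \<lambda>x. f x - of_real c * R f x) \<in> spectral_integral m E (\<lambda>s. of_real s)" if f: "f \<in> ell2 m" for f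
    using S.calc_in_spectral_integral[OF \<psi> s\<psi> f] unfolding cR[OF f] csR[OF f] .
  \<comment> \<open>A symmetric extension of \<open>R\<^sup>-\<^sup>1 - c\<close> is trivial, because \<open>R\<^sup>-\<^sup>1\<close> is onto: test with \<open>R g\<close>.\<close>
  have "(f, h) \<in> {(R f, \<lambda>x. f x - of_real c * R f x) | f. f \<in> ell2 m}"
    if fh: "(f, h) \<in> spectral_integral m E (\<lambda>s. of_real s)" for f h
  proof -
    have f: "f \<in> S.dom" "f \<in> ell2 m" and h: "h \<in> ell2 m"
      and hg: "\<And>g. g \<in> S.dom \<Longrightarrow> ell2_inner m h g = S.pairing (\<lambda>s. of_real s) f g"
      using fh S.dom_ell2 by (auto simp: spectral_integral_def)
    let ?k = "\<lambda>x. h x + of_real c * f x"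
    have k: "?k \<in> ell2 m" by (intro mem f h)
    have "R ?k = f"
    proof (rule eq_by_delta)
      fix x :: 'x
      let ?g = "delta x :: 'x \<Rightarrow> complex"
      have g: "?g \<in> ell2 m" by simp
      have Rg: "R ?g \<in> S.dom" and Rg': "\<And>u. u \<in> S.dom \<Longrightarrow>
          ell2_inner m (\<lambda>x. ?g x - of_real c * R ?g x) u = S.pairing (\<lambda>s. of_real s) (R ?g) u"
        using sub[OF g] by (auto simp: spectral_integral_def)
      have "ell2_inner m (R ?k) ?g = ell2_inner m h (R ?g) + of_real c * ell2_inner m f (R ?g)"
        using k g f h by (simp add: R_sym lin_left R_mem del: inner_delta)
      also have "ell2_inner m h (R ?g) = cnj (S.pairing (\<lambda>s. of_real s) (R ?g) f)"
        using hg[OF Rg] S.pairing_id_herm[OF Rg f(1)] by simp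
      also have "\<dots> = cnj (ell2_inner m (\<lambda>x. ?g x - of_real c * R ?g x) f)" using Rg'[OF f(1)] by simp
      also have "\<dots> = ell2_inner m f (\<lambda>x. ?g x - of_real c * R ?g x)"
        by (rule herm[symmetric]) (intro mem g R_mem f)+
      also have "\<dots> = ell2_inner m f ?g - of_real c * ell2_inner m f (R ?g)"
        using f g R_mem[OF g] by (simp add: diff_right scale_right mem del: inner_delta)
      finally show "ell2_inner m (R ?k) ?g = ell2_inner m f ?g" by simp
    qed
    then have "(f, h) = (R ?k, \<lambda>x. ?k x - of_real c * R ?k x)" by simp
    then show ?thesis using k by blast
  qed
  then have "spectral_integral m E (\<lambda>s. of_real s) = {(R f, \<lambda>x. f x - of_real c * R f x) | f. f \<in> ell2 m}"
    using sub by fast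
  then show ?thesis using E by blast
qed

end

section \<open>Finite linear systems\<close>

text \<open>Gaussian elimination. Injectivity provides a pivot in the first column, and it passes to the system from
  which the pivot row and column have been eliminated.\<close>

lemma injective_imp_solvable:
  fixes M :: "'r \<Rightarrow> 's \<Rightarrow> complex"
  assumes "finite S" "finite T" "card T = card S"
    and "\<And>u. (\<And>r. r \<in> T \<Longrightarrow> (\<Sum>s\<in>S. M r s * u s) = 0) \<Longrightarrow> (\<And>s. s \<in> S \<Longrightarrow> u s = 0)"
  shows "\<exists>u. \<forall>r\<in>T. (\<Sum>s\<in>S. M r s * u s) = F r"
  using assms
proof (induction S arbitrary: T M F)
  case empty
  then show ?case by simp
next
  case (insert s S)
  note S = insert.hyps and T = insert.prems(1,2)
  have "\<exists>t\<in>T. M t s \<noteq> 0"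
  proof (rule ccontr)
    assume "\<not> (\<exists>t\<in>T. M t s \<noteq> 0)"
    then have "(\<Sum>s'\<in>insert s S. M r s' * (if s' = s then 1 else 0)) = 0" if "r \<in> T" for r
      using S that by (simp add: if_distrib cong: if_cong)
    then show False using insert.prems(3)[of "\<lambda>s'. if s' = s then 1 else 0" s] by simp
  qed
  then obtain t where t: "t \<in> T" "M t s \<noteq> 0" by blast
  define M' where "M' r s' = M r s' - M r s / M t s * M t s'" for r s'
  have row: "(\<Sum>s'\<in>S. M' r s' * u s') = (\<Sum>s'\<in>S. M r s' * u s') - M r s / M t s * (\<Sum>s'\<in>S. M t s' * u s')" for r u
    by (simp add: M'_def left_diff_distrib sum_subtractf sum_distrib_left mult.assoc)
  define ext where "ext u k s' = (if s' = s then (k - (\<Sum>s'\<in>S. M t s' * u s')) / M t s else u s')" for u k s'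
  have extS: "(\<Sum>s'\<in>insert s S. M r s' * ext u k s')
      = M r s * ((k - (\<Sum>s'\<in>S. M t s' * u s')) / M t s) + (\<Sum>s'\<in>S. M r s' * u s')" for r u k
  proof -
    have "(\<Sum>s'\<in>S. M r s' * ext u k s') = (\<Sum>s'\<in>S. M r s' * u s')"
      using S by (intro sum.cong) (auto simp: ext_def)
    then show ?thesis using S by (simp add: ext_def)
  qed
  have ext: "(\<Sum>s'\<in>insert s S. M r s' * ext u k s') = (if r = t then k else (\<Sum>s'\<in>S. M' r s' * u s') + M r s / M t s * k)" for r u k
    unfolding extS row using t by (simp add: diff_divide_distrib right_diff_distrib)
  have "\<exists>u. \<forall>r\<in>T - {t}. (\<Sum>s'\<in>S. M' r s' * u s') = F r - M r s / M t s * F t"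
  proof (rule insert.IH)
    show "finite (T - {t})" "card (T - {t}) = card S" using T t S by auto
    fix u s' assume u: "\<And>r. r \<in> T - {t} \<Longrightarrow> (\<Sum>s'\<in>S. M' r s' * u s') = 0" and s': "s' \<in> S"
    have "ext u 0 s' = 0" by (rule insert.prems(3)) (use u s' in \<open>auto simp: ext\<close>)
    moreover have "s' \<noteq> s" using s' S by auto
    ultimately show "u s' = 0" by (simp add: ext_def)
  qed
  then obtain u where "\<forall>r\<in>T - {t}. (\<Sum>s'\<in>S. M' r s' * u s') = F r - M r s / M t s * F t" by blast
  then show ?case by (intro exI[of _ "ext u (F t)"]) (auto simp: ext)
qed

section \<open>Closable forms and their operators\<close>

text \<open>Finite sets that increase to the whole vertex set.\<close>

definition exhaustion :: "nat \<Rightarrow> 'x::countable set" where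
  "exhaustion n = {x. to_nat x < n}"

lemma finite_exhaustion [simp]: "finite (exhaustion n)"
  unfolding exhaustion_def using finite_vimageI[OF finite_lessThan[of n] inj_to_nat]
  by (simp add: vimage_def)

definition supported_on :: "'x set \<Rightarrow> ('x \<Rightarrow> complex) set" where
  "supported_on X = {f. \<forall>x. x \<notin> X \<longrightarrow> f x = 0}"

abbreviation supported :: "nat \<Rightarrow> ('x::countable \<Rightarrow> complex) set" where
  "supported n \<equiv> supported_on (exhaustion n)"

lemma supported_mono: "n \<le> k \<Longrightarrow> supported n \<subseteq> supported k"
  by (force simp: supported_on_def exhaustion_def)

lemma supported_fs: "f \<in> supported n \<Longrightarrow> f \<in> finitely_supported"
  unfolding supported_on_def finitely_supported_def
  by (auto intro: finite_subset[OF _ finite_exhaustion[of n]])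

lemma fs_supported: assumes "f \<in> finitely_supported" obtains N where "\<And>n. n \<ge> N \<Longrightarrow> f \<in> supported n"
proof -
  have fin: "finite (to_nat ` {x. f x \<noteq> 0})" using assms by (simp add: finitely_supported_def)
  obtain N where N: "\<forall>k\<in>to_nat ` {x. f x \<noteq> 0}. k < N"
    using finite_nat_set_iff_bounded[THEN iffD1, OF fin] by blast
  have "f \<in> supported n" if "n \<ge> N" for n
    using N that by (force simp: supported_on_def exhaustion_def)
  then show ?thesis using that by blast
qed

lemma delta_supported: "x \<in> exhaustion n \<Longrightarrow> delta x \<in> supported n"
  by (auto simp: supported_on_def delta_def)

lemma fs_lin: "f \<in> finitely_supported \<Longrightarrow> g \<in> finitely_supported \<Longrightarrow> (\<lambda>x. f x + c * g x) \<in> finitely_supported"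
  unfolding finitely_supported_def mem_Collect_eq
  by (rule finite_subset[of _ "{x. f x \<noteq> 0} \<union> {x. g x \<noteq> 0}"]) auto

lemma fs_diff: "f \<in> finitely_supported \<Longrightarrow> g \<in> finitely_supported \<Longrightarrow> (\<lambda>x. f x - g x) \<in> finitely_supported"
  using fs_lin[of f g "-1"] by simp

lemma fs_zero: "(\<lambda>_. 0) \<in> finitely_supported" by (simp add: finitely_supported_def)

text \<open>A form with \<open>B u u \<noteq> 0\<close> for \<open>u \<noteq> 0\<close> is represented by an injective matrix on every finite set.\<close>

lemma (in weights) Galerkin_solution:
  fixes B :: "'x form"
  assumes lin: "\<And>f g h c. \<lbrakk>f \<in> finitely_supported; g \<in> finitely_supported; h \<in> finitely_supported\<rbrakk>
      \<Longrightarrow> B (\<lambda>x. f x + c * g x) h = B f h + c * B g h"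
    and linr: "\<And>f g h c. \<lbrakk>f \<in> finitely_supported; g \<in> finitely_supported; h \<in> finitely_supported\<rbrakk>
      \<Longrightarrow> B h (\<lambda>x. f x + c * g x) = B h f + cnj c * B h g"
    and def: "\<And>u. u \<in> finitely_supported \<Longrightarrow> B u u = 0 \<Longrightarrow> u = (\<lambda>_. 0)"
    and f: "f \<in> ell2 m" and X: "finite X"
  shows "\<exists>u\<in>supported_on X. \<forall>g\<in>supported_on X. B u g = ell2_inner m f g"
proof -
  have zl: "B (\<lambda>_. 0) h = 0" "B h (\<lambda>_. 0) = 0" if "h \<in> finitely_supported" for h
    using lin[OF fs_zero fs_zero that, of 1] linr[OF fs_zero fs_zero that, of 1] by simp_all
  have sfs: "(\<lambda>y. \<Sum>x\<in>S. u x * delta x y) \<in> finitely_supported" if "finite S" for u S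
    using that
  proof induction
    case (insert x S)
    then show ?case using fs_lin[OF insert.IH delta_fs, of "u x" x] by (simp add: add.commute)
  qed (simp add: fs_zero)
  have Bl: "B (\<lambda>y. \<Sum>x\<in>S. u x * delta x y) h = (\<Sum>x\<in>S. u x * B (delta x) h)"
    if "finite S" "h \<in> finitely_supported" for u S h
    using that
  proof induction
    case (insert x S)
    then show ?case using lin[OF sfs[OF insert(1), of u] delta_fs insert(4), of "u x" x] by (simp add: add.commute)
  qed (simp add: zl)
  have Br: "B h (\<lambda>y. \<Sum>x\<in>S. u x * delta x y) = (\<Sum>x\<in>S. cnj (u x) * B h (delta x))"
    if "finite S" "h \<in> finitely_supported" for u S h
    using that
  proof induction
    case (insert x S)
    then show ?case using linr[OF sfs[OF insert(1), of u] delta_fs insert(4), of "u x" x] by (simp add: add.commute)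
  qed (simp add: zl)
  have exp: "g = (\<lambda>y. \<Sum>x\<in>X. g x * delta x y)" if "g \<in> supported_on X" for g
    by (rule finite_support_sum[OF X]) (use that in \<open>auto simp: supported_on_def\<close>)
  have restr: "(\<lambda>y. \<Sum>x\<in>X. u x * delta x y) = (\<lambda>y. if y \<in> X then u y else 0)" for u
    using X by (auto simp: fun_eq_iff delta_def if_distrib cong: if_cong)
  have "\<exists>u. \<forall>x\<in>X. (\<Sum>y\<in>X. B (delta y) (delta x) * u y) = ell2_inner m f (delta x)"
  proof (rule injective_imp_solvable)
    fix u y assume u: "\<And>x. x \<in> X \<Longrightarrow> (\<Sum>y\<in>X. B (delta y) (delta x) * u y) = 0" and y: "y \<in> X"
    let ?u = "\<lambda>y. \<Sum>x\<in>X. u x * delta x y"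
    have fs: "?u \<in> finitely_supported" by (rule sfs[OF X])
    have "B ?u (delta x) = 0" if "x \<in> X" for x
      using u[OF that] by (subst Bl[OF X]) (simp_all add: mult.commute)
    then have "B ?u ?u = 0" by (subst Br[OF X fs]) simp_all
    then have "?u = (\<lambda>_. 0)" by (rule def[OF fs])
    then show "u y = 0" unfolding restr using y by (auto dest!: fun_cong[of _ _ y])
  qed (use X in auto)
  then obtain u where u: "\<forall>x\<in>X. (\<Sum>y\<in>X. B (delta y) (delta x) * u y) = ell2_inner m f (delta x)" by blast
  let ?u = "\<lambda>y. \<Sum>x\<in>X. u x * delta x y"
  have us: "?u \<in> supported_on X" unfolding restr by (simp add: supported_on_def)
  have "B ?u g = ell2_inner m f g" if g: "g \<in> supported_on X" for g
  proof -
    have "B ?u g = (\<Sum>x\<in>X. cnj (g x) * B ?u (delta x))"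
      using Br[OF X sfs[OF X, of u], of g] exp[OF g] by simp
    also have "\<dots> = (\<Sum>x\<in>X. f x * cnj (g x) * of_real (m x))"
    proof (rule sum.cong)
      fix x assume "x \<in> X"
      then have "B ?u (delta x) = f x * of_real (m x)"
        using u by (subst Bl[OF X]) (simp_all add: mult.commute)
      then show "cnj (g x) * B ?u (delta x) = f x * cnj (g x) * of_real (m x)" by simp
    qed simp
    also have "\<dots> = ell2_inner m f g"
      by (rule inner_finite_right[OF X, symmetric]) (use g in \<open>auto simp: supported_on_def\<close>)
    finally show ?thesis .
  qed
  then show ?thesis using us by blast
qed

locale closable_lower_bounded = weights m for m :: "'x::countable \<Rightarrow> real" +
  fixes q :: "'x form" and C :: real
  assumes q_lin: "\<lbrakk>f \<in> finitely_supported; g \<in> finitely_supported; h \<in> finitely_supported\<rbrakk>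
      \<Longrightarrow> q (\<lambda>x. f x + a * g x) h = q f h + a * q g h"
    and q_herm: "\<lbrakk>f \<in> finitely_supported; g \<in> finitely_supported\<rbrakk> \<Longrightarrow> q g f = cnj (q f g)"
    and q_lower: "f \<in> finitely_supported \<Longrightarrow> - C * (ell2_norm m f)\<^sup>2 \<le> Re (q f f)"
    and q_closable: "closable_form m finitely_supported q"
begin

abbreviation "FS \<equiv> (finitely_supported :: ('x \<Rightarrow> complex) set)"

lemma fs_ell2: "f \<in> FS \<Longrightarrow> f \<in> ell2 m" by (rule finitely_supported_ell2)

lemma q_linr: "\<lbrakk>f \<in> FS; g \<in> FS; h \<in> FS\<rbrakk> \<Longrightarrow> q h (\<lambda>x. f x + a * g x) = q h f + cnj a * q h g"
  using q_herm[of "\<lambda>x. f x + a * g x" h] q_herm[of f h] q_herm[of g h] by (simp add: fs_lin q_lin)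

lemma q_real: "f \<in> FS \<Longrightarrow> Im (q f f) = 0"
  using q_herm[of f f] by (simp add: complex_eq_iff)

definition L :: "'x operator" where
  "L = form_operator m (closure_domain m FS q) (closure_form m FS q)"

end

text \<open>For \<open>c \<ge> C + 1\<close> the form \<open>q + c\<close> dominates the squared norm, which makes its resolvent a contraction.\<close>

locale shifted_form = closable_lower_bounded m q C for m :: "'x::countable \<Rightarrow> real" and q C +
  fixes c :: real
  assumes c: "C + 1 \<le> c"
begin

definition qc :: "'x form" where "qc f g = q f g + of_real c * ell2_inner m f g"

lemma qc_ge: "f \<in> FS \<Longrightarrow> (ell2_norm m f)\<^sup>2 \<le> Re (qc f f)"
proof -
  assume f: "f \<in> FS"
  have "(C + 1) * (ell2_norm m f)\<^sup>2 \<le> c * (ell2_norm m f)\<^sup>2" using c by (intro mult_right_mono) auto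
  then show ?thesis using q_lower[OF f] norm_sq[OF fs_ell2[OF f]] by (simp add: qc_def algebra_simps)
qed

sublocale qc: semi_inner FS qc
proof
  show "qc g f = cnj (qc f g)" if "f \<in> FS" "g \<in> FS" for f g
    using that herm[of f g] q_herm[of f g] by (simp add: qc_def fs_ell2)
  show "0 \<le> Re (qc f f)" if "f \<in> FS" for f
    using qc_ge[OF that] zero_le_power2 order_trans by blast
qed (auto simp: fs_zero fs_lin qc_def q_lin lin_left fs_ell2 algebra_simps)

abbreviation "N \<equiv> qc.seminorm"

lemma norm_le_N: "f \<in> FS \<Longrightarrow> ell2_norm m f \<le> N f"
  unfolding qc.seminorm_def using qc_ge by (simp add: real_le_rsqrt)

lemma N_diff_nonneg [simp]: "f \<in> FS \<Longrightarrow> g \<in> FS \<Longrightarrow> 0 \<le> N (\<lambda>x. f x - g x)"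
  by (intro qc.seminorm_nonneg fs_diff)

lemma qc_zero_iff: "f \<in> FS \<Longrightarrow> qc f f = 0 \<Longrightarrow> f = (\<lambda>_. 0)"
proof -
  assume f: "f \<in> FS" and 0: "qc f f = 0"
  have "ell2_norm m f = 0" using qc_ge[OF f] 0 by simp
  then show "f = (\<lambda>_. 0)" by (rule norm_zero_imp[OF fs_ell2[OF f]])
qed

lemma N_sq_le: "f \<in> FS \<Longrightarrow> (N f)\<^sup>2 \<le> cmod (q f f) + \<bar>c\<bar> * (ell2_norm m f)\<^sup>2"
proof -
  assume f: "f \<in> FS"
  have "c * (ell2_norm m f)\<^sup>2 \<le> \<bar>c\<bar> * (ell2_norm m f)\<^sup>2" by (intro mult_right_mono) auto
  then show ?thesis
    using complex_Re_le_cmod[of "q f f"] by (simp add: qc.seminorm_sq f qc_def inner_self fs_ell2)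
qed

lemma q_le_N: "f \<in> FS \<Longrightarrow> cmod (q f f) \<le> (1 + \<bar>c\<bar>) * (N f)\<^sup>2"
proof -
  assume f: "f \<in> FS"
  have "q f f = qc f f - of_real c * ell2_inner m f f" by (simp add: qc_def)
  also have "cmod \<dots> \<le> cmod (qc f f) + cmod (of_real c * ell2_inner m f f)" by (rule norm_triangle_ineq4)
  also have "\<dots> = (N f)\<^sup>2 + \<bar>c\<bar> * (ell2_norm m f)\<^sup>2"
    by (simp add: qc.self_eq[OF f] inner_self[OF fs_ell2[OF f]] norm_mult norm_power qc.seminorm_nonneg[OF f])
  also have "\<dots> \<le> (N f)\<^sup>2 + \<bar>c\<bar> * (N f)\<^sup>2"
    using norm_le_N[OF f] by (intro add_left_mono mult_left_mono power_mono) auto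
  finally show ?thesis by (simp add: algebra_simps)
qed

subsection \<open>Galerkin approximation of the resolvent\<close>

definition Rn :: "nat \<Rightarrow> ('x \<Rightarrow> complex) \<Rightarrow> 'x \<Rightarrow> complex" where
  "Rn n f = (SOME u. u \<in> supported n \<and> (\<forall>g\<in>supported n. qc u g = ell2_inner m f g))"

context
  fixes f :: "'x \<Rightarrow> complex" assumes f: "f \<in> ell2 m"
begin

lemma Rn_props: "Rn n f \<in> supported n \<and> (\<forall>g\<in>supported n. qc (Rn n f) g = ell2_inner m f g)"
proof -
  have "\<exists>u. u \<in> supported n \<and> (\<forall>g\<in>supported n. qc u g = ell2_inner m f g)"
    using Galerkin_solution[where B = qc and f = f and X = "exhaustion n",
        OF qc.lin_left qc.lin_right qc_zero_iff f finite_exhaustion] by blast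
  from someI_ex[OF this] show ?thesis unfolding Rn_def .
qed

lemma Rn_supported: "Rn n f \<in> supported n" using Rn_props by blast

lemma Rn_fs: "Rn n f \<in> FS" by (rule supported_fs[OF Rn_supported])

lemma Rn_ell2: "Rn n f \<in> ell2 m" by (rule fs_ell2[OF Rn_fs])

lemma Rn_eq: "g \<in> supported k \<Longrightarrow> k \<le> n \<Longrightarrow> qc (Rn n f) g = ell2_inner m f g"
  using Rn_props supported_mono by blast

lemma N_Rn_sq: "(N (Rn n f))\<^sup>2 = Re (ell2_inner m f (Rn n f))"
  using Rn_eq[OF Rn_supported order_refl] by (simp add: qc.seminorm_sq Rn_fs)

lemma N_Rn_le: "N (Rn n f) \<le> ell2_norm m f"
proof -
  have "N (Rn n f) * N (Rn n f) \<le> ell2_norm m f * N (Rn n f)"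
  proof -
    have "N (Rn n f) * N (Rn n f) \<le> ell2_norm m f * ell2_norm m (Rn n f)"
      using N_Rn_sq[of n] CS[OF f Rn_ell2, of n] complex_Re_le_cmod[of "ell2_inner m f (Rn n f)"]
      by (simp add: power2_eq_square)
    also have "\<dots> \<le> ell2_norm m f * N (Rn n f)" by (intro mult_left_mono norm_le_N Rn_fs) auto
    finally show ?thesis .
  qed
  then show ?thesis
    using qc.seminorm_nonneg[OF Rn_fs[of n]] by (cases "N (Rn n f) = 0") (auto simp: mult_le_cancel_right)
qed

text \<open>For \<open>n \<le> k\<close>, \<open>Rn n f\<close> is the orthogonal projection of \<open>Rn k f\<close> with respect to \<open>q + c\<close>.\<close>

lemma N_Rn_diff:
  assumes "n \<le> k" shows "(N (\<lambda>x. Rn k f x - Rn n f x))\<^sup>2 = (N (Rn k f))\<^sup>2 - (N (Rn n f))\<^sup>2"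
proof -
  have kn: "qc (Rn k f) (Rn n f) = qc (Rn n f) (Rn n f)"
    using Rn_eq[OF Rn_supported assms] Rn_eq[OF Rn_supported order_refl, of n] by simp
  have nk: "qc (Rn n f) (Rn k f) = qc (Rn n f) (Rn n f)"
    using qc.herm[OF Rn_fs[of k] Rn_fs[of n]] qc.herm[OF Rn_fs[of n] Rn_fs[of n]] kn by simp
  show ?thesis
    by (simp add: qc.seminorm_sq qc.mem Rn_fs qc.diff_left qc.diff_right kn nk)
qed

text \<open>The squares of the norms \<open>N (Rn n f)\<close> are increasing and bounded, and by orthogonality their increments are the
  squared distances.\<close>

lemma Rn_Cauchy:
  assumes "e > 0" shows "\<exists>M. \<forall>j\<ge>M. \<forall>k\<ge>M. N (\<lambda>x. Rn j f x - Rn k f x) < e"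
proof -
  have "incseq (\<lambda>n. (N (Rn n f))\<^sup>2)"
  proof (rule incseq_SucI)
    fix n show "(N (Rn n f))\<^sup>2 \<le> (N (Rn (Suc n) f))\<^sup>2"
      using N_Rn_diff[of n "Suc n"] zero_le_power2[of "N (\<lambda>x. Rn (Suc n) f x - Rn n f x)"] by simp
  qed
  moreover have "(N (Rn n f))\<^sup>2 \<le> (ell2_norm m f)\<^sup>2" for n
    using N_Rn_le qc.seminorm_nonneg[OF Rn_fs] by (intro power_mono) auto
  ultimately obtain l where "(\<lambda>n. (N (Rn n f))\<^sup>2) \<longlonglongrightarrow> l" using incseq_convergent by blast
  then have "Cauchy (\<lambda>n. (N (Rn n f))\<^sup>2)" by (rule LIMSEQ_imp_Cauchy)
  then obtain M where M: "\<And>j k. j \<ge> M \<Longrightarrow> k \<ge> M \<Longrightarrow> dist ((N (Rn j f))\<^sup>2) ((N (Rn k f))\<^sup>2) < e\<^sup>2"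
    unfolding Cauchy_def using assms by (metis zero_less_power)
  have le: "N (\<lambda>x. Rn k f x - Rn j f x) < e" if "j \<ge> M" "j \<le> k" for j k
  proof (rule power2_less_imp_less)
    show "(N (\<lambda>x. Rn k f x - Rn j f x))\<^sup>2 < e\<^sup>2"
      using N_Rn_diff[OF that(2)] M[of k j] that by (simp add: dist_real_def)
  qed (use assms in simp)
  have "N (\<lambda>x. Rn j f x - Rn k f x) < e" if "j \<ge> M" "k \<ge> M" for j k
    using le[of j k] le[of k j] that qc.seminorm_diff_commute[OF Rn_fs Rn_fs, of j k] by (cases "j \<le> k") auto
  then show ?thesis by blast
qed

lemma Rn_form_Cauchy: "form_Cauchy q (\<lambda>n. Rn n f)"
  unfolding form_Cauchy_def
proof (intro allI impI)
  fix e :: real assume e: "e > 0"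
  then have "sqrt (e / (1 + \<bar>c\<bar>)) > 0" by simp
  from Rn_Cauchy[OF this] obtain M where
    M: "\<forall>j\<ge>M. \<forall>k\<ge>M. N (\<lambda>x. Rn j f x - Rn k f x) < sqrt (e / (1 + \<bar>c\<bar>))" by blast
  show "\<exists>M. \<forall>j\<ge>M. \<forall>k\<ge>M. cmod (q (\<lambda>x. Rn j f x - Rn k f x) (\<lambda>x. Rn j f x - Rn k f x)) < e"
  proof (intro exI allI impI)
    fix j k assume jk: "j \<ge> M" "k \<ge> M"
    let ?d = "\<lambda>x. Rn j f x - Rn k f x"
    have d: "?d \<in> FS" by (intro fs_diff Rn_fs)
    have "cmod (q ?d ?d) \<le> (1 + \<bar>c\<bar>) * (N ?d)\<^sup>2" by (rule q_le_N[OF d])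
    also have "\<dots> < (1 + \<bar>c\<bar>) * (sqrt (e / (1 + \<bar>c\<bar>)))\<^sup>2"
      using M jk qc.seminorm_nonneg[OF d] by (intro mult_strict_left_mono power_strict_mono) auto
    also have "\<dots> = e" using e by simp
    finally show "cmod (q ?d ?d) < e" .
  qed
qed

lemma Rn_converges: "\<exists>u. u \<in> ell2 m \<and> (\<lambda>n. ell2_norm m (\<lambda>x. Rn n f x - u x)) \<longlonglongrightarrow> 0"
proof -
  have "\<exists>M. \<forall>j\<ge>M. \<forall>k\<ge>M. ell2_norm m (\<lambda>x. Rn j f x - Rn k f x) < e" if e: "e > 0" for e
  proof -
    obtain M where M: "\<And>j k. j \<ge> M \<Longrightarrow> k \<ge> M \<Longrightarrow> N (\<lambda>x. Rn j f x - Rn k f x) < e"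
      using Rn_Cauchy[OF e] by blast
    have "ell2_norm m (\<lambda>x. Rn j f x - Rn k f x) < e" if "j \<ge> M" "k \<ge> M" for j k
      using norm_le_N[OF fs_diff[OF Rn_fs Rn_fs], of j k] M[OF that] by simp
    then show ?thesis by blast
  qed
  from ell2_complete[OF Rn_ell2 this] show ?thesis by blast
qed

end

definition R :: "('x \<Rightarrow> complex) \<Rightarrow> 'x \<Rightarrow> complex" where
  "R f = (SOME u. u \<in> ell2 m \<and> (\<lambda>n. ell2_norm m (\<lambda>x. Rn n f x - u x)) \<longlonglongrightarrow> 0)"

lemma
  assumes f: "f \<in> ell2 m"
  shows R_ell2: "R f \<in> ell2 m" and Rn_tendsto: "(\<lambda>n. ell2_norm m (\<lambda>x. Rn n f x - R f x)) \<longlonglongrightarrow> 0"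
  using someI_ex[OF Rn_converges[OF f]] unfolding R_def[symmetric] by auto

lemma const_tendsto: "(\<lambda>n. ell2_norm m (\<lambda>x. f x - f x)) \<longlonglongrightarrow> 0"
  by (simp add: ell2_norm_def)

lemma R_approximates: "f \<in> ell2 m \<Longrightarrow> form_approximates m FS q (\<lambda>n. Rn n f) (R f)"
  by (simp add: form_approximates_def R_ell2 Rn_fs Rn_form_Cauchy Rn_tendsto)

lemma Rn_sym:
  assumes "f \<in> ell2 m" "g \<in> ell2 m"
  shows "ell2_inner m (Rn n f) g = ell2_inner m f (Rn n g)"
  using Rn_eq[OF assms(1) Rn_supported[OF assms(2)] order_refl] Rn_eq[OF assms(2) Rn_supported[OF assms(1)] order_refl]
    qc.herm[OF Rn_fs[OF assms(2)] Rn_fs[OF assms(1)]] herm[OF assms(2) Rn_ell2[OF assms(1)]] by metis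

lemma inner_R_lim:
  assumes "f \<in> ell2 m" "g \<in> ell2 m"
  shows "(\<lambda>n. ell2_inner m (Rn n f) g) \<longlonglongrightarrow> ell2_inner m (R f) g"
  by (rule tendsto_inner[OF Rn_ell2 R_ell2 Rn_tendsto _ _ const_tendsto]) (use assms in auto)

lemma inner_R_self:
  assumes f: "f \<in> ell2 m" shows "(\<lambda>n. (N (Rn n f))\<^sup>2) \<longlonglongrightarrow> Re (ell2_inner m (R f) f)"
  using tendsto_Re[OF inner_R_lim[OF f f]] by (simp add: N_Rn_sq[OF f] Rn_sym[OF f f])

sublocale R: positive_contraction m R
proof
  fix f assume f: "f \<in> ell2 m"
  show "R f \<in> ell2 m" by (rule R_ell2[OF f])
  show "0 \<le> Re (ell2_inner m (R f) f)"
    by (rule tendsto_lowerbound[OF inner_R_self[OF f]]) auto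
  have "(N (Rn n f))\<^sup>2 \<le> (ell2_norm m f)\<^sup>2" for n
    using N_Rn_le[OF f] qc.seminorm_nonneg[OF Rn_fs[OF f]] by (intro power_mono) auto
  then show "Re (ell2_inner m (R f) f) \<le> (ell2_norm m f)\<^sup>2"
    by (intro tendsto_upperbound[OF inner_R_self[OF f]]) auto
  fix g assume g: "g \<in> ell2 m"
  have "(\<lambda>n. ell2_inner m (Rn n f) g) \<longlonglongrightarrow> ell2_inner m f (R g)"
    unfolding Rn_sym[OF f g]
    by (rule tendsto_inner[OF _ _ const_tendsto Rn_ell2 R_ell2 Rn_tendsto]) (use f g in auto)
  then show "ell2_inner m (R f) g = ell2_inner m f (R g)"
    using inner_R_lim[OF f g] LIMSEQ_unique by blast
qed

lemma N_tendsto_0: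
  assumes "\<And>n. F n \<in> FS" "form_Cauchy q F" "(\<lambda>n. ell2_norm m (F n)) \<longlonglongrightarrow> 0"
  shows "(\<lambda>n. N (F n)) \<longlonglongrightarrow> 0"
proof -
  have "(\<lambda>n. q (F n) (F n)) \<longlonglongrightarrow> 0"
    using q_closable assms unfolding closable_form_def by blast
  then have "(\<lambda>n. cmod (q (F n) (F n)) + \<bar>c\<bar> * (ell2_norm m (F n))\<^sup>2) \<longlonglongrightarrow> 0 + \<bar>c\<bar> * 0\<^sup>2"
    by (intro tendsto_intros assms tendsto_norm_zero)
  then have lim: "(\<lambda>n. cmod (q (F n) (F n)) + \<bar>c\<bar> * (ell2_norm m (F n))\<^sup>2) \<longlonglongrightarrow> 0" by simp
  have "(\<lambda>n. (N (F n))\<^sup>2) \<longlonglongrightarrow> 0"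
    by (rule Lim_null_comparison[OF _ lim]) (use N_sq_le assms in auto)
  then have "(\<lambda>n. sqrt ((N (F n))\<^sup>2)) \<longlonglongrightarrow> sqrt 0" by (rule tendsto_real_sqrt)
  then show ?thesis using qc.seminorm_nonneg assms(1) by simp
qed

text \<open>This is where closability enters: if \<open>Rn n f\<close> tends to zero, then it does so in the form norm, whereas its
  form product with a point mass is eventually constant.\<close>

lemma R_injective:
  assumes f: "f \<in> ell2 m" and 0: "R f = (\<lambda>_. 0)" shows "f = (\<lambda>_. 0)"
proof (rule eq_by_delta)
  fix x :: 'x
  have "(\<lambda>n. ell2_norm m (Rn n f)) \<longlonglongrightarrow> 0" using Rn_tendsto[OF f] 0 by simp
  then have N0: "(\<lambda>n. N (Rn n f)) \<longlonglongrightarrow> 0" by (rule N_tendsto_0[OF Rn_fs[OF f] Rn_form_Cauchy[OF f]])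
  obtain n0 where n0: "\<And>n. n \<ge> n0 \<Longrightarrow> delta x \<in> supported n" using fs_supported[OF delta_fs] by blast
  have "(\<lambda>n. N (Rn n f) * N (delta x)) \<longlonglongrightarrow> 0 * N (delta x)" by (intro tendsto_intros N0)
  moreover have "cmod (ell2_inner m f (delta x)) \<le> N (Rn n f) * N (delta x)" if "n \<ge> n0" for n
    using qc.Cauchy_Schwarz[OF Rn_fs[OF f] delta_fs, of n x] Rn_eq[OF f n0[OF that] order_refl] by simp
  ultimately have "cmod (ell2_inner m f (delta x)) \<le> 0 * N (delta x)"
    by (intro tendsto_lowerbound) (auto simp: eventually_sequentially simp del: inner_delta intro!: exI[of _ n0])
  then show "ell2_inner m f (delta x) = ell2_inner m (\<lambda>_. 0) (delta x)" by simp
qed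

subsection \<open>The closure and its operator\<close>

lemma approximates_N_Cauchy:
  assumes F: "form_approximates m FS q F f" and e: "e > 0"
  shows "\<exists>M. \<forall>j\<ge>M. \<forall>k\<ge>M. N (\<lambda>x. F j x - F k x) < e"
proof -
  have fs: "F n \<in> FS" for n using F by (simp add: form_approximates_def)
  have f: "f \<in> ell2 m" using F by (simp add: form_approximates_def)
  note f2 = fs_ell2[OF fs]
  \<comment> \<open>One half of \<open>e\<^sup>2\<close> is spent on \<open>q\<close>, the other half on \<open>|c|\<close> times the squared norm.\<close>
  define d where "d = sqrt (e\<^sup>2 / (2 * (1 + \<bar>c\<bar>))) / 2"
  have d: "d > 0" using e by (simp add: d_def)
  obtain M1 where M1: "\<And>j k. j \<ge> M1 \<Longrightarrow> k \<ge> M1 \<Longrightarrow> cmod (q (\<lambda>x. F j x - F k x) (\<lambda>x. F j x - F k x)) < e\<^sup>2 / 2"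
    using F e unfolding form_approximates_def form_Cauchy_def by (meson half_gt_zero zero_less_power)
  have "(\<lambda>n. ell2_norm m (\<lambda>x. F n x - f x)) \<longlonglongrightarrow> 0" using F by (simp add: form_approximates_def)
  then obtain M2 where M2: "\<And>n. n \<ge> M2 \<Longrightarrow> ell2_norm m (\<lambda>x. F n x - f x) < d"
    using LIMSEQ_D[of _ 0 d] d by fastforce
  have "N (\<lambda>x. F j x - F k x) < e" if jk: "j \<ge> max M1 M2" "k \<ge> max M1 M2" for j k
  proof (rule power2_less_imp_less)
    let ?d = "\<lambda>x. F j x - F k x"
    have fd: "?d \<in> FS" by (intro fs_diff fs)
    have "ell2_norm m ?d \<le> ell2_norm m (\<lambda>x. F j x - f x) + ell2_norm m (\<lambda>x. f x - F k x)"
      by (rule norm_triangle[OF f2 f f2])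
    also have "\<dots> \<le> 2 * d"
      using M2[of j] M2[of k] jk norm_diff_commute[OF f f2, of k] by simp
    finally have "(ell2_norm m ?d)\<^sup>2 \<le> (2 * d)\<^sup>2" by (intro power_mono) auto
    also have "\<dots> = e\<^sup>2 / (2 * (1 + \<bar>c\<bar>))" by (simp add: d_def power_divide)
    finally have "\<bar>c\<bar> * (ell2_norm m ?d)\<^sup>2 \<le> \<bar>c\<bar> * (e\<^sup>2 / (2 * (1 + \<bar>c\<bar>)))"
      by (intro mult_left_mono) auto
    also have "\<dots> \<le> e\<^sup>2 / 2" by (simp add: field_simps)
    finally show "(N ?d)\<^sup>2 < e\<^sup>2" using N_sq_le[OF fd] M1[of j k] jk by simp
  qed (use e in simp)
  then show ?thesis by blast
qed

lemma approximates_bounded: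
  assumes F: "form_approximates m FS q F f" shows "\<exists>B\<ge>0. \<forall>n. N (F n) \<le> B"
proof -
  have fs: "F n \<in> FS" for n using F by (simp add: form_approximates_def)
  obtain M where M: "\<forall>j\<ge>M. \<forall>k\<ge>M. N (\<lambda>x. F j x - F k x) < 1" using approximates_N_Cauchy[OF F, of 1] by auto
  have "N (F n) \<le> (\<Sum>j\<le>M. N (F j)) + 1" for n
  proof (cases "n \<ge> M")
    case True
    have "N (F n) \<le> N (F M) + N (\<lambda>x. F n x - F M x)" by (rule qc.seminorm_le_diff[OF fs fs])
    also have "N (\<lambda>x. F n x - F M x) < 1" using M True by simp
    also have "N (F M) \<le> (\<Sum>j\<le>M. N (F j))"
      by (rule member_le_sum) (auto simp: qc.seminorm_nonneg fs)
    finally show ?thesis by simp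
  next
    case False
    then have "N (F n) \<le> (\<Sum>j\<le>M. N (F j))"
      by (intro member_le_sum) (auto simp: qc.seminorm_nonneg fs)
    then show ?thesis by simp
  qed
  moreover have "0 \<le> (\<Sum>j\<le>M. N (F j)) + 1" by (intro add_nonneg_nonneg sum_nonneg) (auto simp: fs)
  ultimately show ?thesis by blast
qed

lemma form_diff_le:
  assumes "f \<in> FS" "f' \<in> FS" "g \<in> FS" "g' \<in> FS"
  shows "cmod (qc f g - qc f' g') \<le> N (\<lambda>x. f x - f' x) * N g + N f' * N (\<lambda>x. g x - g' x)"
proof -
  have eq: "qc f g - qc f' g' = qc (\<lambda>x. f x - f' x) g + qc f' (\<lambda>x. g x - g' x)"
    using assms by (simp add: qc.diff_left qc.diff_right fs_diff)
  show ?thesis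
    unfolding eq using assms by (intro norm_triangle_le add_mono qc.Cauchy_Schwarz fs_diff)
qed

lemma approximates_convergent:
  assumes F: "form_approximates m FS q F f" and G: "form_approximates m FS q G g"
  shows "convergent (\<lambda>n. qc (F n) (G n))"
proof (rule Cauchy_convergent, rule metric_CauchyI)
  fix e :: real assume e: "e > 0"
  have fs: "F n \<in> FS" "G n \<in> FS" for n using F G by (simp_all add: form_approximates_def)
  obtain A where A: "A \<ge> 0" "\<And>n. N (F n) \<le> A" using approximates_bounded[OF F] by blast
  obtain B where B: "B \<ge> 0" "\<And>n. N (G n) \<le> B" using approximates_bounded[OF G] by blast
  define d where "d = e / (A + B + 1)"
  have d: "d > 0" using e A B by (simp add: d_def)
  obtain M1 where M1: "\<And>j k. j \<ge> M1 \<Longrightarrow> k \<ge> M1 \<Longrightarrow> N (\<lambda>x. F j x - F k x) < d"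
    using approximates_N_Cauchy[OF F d] by blast
  obtain M2 where M2: "\<And>j k. j \<ge> M2 \<Longrightarrow> k \<ge> M2 \<Longrightarrow> N (\<lambda>x. G j x - G k x) < d"
    using approximates_N_Cauchy[OF G d] by blast
  show "\<exists>M. \<forall>j\<ge>M. \<forall>k\<ge>M. dist (qc (F j) (G j)) (qc (F k) (G k)) < e"
  proof (intro exI allI impI)
    fix j k assume jk: "j \<ge> max M1 M2" "k \<ge> max M1 M2"
    have "dist (qc (F j) (G j)) (qc (F k) (G k)) \<le> N (\<lambda>x. F j x - F k x) * N (G j) + N (F k) * N (\<lambda>x. G j x - G k x)"
      unfolding dist_norm by (rule form_diff_le[OF fs(1) fs(1) fs(2) fs(2)])
    also have "\<dots> \<le> d * B + A * d"
      using M1[of j k] M2[of j k] A B jk d qc.seminorm_nonneg fs fs_diff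
      by (intro add_mono mult_mono) (auto intro: less_imp_le)
    also have "\<dots> = d * (A + B)" by (simp add: algebra_simps)
    also have "\<dots> < d * (A + B + 1)" using d by simp
    also have "\<dots> = e" using A B by (simp add: d_def)
    finally show "dist (qc (F j) (G j)) (qc (F k) (G k)) < e" .
  qed
qed

text \<open>By closability two sequences that approximate the same vector have vanishing distance in the form norm.\<close>

lemma approximates_same:
  assumes F: "form_approximates m FS q F f" and F': "form_approximates m FS q F' f"
  shows "(\<lambda>n. N (\<lambda>x. F n x - F' n x)) \<longlonglongrightarrow> 0"
proof (rule N_tendsto_0)
  have fs: "F n \<in> FS" "F' n \<in> FS" for n using F F' by (simp_all add: form_approximates_def)
  note f2 = fs_ell2[OF fs(1)] fs_ell2[OF fs(2)]
  have f: "f \<in> ell2 m" using F by (simp add: form_approximates_def)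
  show "(\<lambda>x. F n x - F' n x) \<in> FS" for n by (intro fs_diff fs)
  have l: "(\<lambda>n. ell2_norm m (\<lambda>x. F n x - f x) + ell2_norm m (\<lambda>x. F' n x - f x)) \<longlonglongrightarrow> 0 + 0"
    using F F' unfolding form_approximates_def by (intro tendsto_add) auto
  have "ell2_norm m (\<lambda>x. F n x - F' n x) \<le> ell2_norm m (\<lambda>x. F n x - f x) + ell2_norm m (\<lambda>x. F' n x - f x)" for n
    using norm_triangle[OF f2(1)[of n] f f2(2)[of n]] norm_diff_commute[OF f f2(2), of n] by simp
  then show "(\<lambda>n. ell2_norm m (\<lambda>x. F n x - F' n x)) \<longlonglongrightarrow> 0"
    by (intro Lim_null_comparison[OF _ l[simplified]]) auto
  show "form_Cauchy q (\<lambda>n x. F n x - F' n x)" unfolding form_Cauchy_def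
  proof (intro allI impI)
    fix e :: real assume e: "e > 0"
    define d where "d = sqrt (e / (1 + \<bar>c\<bar>)) / 2"
    have d: "d > 0" using e by (simp add: d_def)
    obtain M1 where M1: "\<And>j k. j \<ge> M1 \<Longrightarrow> k \<ge> M1 \<Longrightarrow> N (\<lambda>x. F j x - F k x) < d"
      using approximates_N_Cauchy[OF F d] by blast
    obtain M2 where M2: "\<And>j k. j \<ge> M2 \<Longrightarrow> k \<ge> M2 \<Longrightarrow> N (\<lambda>x. F' j x - F' k x) < d"
      using approximates_N_Cauchy[OF F' d] by blast
    show "\<exists>M. \<forall>j\<ge>M. \<forall>k\<ge>M. cmod (q (\<lambda>x. F j x - F' j x - (F k x - F' k x)) (\<lambda>x. F j x - F' j x - (F k x - F' k x))) < e"
    proof (intro exI allI impI)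
      fix j k assume jk: "j \<ge> max M1 M2" "k \<ge> max M1 M2"
      let ?a = "\<lambda>x. F j x - F k x" and ?b = "\<lambda>x. F' k x - F' j x"
      have ab: "?a \<in> FS" "?b \<in> FS" by (intro fs_diff fs)+
      have "(\<lambda>x. F j x - F' j x - (F k x - F' k x)) = (\<lambda>x. ?a x + ?b x)" by auto
      moreover have "cmod (q (\<lambda>x. ?a x + ?b x) (\<lambda>x. ?a x + ?b x)) < e"
      proof -
        have ab': "(\<lambda>x. ?a x + ?b x) \<in> FS" by (rule qc.add_mem[OF ab])
        have "N (\<lambda>x. ?a x + ?b x) \<le> N ?a + N ?b" by (rule qc.seminorm_add[OF ab])
        also have "\<dots> < 2 * d" using M1[of j k] M2[of k j] jk by simp
        finally have n: "N (\<lambda>x. ?a x + ?b x) < 2 * d" .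
        have "cmod (q (\<lambda>x. ?a x + ?b x) (\<lambda>x. ?a x + ?b x)) \<le> (1 + \<bar>c\<bar>) * (N (\<lambda>x. ?a x + ?b x))\<^sup>2"
          by (rule q_le_N[OF ab'])
        also have "\<dots> < (1 + \<bar>c\<bar>) * (2 * d)\<^sup>2"
          using n qc.seminorm_nonneg[OF ab'] by (intro mult_strict_left_mono power_strict_mono) auto
        also have "\<dots> = e" using e by (simp add: d_def)
        finally show ?thesis .
      qed
      ultimately show "cmod (q (\<lambda>x. F j x - F' j x - (F k x - F' k x)) (\<lambda>x. F j x - F' j x - (F k x - F' k x))) < e"
        by simp
    qed
  qed
qed

lemma approximates_inner_lim:
  assumes F: "form_approximates m FS q F f" and G: "form_approximates m FS q G g"
  shows "(\<lambda>n. ell2_inner m (F n) (G n)) \<longlonglongrightarrow> ell2_inner m f g"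
  using F G unfolding form_approximates_def by (intro tendsto_inner) (auto simp: fs_ell2)

lemma closure_form_lim:
  assumes F: "form_approximates m FS q F f" and G: "form_approximates m FS q G g"
  shows "(\<lambda>n. q (F n) (G n)) \<longlonglongrightarrow> closure_form m FS q f g"
proof -
  obtain z where z: "(\<lambda>n. qc (F n) (G n)) \<longlonglongrightarrow> z"
    using approximates_convergent[OF F G] by (auto simp: convergent_def)
  have lim: "(\<lambda>n. q (F' n) (G' n)) \<longlonglongrightarrow> z - of_real c * ell2_inner m f g"
    if F': "form_approximates m FS q F' f" and G': "form_approximates m FS q G' g" for F' G'
  proof -
    have fs: "F n \<in> FS" "G n \<in> FS" "F' n \<in> FS" "G' n \<in> FS" for n
      using F G F' G' by (simp_all add: form_approximates_def)
    obtain A where A: "A \<ge> 0" "\<And>n. N (F n) \<le> A" using approximates_bounded[OF F] by blast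
    obtain B where B: "B \<ge> 0" "\<And>n. N (G' n) \<le> B" using approximates_bounded[OF G'] by blast
    have "(\<lambda>n. N (\<lambda>x. F' n x - F n x) * B + A * N (\<lambda>x. G' n x - G n x)) \<longlonglongrightarrow> 0 * B + A * 0"
      by (intro tendsto_intros approximates_same[OF F' F] approximates_same[OF G' G])
    then have l: "(\<lambda>n. N (\<lambda>x. F' n x - F n x) * B + A * N (\<lambda>x. G' n x - G n x)) \<longlonglongrightarrow> 0" by simp
    have "cmod (qc (F' n) (G' n) - qc (F n) (G n)) \<le> N (\<lambda>x. F' n x - F n x) * B + A * N (\<lambda>x. G' n x - G n x)" for n
    proof -
      have "cmod (qc (F' n) (G' n) - qc (F n) (G n)) \<le> N (\<lambda>x. F' n x - F n x) * N (G' n) + N (F n) * N (\<lambda>x. G' n x - G n x)"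
        by (rule form_diff_le[OF fs(3,1,4,2)])
      also have "\<dots> \<le> N (\<lambda>x. F' n x - F n x) * B + A * N (\<lambda>x. G' n x - G n x)"
        using A B fs fs_diff by (intro add_mono mult_left_mono mult_right_mono) auto
      finally show ?thesis .
    qed
    then have "(\<lambda>n. qc (F' n) (G' n) - qc (F n) (G n)) \<longlonglongrightarrow> 0"
      by (intro Lim_null_comparison[OF _ l]) auto
    from tendsto_add[OF this z] have "(\<lambda>n. qc (F' n) (G' n)) \<longlonglongrightarrow> z" by simp
    then have "(\<lambda>n. qc (F' n) (G' n) - of_real c * ell2_inner m (F' n) (G' n)) \<longlonglongrightarrow> z - of_real c * ell2_inner m f g"
      by (intro tendsto_intros approximates_inner_lim F' G')
    then show ?thesis by (simp add: qc_def)
  qed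
  have "closure_form m FS q f g = z - of_real c * ell2_inner m f g"
    unfolding closure_form_def
  proof (rule the_equality)
    fix z' assume "\<forall>F G. form_approximates m FS q F f \<longrightarrow> form_approximates m FS q G g \<longrightarrow> (\<lambda>n. q (F n) (G n)) \<longlonglongrightarrow> z'"
    then have "(\<lambda>n. q (F n) (G n)) \<longlonglongrightarrow> z'" using F G by blast
    then show "z' = z - of_real c * ell2_inner m f g" using lim[OF F G] LIMSEQ_unique by blast
  qed (use lim in blast)
  then show ?thesis using lim[OF F G] by simp
qed

text \<open>The limits in the definition of the closure exist and do not depend on the approximating sequences, so the
  properties of \<open>q\<close> carry over.\<close>

lemma closure_form_herm:
  assumes "f \<in> closure_domain m FS q" "g \<in> closure_domain m FS q"
  shows "closure_form m FS q g f = cnj (closure_form m FS q f g)"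
proof -
  obtain F G where F: "form_approximates m FS q F f" and G: "form_approximates m FS q G g"
    using assms by (auto simp: closure_domain_def)
  have "q (G n) (F n) = cnj (q (F n) (G n))" for n
    using F G by (intro q_herm) (simp_all add: form_approximates_def)
  then have 1: "(\<lambda>n. cnj (q (F n) (G n))) \<longlonglongrightarrow> closure_form m FS q g f"
    using closure_form_lim[OF G F] by simp
  have 2: "(\<lambda>n. cnj (q (F n) (G n))) \<longlonglongrightarrow> cnj (closure_form m FS q f g)"
    by (rule tendsto_cnj[OF closure_form_lim[OF F G]])
  show ?thesis by (rule LIMSEQ_unique[OF 1 2])
qed

lemma R_in_L:
  assumes f: "f \<in> ell2 m" shows "(R f, \<lambda>x. f x - of_real c * R f x) \<in> L"
proof -
  have dom: "R f \<in> closure_domain m FS q" using R_approximates[OF f] by (auto simp: closure_domain_def)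
  have "closure_form m FS q (R f) g = ell2_inner m (\<lambda>x. f x - of_real c * R f x) g"
    if "g \<in> closure_domain m FS q" for g
  proof -
    obtain G where G: "form_approximates m FS q G g" using \<open>g \<in> closure_domain m FS q\<close> by (auto simp: closure_domain_def)
    have fs: "G n \<in> FS" for n using G by (simp add: form_approximates_def)
    have g: "g \<in> ell2 m" using G by (simp add: form_approximates_def)
    have "(\<lambda>n. qc (Rn n f) (G n) - ell2_inner m f (G n)) \<longlonglongrightarrow> 0"
    proof (rule LIMSEQ_I)
      fix e :: real assume e: "e > 0"
      define d where "d = e / (2 * ell2_norm m f + 1)"
      have pos: "2 * ell2_norm m f + 1 > 0" using norm_nonneg[of f] by linarith
      have d: "d > 0" using e pos by (simp add: d_def)
      obtain K where K: "\<And>j k. j \<ge> K \<Longrightarrow> k \<ge> K \<Longrightarrow> N (\<lambda>x. G j x - G k x) < d"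
        using approximates_N_Cauchy[OF G d] by blast
      obtain M where M: "\<And>n. n \<ge> M \<Longrightarrow> G K \<in> supported n" using fs_supported[OF fs] by blast
      have "norm (qc (Rn n f) (G n) - ell2_inner m f (G n) - 0) < e" if n: "n \<ge> max K M" for n
      proof -
        let ?D = "\<lambda>x. G n x - G K x"
        have D: "?D \<in> FS" by (intro fs_diff fs)
        have eq: "qc (Rn n f) (G K) = ell2_inner m f (G K)"
          using M[of n] n by (intro Rn_eq[OF f _ order_refl]) auto
        have sp: "qc (Rn n f) (G n) - ell2_inner m f (G n) = qc (Rn n f) ?D - ell2_inner m f ?D"
          using eq by (simp add: qc.diff_right diff_right Rn_fs[OF f] fs f fs_ell2)
        have b1: "cmod (qc (Rn n f) ?D) \<le> ell2_norm m f * N ?D"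
          using qc.Cauchy_Schwarz[OF Rn_fs[OF f] D, of n]
            mult_right_mono[OF N_Rn_le[OF f] qc.seminorm_nonneg[OF D], of n] by linarith
        have b2: "cmod (ell2_inner m f ?D) \<le> ell2_norm m f * N ?D"
          using CS[OF f fs_ell2[OF D]] mult_left_mono[OF norm_le_N[OF D] norm_nonneg, of f] by linarith
        have "cmod (qc (Rn n f) (G n) - ell2_inner m f (G n)) \<le> 2 * ell2_norm m f * N ?D"
          unfolding sp using norm_triangle_ineq4[of "qc (Rn n f) ?D" "ell2_inner m f ?D"] b1 b2 by linarith
        also have "\<dots> \<le> 2 * ell2_norm m f * d" using K[of n K] n by (intro mult_left_mono) auto
        also have "\<dots> < (2 * ell2_norm m f + 1) * d" using d by (simp add: algebra_simps)
        also have "\<dots> = e" using pos by (simp add: d_def)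
        finally show ?thesis by simp
      qed
      then show "\<exists>M. \<forall>n\<ge>M. norm (qc (Rn n f) (G n) - ell2_inner m f (G n) - 0) < e" by blast
    qed
    moreover have "(\<lambda>n. ell2_inner m f (G n)) \<longlonglongrightarrow> ell2_inner m f g"
      using G f unfolding form_approximates_def by (intro tendsto_inner const_tendsto) (auto simp: fs_ell2)
    moreover have "(\<lambda>n. ell2_inner m (Rn n f) (G n)) \<longlonglongrightarrow> ell2_inner m (R f) g"
      by (rule approximates_inner_lim[OF R_approximates[OF f] G])
    ultimately have "(\<lambda>n. (qc (Rn n f) (G n) - ell2_inner m f (G n)) + ell2_inner m f (G n) - of_real c * ell2_inner m (Rn n f) (G n))
        \<longlonglongrightarrow> 0 + ell2_inner m f g - of_real c * ell2_inner m (R f) g"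
      by (intro tendsto_intros)
    then have "(\<lambda>n. q (Rn n f) (G n)) \<longlonglongrightarrow> ell2_inner m f g - of_real c * ell2_inner m (R f) g"
      by (simp add: qc_def)
    then have "closure_form m FS q (R f) g = ell2_inner m f g - of_real c * ell2_inner m (R f) g"
      using closure_form_lim[OF R_approximates[OF f] G] LIMSEQ_unique by blast
    then show ?thesis using f g R_ell2[OF f] by (simp add: diff_left scale_left mem)
  qed
  moreover have "(\<lambda>x. f x - of_real c * R f x) \<in> ell2 m" by (intro mem f R_ell2)
  ultimately show ?thesis using dom by (simp add: L_def form_operator_def)
qed

text \<open>The operator of the closed form is \<open>R\<^sup>-\<^sup>1 - c\<close>. One inclusion is the Galerkin limit; the other one holds
  because the operator is symmetric and \<open>R\<^sup>-\<^sup>1\<close> is onto.\<close>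

theorem L_eq: "L = {(R f, \<lambda>x. f x - of_real c * R f x) | f. f \<in> ell2 m}"
proof -
  have "(u, h) \<in> {(R f, \<lambda>x. f x - of_real c * R f x) | f. f \<in> ell2 m}" if uh: "(u, h) \<in> L" for u h
  proof -
    have ud: "u \<in> closure_domain m FS q" and h: "h \<in> ell2 m"
      and eq: "\<And>g. g \<in> closure_domain m FS q \<Longrightarrow> closure_form m FS q u g = ell2_inner m h g"
      using uh by (auto simp: L_def form_operator_def)
    have u: "u \<in> ell2 m" using ud by (auto simp: closure_domain_def form_approximates_def)
    let ?k = "\<lambda>x. h x + of_real c * u x"
    have k: "?k \<in> ell2 m" by (intro mem u h)
    have "R ?k = u"
    proof (rule eq_by_delta)
      fix x
      let ?g = "delta x :: 'x \<Rightarrow> complex"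
      have g: "?g \<in> ell2 m" by simp
      have Rg: "R ?g \<in> closure_domain m FS q" and Rg': "closure_form m FS q (R ?g) u = ell2_inner m (\<lambda>x. ?g x - of_real c * R ?g x) u"
        using R_in_L[OF g] ud by (auto simp: L_def form_operator_def)
      have "ell2_inner m (R ?k) ?g = ell2_inner m h (R ?g) + of_real c * ell2_inner m u (R ?g)"
        using k g u h by (simp add: R.R_sym lin_left R_ell2 del: inner_delta)
      also have "ell2_inner m h (R ?g) = cnj (closure_form m FS q (R ?g) u)"
        using eq[OF Rg] closure_form_herm[OF Rg ud] by simp
      also have "\<dots> = ell2_inner m u (\<lambda>x. ?g x - of_real c * R ?g x)"
        unfolding Rg' by (rule herm[symmetric]) (intro mem g R_ell2 u)+
      also have "\<dots> = ell2_inner m u ?g - of_real c * ell2_inner m u (R ?g)"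
        using u g R_ell2[OF g] by (simp add: diff_right scale_right mem del: inner_delta)
      finally show "ell2_inner m (R ?k) ?g = ell2_inner m u ?g" by simp
    qed
    then have "(u, h) = (R ?k, \<lambda>x. ?k x - of_real c * R ?k x)" by simp
    then show ?thesis using k by blast
  qed
  then show ?thesis using R_in_L by fast
qed

end

context shifted_form
begin

text \<open>The lower bound of the form is inherited by the operator, again through the Galerkin approximations.\<close>

lemma L_lower:
  assumes uh: "(u, h) \<in> L" shows "- C * (ell2_norm m u)\<^sup>2 \<le> Re (ell2_inner m h u)"
proof -
  obtain k where k: "k \<in> ell2 m" "u = R k" "h = (\<lambda>x. k x - of_real c * R k x)"
    using uh unfolding L_eq by blast
  note Rk = R_ell2[OF k(1)]
  have "(c - C) * (ell2_norm m (Rn n k))\<^sup>2 \<le> (N (Rn n k))\<^sup>2" for n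
    using q_lower[OF Rn_fs[OF k(1)], of n] norm_sq[OF Rn_ell2[OF k(1)], of n]
    by (simp add: qc.seminorm_sq[OF Rn_fs[OF k(1)]] qc_def algebra_simps)
  moreover have "(\<lambda>n. (c - C) * (ell2_norm m (Rn n k))\<^sup>2) \<longlonglongrightarrow> (c - C) * (ell2_norm m (R k))\<^sup>2"
    by (intro tendsto_intros tendsto_ell2_norm Rn_ell2 R_ell2 Rn_tendsto k)
  ultimately have "(c - C) * (ell2_norm m (R k))\<^sup>2 \<le> Re (ell2_inner m (R k) k)"
    using inner_R_self[OF k(1)] by (intro LIMSEQ_le) auto
  moreover have "Re (ell2_inner m h u) = Re (ell2_inner m (R k) k) - c * (ell2_norm m (R k))\<^sup>2"
    using k Rk norm_sq[OF Rk] by (simp add: diff_left scale_left mem R.R_sym)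
  ultimately show ?thesis using k(2) by (simp add: algebra_simps)
qed

lemma L_ell2: "(u, h) \<in> L \<Longrightarrow> u \<in> ell2 m" "(u, h) \<in> L \<Longrightarrow> h \<in> ell2 m"
  unfolding L_eq using R_ell2 by (auto intro!: mem)

lemma L_sym:
  assumes "(u, h) \<in> L" "(g, w) \<in> L" shows "ell2_inner m h g = ell2_inner m u w"
proof -
  obtain k l where k: "k \<in> ell2 m" "u = R k" "h = (\<lambda>x. k x - of_real c * R k x)"
    and l: "l \<in> ell2 m" "g = R l" "w = (\<lambda>x. l x - of_real c * R l x)"
    using assms unfolding L_eq by blast
  show ?thesis using k(1) l(1)
    by (simp add: k(2,3) l(2,3) diff_left diff_right scale_left scale_right mem R_ell2 R.R_sym)
qed

lemma L_spectral_measure: "\<exists>E. projection_valued_measure m E \<and> L = spectral_integral m E (\<lambda>s. of_real s)"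
proof -
  obtain E where "projection_valued_measure m E"
    "spectral_integral m E (\<lambda>s. of_real s) = {(R f, \<lambda>x. f x - of_real c * R f x) | f. f \<in> ell2 m}"
    using R.resolvent_spectral_measure[OF R_injective, of c] by blast
  then show ?thesis by (intro exI[of _ E]) (simp only: L_eq)
qed

text \<open>The Galerkin approximations of \<open>(1 + i s L)\<^sup>-\<^sup>1 f\<close> stay bounded. Testing them with the Galerkin
  approximations of \<open>(1 - i s L)\<^sup>-\<^sup>1 \<delta>\<^sub>x\<close>, which converge strongly, gives pointwise convergence.\<close>

lemma Galerkin_pointwise:
  assumes f: "f \<in> ell2 m"
    and U: "\<And>n. U n \<in> supported n"
      "\<And>n g. g \<in> supported n \<Longrightarrow> ell2_inner m (U n) g + \<i> * of_real s * q (U n) g = ell2_inner m f g"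
    and uh: "(u, h) \<in> L" "\<And>x. u x + \<i> * of_real s * h x = f x"
    and gw: "(g, w) \<in> L" "\<And>z. g z - \<i> * of_real s * w z = delta x z"
  shows "(\<lambda>n. U n x) \<longlonglongrightarrow> u x"
proof -
  have Ufs: "U n \<in> FS" for n by (rule supported_fs[OF U(1)])
  note U2 = fs_ell2[OF Ufs]
  note ell2s = L_ell2[OF uh(1)] L_ell2[OF gw(1)]
  have Ub: "ell2_norm m (U n) \<le> ell2_norm m f" for n
  proof -
    have "Re (ell2_inner m (U n) (U n)) = Re (ell2_inner m f (U n))"
      using U(2)[OF U(1), of n] q_real[OF Ufs, of n] by (simp add: complex_eq_iff)
    then have "ell2_norm m (U n) * ell2_norm m (U n) \<le> ell2_norm m f * ell2_norm m (U n)"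
      using CS[OF f U2, of n] complex_Re_le_cmod[of "ell2_inner m f (U n)"] norm_sq[OF U2, of n]
      by (simp add: power2_eq_square)
    then show ?thesis
      using norm_nonneg[of "U n"] norm_nonneg[of f] mult_right_le_imp_le
      by (cases "0 < ell2_norm m (U n)") (auto simp: not_less intro: order_trans)
  qed
  obtain k where k: "k \<in> ell2 m" "g = R k" "w = (\<lambda>x. k x - of_real c * R k x)"
    using gw(1) unfolding L_eq by blast
  define G where "G n = Rn n k" for n
  have G2: "G n \<in> ell2 m" for n unfolding G_def by (rule Rn_ell2[OF k(1)])
  define a where "a = \<i> * complex_of_real s"
  define D where "D n = (\<lambda>z. G n z - a * (k z - of_real c * G n z))" for n
  have D2: "D n \<in> ell2 m" for n unfolding D_def by (intro mem G2 k)
  have fG: "ell2_inner m f (G n) = ell2_inner m (U n) (D n)" for n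
  proof -
    have Gs: "G n \<in> supported n" unfolding G_def by (rule Rn_supported[OF k(1)])
    have "qc (G n) (U n) = ell2_inner m k (U n)"
      unfolding G_def by (rule Rn_eq[OF k(1) U(1) order_refl])
    then have "qc (U n) (G n) = ell2_inner m (U n) k"
      using qc.herm[OF supported_fs[OF Gs] Ufs, of n] herm[OF k(1) U2, of n] by simp
    then have "q (U n) (G n) = ell2_inner m (U n) k - of_real c * ell2_inner m (U n) (G n)"
      by (simp add: qc_def algebra_simps)
    then have "ell2_inner m f (G n) = ell2_inner m (U n) (G n)
        + a * (ell2_inner m (U n) k - of_real c * ell2_inner m (U n) (G n))"
      using U(2)[OF Gs] by (simp add: a_def)
    also have "\<dots> = ell2_inner m (U n) (D n)"
      unfolding D_def using U2 G2 k(1) by (simp add: diff_right scale_right mem a_def)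
    finally show ?thesis .
  qed
  have lim1: "(\<lambda>n. ell2_inner m f (G n)) \<longlonglongrightarrow> ell2_inner m f g"
    unfolding G_def k(2) using f k
    by (intro tendsto_inner[OF _ _ const_tendsto Rn_ell2 R_ell2 Rn_tendsto]) auto
  have DG: "(\<lambda>z. D n z - delta x z) = (\<lambda>z. (1 + a * of_real c) * (G n z - R k z))" for n
  proof
    fix z
    have "delta x z = R k z - a * (k z - of_real c * R k z)"
      using gw(2)[of z] unfolding k(2,3) a_def by simp
    then show "D n z - delta x z = (1 + a * of_real c) * (G n z - R k z)"
      by (simp add: D_def algebra_simps)
  qed
  have limD: "(\<lambda>n. ell2_norm m (\<lambda>z. D n z - delta x z)) \<longlonglongrightarrow> 0"
  proof -
    have "(\<lambda>n. cmod (1 + a * of_real c) * ell2_norm m (\<lambda>z. G n z - R k z)) \<longlonglongrightarrow> cmod (1 + a * of_real c) * 0"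
      unfolding G_def by (intro tendsto_intros Rn_tendsto k)
    then show ?thesis unfolding DG using norm_scale[OF diff_mem[OF G2 R_ell2[OF k(1)]]] by simp
  qed
  have "(\<lambda>n. ell2_norm m f * ell2_norm m (\<lambda>z. D n z - delta x z)) \<longlonglongrightarrow> ell2_norm m f * 0"
    by (intro tendsto_intros limD)
  then have null: "(\<lambda>n. ell2_norm m f * ell2_norm m (\<lambda>z. D n z - delta x z)) \<longlonglongrightarrow> 0" by simp
  have "(\<lambda>n. ell2_inner m (U n) (\<lambda>z. D n z - delta x z)) \<longlonglongrightarrow> 0"
  proof (rule Lim_null_comparison[OF _ null], intro always_eventually allI)
    fix n
    have "cmod (ell2_inner m (U n) (\<lambda>z. D n z - delta x z)) \<le> ell2_norm m (U n) * ell2_norm m (\<lambda>z. D n z - delta x z)"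
      by (intro CS U2 mem D2 delta_ell2)
    also have "\<dots> \<le> ell2_norm m f * ell2_norm m (\<lambda>z. D n z - delta x z)"
      by (intro mult_right_mono Ub) auto
    finally show "cmod (ell2_inner m (U n) (\<lambda>z. D n z - delta x z)) \<le> ell2_norm m f * ell2_norm m (\<lambda>z. D n z - delta x z)" .
  qed
  from tendsto_diff[OF lim1 this]
  have "(\<lambda>n. ell2_inner m (U n) (delta x)) \<longlonglongrightarrow> ell2_inner m f g"
    unfolding fG using U2 D2 by (simp add: diff_right del: inner_delta)
  moreover have "ell2_inner m f g = ell2_inner m u (delta x)"
  proof -
    have "f = (\<lambda>z. u z + a * h z)" using uh(2) by (auto simp: a_def fun_eq_iff)
    then have "ell2_inner m f g = ell2_inner m u g + a * ell2_inner m h g"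
      using ell2s by (simp add: lin_left)
    also have "ell2_inner m h g = ell2_inner m u w" by (rule L_sym[OF uh(1) gw(1)])
    also have "ell2_inner m u g + a * ell2_inner m u w = ell2_inner m u (\<lambda>z. g z - a * w z)"
      using ell2s by (simp add: diff_right scale_right mem a_def)
    also have "(\<lambda>z. g z - a * w z) = delta x" using gw(2) by (auto simp: a_def fun_eq_iff)
    finally show ?thesis .
  qed
  ultimately have "(\<lambda>n. U n x * of_real (m x)) \<longlonglongrightarrow> u x * of_real (m x)" by simp
  then have "(\<lambda>n. U n x * of_real (m x) / of_real (m x)) \<longlonglongrightarrow> u x * of_real (m x) / of_real (m x)"
    by (intro tendsto_divide tendsto_const) auto
  then show ?thesis by simp
qed

lemma Galerkin_imaginary_solution:
  assumes f: "f \<in> ell2 m"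
  shows "\<exists>u\<in>supported n. \<forall>g\<in>supported n. ell2_inner m u g + \<i> * of_real s * q u g = ell2_inner m f g"
proof (rule Galerkin_solution[where B = "\<lambda>u g. ell2_inner m u g + \<i> * of_real s * q u g", OF _ _ _ f finite_exhaustion])
  fix u assume u: "u \<in> FS" and 0: "ell2_inner m u u + \<i> * of_real s * q u u = 0"
  have "Re (ell2_inner m u u) = 0" using 0 q_real[OF u] by (simp add: complex_eq_iff)
  then have "ell2_norm m u = 0" using norm_sq[OF fs_ell2[OF u]] by simp
  then show "u = (\<lambda>_. 0)" by (rule norm_zero_imp[OF fs_ell2[OF u]])
qed (auto simp: lin_left lin_right q_lin q_linr fs_ell2 algebra_simps)

end

section \<open>Magnetic forms\<close>

locale magnetic_graph = weights m for m :: "'x::countable \<Rightarrow> real" +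
  fixes b :: "'x \<Rightarrow> 'x \<Rightarrow> real" and v :: "'x \<Rightarrow> real" and \<theta> :: "'x \<Rightarrow> 'x \<Rightarrow> real"
  assumes graph: "weighted_graph b m" and magnetic: "magnetic_potential b \<theta>"
begin

lemma b_nonneg [simp]: "0 \<le> b x y" and b_sym: "b x y = b y x" and b_diag [simp]: "b x x = 0"
  and b_summable: "(\<lambda>y. b x y) summable_on UNIV"
  using graph by (auto simp: weighted_graph_def)

definition phase :: "'x \<Rightarrow> 'x \<Rightarrow> complex" where "phase x y = exp (\<i> * of_real (\<theta> x y))"

lemma norm_phase [simp]: "cmod (phase x y) = 1" by (simp add: phase_def)

lemma phase_sym: "b x y > 0 \<Longrightarrow> cnj (phase y x) = phase x y"
  using magnetic unfolding magnetic_potential_def phase_def by (simp add: exp_cnj)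

text \<open>Outside the edges the summands of the form vanish, so the sum may be extended to all pairs.\<close>

definition kin :: "('x \<Rightarrow> complex) \<Rightarrow> ('x \<Rightarrow> complex) \<Rightarrow> 'x \<times> 'x \<Rightarrow> complex" where
  "kin f g = (\<lambda>(x, y). of_real (b x y) * (f x - phase x y * f y) * cnj (g x - phase x y * g y))"

definition pot :: "('x \<Rightarrow> complex) \<Rightarrow> ('x \<Rightarrow> complex) \<Rightarrow> 'x \<Rightarrow> complex" where
  "pot f g = (\<lambda>x. of_real (v x) * f x * cnj (g x) * of_real (m x))"

abbreviation "form \<equiv> magnetic_form b m v \<theta>"

lemma form_eq: "form f g = 1 / 2 * infsum (kin f g) UNIV + infsum (pot f g) UNIV"
proof -
  have "infsum (kin f g) UNIV = (\<Sum>\<^sub>\<infinity>(x, y) \<in> {(x, y). b x y > 0}.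
      of_real (b x y) * (f x - phase x y * f y) * cnj (g x - phase x y * g y))"
  proof (rule infsum_cong_neutral)
    fix z assume "z \<in> UNIV - {(x, y). 0 < b x y}"
    then have "\<not> 0 < b (fst z) (snd z)" by (simp add: case_prod_beta)
    then have "b (fst z) (snd z) = 0" using b_nonneg[of "fst z" "snd z"] by linarith
    then show "kin f g z = 0" by (simp add: kin_def case_prod_beta)
  qed (auto simp: kin_def)
  then show ?thesis by (simp add: magnetic_form_def phase_def pot_def)
qed

text \<open>Finite support in one variable suffices, since the vertex degrees are finite.\<close>

lemma summable_edges: assumes "f \<in> finitely_supported" shows "(\<lambda>(x, y). b x y * cmod (f x)) summable_on UNIV"
proof -
  have "(\<lambda>(x, y). b x y * cmod (f x)) summable_on (Sigma UNIV (\<lambda>_. UNIV))"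
  proof (rule summable_on_SigmaI)
    fix x
    show "((\<lambda>y. case (x, y) of (x, y) \<Rightarrow> b x y * cmod (f x)) has_sum (\<Sum>\<^sub>\<infinity>y. b x y) * cmod (f x)) UNIV"
      using has_sum_cmult_left[OF has_sum_infsum[OF b_summable[of x]]] by simp
  next
    show "(\<lambda>x. (\<Sum>\<^sub>\<infinity>y. b x y) * cmod (f x)) summable_on UNIV"
      by (rule finite_nonzero_values_imp_summable_on)
         (use assms in \<open>auto simp: finitely_supported_def intro: finite_subset[of _ "{x. f x \<noteq> 0}"]\<close>)
  qed auto
  then show ?thesis by simp
qed

lemma summable_edges': assumes "f \<in> finitely_supported" shows "(\<lambda>(x, y). b x y * cmod (f y)) summable_on UNIV"
proof -
  have "(\<lambda>z. (\<lambda>(x, y). b x y * cmod (f x)) (prod.swap z)) summable_on UNIV \<longleftrightarrow> (\<lambda>(x, y). b x y * cmod (f x)) summable_on UNIV"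
    by (rule summable_on_reindex_bij_betw) (rule bij_swap)
  moreover have "(\<lambda>(x, y). b x y * cmod (f y)) = (\<lambda>z. (\<lambda>(x, y). b x y * cmod (f x)) (prod.swap z))"
    using b_sym by (auto simp: fun_eq_iff)
  ultimately show ?thesis using summable_edges[OF assms] by simp
qed

lemma fs_bounded: assumes "f \<in> finitely_supported" obtains M where "\<And>x. cmod (f x) \<le> M"
proof -
  let ?S = "{x. f x \<noteq> 0}"
  have fin: "finite ?S" using assms by (simp add: finitely_supported_def)
  have "cmod (f x) \<le> (\<Sum>x\<in>?S. cmod (f x))" for x
    using fin by (cases "x \<in> ?S") (auto intro: member_le_sum sum_nonneg)
  then show ?thesis using that by blast
qed

lemma kin_summable:
  assumes f: "f \<in> finitely_supported" and g: "g \<in> finitely_supported" shows "kin f g summable_on UNIV"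
proof -
  obtain M where M: "\<And>x. cmod (g x) \<le> M" using fs_bounded[OF g] by blast
  have "(\<lambda>z. ((\<lambda>(x, y). b x y * cmod (f x)) z + (\<lambda>(x, y). b x y * cmod (f y)) z) * (2 * M)) summable_on UNIV"
    by (intro summable_on_cmult_left summable_on_add summable_edges summable_edges' f)
  then have "(\<lambda>z. norm (kin f g z)) summable_on UNIV"
  proof (rule summable_on_comparison_test)
    fix z :: "'x \<times> 'x"
    obtain x y where z: "z = (x, y)" by (cases z)
    have 1: "cmod (f x - phase x y * f y) \<le> cmod (f x) + cmod (f y)"
      using norm_triangle_ineq4[of "f x" "phase x y * f y"] by (simp add: norm_mult)
    have 2: "cmod (g x - phase x y * g y) \<le> 2 * M"
      using norm_triangle_ineq4[of "g x" "phase x y * g y"] M[of x] M[of y] by (simp add: norm_mult)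
    have "norm (kin f g z) = b x y * (cmod (f x - phase x y * f y) * cmod (g x - phase x y * g y))"
      by (simp add: kin_def z norm_mult mult.assoc del: complex_cnj_diff complex_cnj_mult)
    also have "\<dots> \<le> b x y * ((cmod (f x) + cmod (f y)) * (2 * M))"
      by (intro mult_left_mono mult_mono 1 2) auto
    finally show "norm (kin f g z) \<le> ((\<lambda>(x, y). b x y * cmod (f x)) z + (\<lambda>(x, y). b x y * cmod (f y)) z) * (2 * M)"
      by (simp add: z algebra_simps)
  qed auto
  then show ?thesis by (rule abs_summable_summable)
qed

lemma pot_summable: "f \<in> finitely_supported \<Longrightarrow> pot f g summable_on UNIV"
  by (rule finite_nonzero_values_imp_summable_on)
     (auto simp: finitely_supported_def pot_def intro: finite_subset[of _ "{x. f x \<noteq> 0}"])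

lemma form_lin:
  assumes f: "f \<in> finitely_supported" and g: "g \<in> finitely_supported" and h: "h \<in> finitely_supported"
  shows "form (\<lambda>x. f x + a * g x) h = form f h + a * form g h"
proof -
  have "kin (\<lambda>x. f x + a * g x) h = (\<lambda>z. kin f h z + a * kin g h z)"
    by (auto simp: kin_def fun_eq_iff algebra_simps)
  then have k: "infsum (kin (\<lambda>x. f x + a * g x) h) UNIV = infsum (kin f h) UNIV + a * infsum (kin g h) UNIV"
    using kin_summable[OF f h] kin_summable[OF g h]
    by (simp add: infsum_add summable_on_cmult_right infsum_cmult_right')
  have "pot (\<lambda>x. f x + a * g x) h = (\<lambda>z. pot f h z + a * pot g h z)"
    by (auto simp: pot_def fun_eq_iff algebra_simps)
  then have "infsum (pot (\<lambda>x. f x + a * g x) h) UNIV = infsum (pot f h) UNIV + a * infsum (pot g h) UNIV"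
    using pot_summable[OF f] pot_summable[OF g]
    by (simp add: infsum_add summable_on_cmult_right infsum_cmult_right')
  then show ?thesis unfolding form_eq k by (simp add: algebra_simps)
qed

lemma form_herm: "form g f = cnj (form f g)"
proof -
  have "kin g f = (\<lambda>z. cnj (kin f g z))" "pot g f = (\<lambda>z. cnj (pot f g z))"
    by (auto simp: kin_def pot_def fun_eq_iff)
  then show ?thesis unfolding form_eq by simp
qed

text \<open>The ordered pairs \<open>(x, y)\<close> and \<open>(y, x)\<close> contribute equally, because \<open>\<theta>\<close> is antisymmetric and \<open>b\<close> is
  symmetric.\<close>

lemma form_delta:
  assumes u: "u \<in> finitely_supported"
  shows "form u (delta x) = of_real (v x * m x + (\<Sum>\<^sub>\<infinity>y. b x y)) * u x - (\<Sum>\<^sub>\<infinity>y. of_real (b x y) * phase x y * u y)"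
proof -
  define h where "h y = of_real (b x y) * (u x - phase x y * u y)" for y
  obtain M where M: "\<And>x. cmod (u x) \<le> M" using fs_bounded[OF u] by blast
  have bsum: "(\<lambda>y. of_real (b x y) :: complex) summable_on UNIV"
    using b_summable[of x] by (rule summable_on_of_real)
  have s2: "(\<lambda>y. of_real (b x y) * phase x y * u y) summable_on UNIV"
    by (rule finite_nonzero_values_imp_summable_on)
       (use u in \<open>auto simp: finitely_supported_def intro: finite_subset[of _ "{x. u x \<noteq> 0}"]\<close>)
  have "(h has_sum (\<Sum>\<^sub>\<infinity>y. of_real (b x y)) * u x - (\<Sum>\<^sub>\<infinity>y. of_real (b x y) * phase x y * u y)) UNIV"
  proof -
    have "h = (\<lambda>y. of_real (b x y) * u x + - (of_real (b x y) * phase x y * u y))"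
      by (auto simp: h_def fun_eq_iff algebra_simps)
    then show ?thesis
      using has_sum_add[OF has_sum_cmult_left[OF has_sum_infsum[OF bsum], of "u x"] has_sum_uminusI[OF has_sum_infsum[OF s2]]]
      by simp
  qed
  moreover have "(\<Sum>\<^sub>\<infinity>y. complex_of_real (b x y)) = of_real (\<Sum>\<^sub>\<infinity>y. b x y)"
    using infsumI[OF has_sum_of_real[OF has_sum_infsum[OF b_summable[of x]]]] .
  ultimately have h: "(h has_sum of_real (\<Sum>\<^sub>\<infinity>y. b x y) * u x - (\<Sum>\<^sub>\<infinity>y. of_real (b x y) * phase x y * u y)) UNIV" (is "(h has_sum ?H) _")
    by simp
  have hx: "h x = 0" by (simp add: h_def)
  let ?Y = "UNIV - {x}"
  have hY: "(h has_sum ?H) ?Y"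
    using h by (rule has_sum_cong_neutral[THEN iffD1, rotated -1]) (use hx in auto)
  have A: "(kin u (delta x) has_sum ?H) (Pair x ` ?Y)"
  proof (subst has_sum_reindex)
    show "inj_on (Pair x) ?Y" by (auto simp: inj_on_def)
    show "(kin u (delta x) \<circ> Pair x has_sum ?H) ?Y"
      using hY by (rule has_sum_cong[THEN iffD1, rotated]) (auto simp: h_def kin_def delta_def)
  qed
  have B: "(kin u (delta x) has_sum ?H) ((\<lambda>y. (y, x)) ` ?Y)"
  proof (subst has_sum_reindex)
    show "inj_on (\<lambda>y. (y, x)) ?Y" by (auto simp: inj_on_def)
    have "(kin u (delta x) \<circ> (\<lambda>y. (y, x))) y = h y" if y: "y \<in> ?Y" for y
    proof (cases "b x y > 0")
      case True
      then have ce: "cnj (phase y x) = phase x y" by (rule phase_sym)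
      have ee: "phase y x * phase x y = 1"
        using complex_norm_square[of "phase y x"] unfolding ce by simp
      have "(kin u (delta x) \<circ> (\<lambda>y. (y, x))) y = - (of_real (b y x) * (u y - phase y x * u x) * phase x y)"
        using y ce by (simp add: kin_def delta_def)
      also have "\<dots> = of_real (b y x) * ((phase y x * phase x y) * u x - phase x y * u y)"
        by (simp add: algebra_simps)
      finally show ?thesis unfolding ee h_def by (simp add: b_sym[of y x])
    next
      case False
      then have "b x y = 0" using b_nonneg[of x y] by simp
      then show ?thesis by (simp add: kin_def h_def b_sym[of y x])
    qed
    then show "(kin u (delta x) \<circ> (\<lambda>y. (y, x)) has_sum ?H) ?Y"
      using hY by (subst has_sum_cong) auto
  qed
  have "(kin u (delta x) has_sum ?H + ?H) (Pair x ` ?Y \<union> (\<lambda>y. (y, x)) ` ?Y)"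
    by (rule has_sum_Un_disjoint[OF A B]) auto
  then have "(kin u (delta x) has_sum ?H + ?H) UNIV"
  proof (rule has_sum_cong_neutral[THEN iffD1, rotated -1])
    fix z assume z: "z \<in> UNIV - (Pair x ` ?Y \<union> (\<lambda>y. (y, x)) ` ?Y)"
    obtain y y' where yy: "z = (y, y')" by (cases z)
    have "(y = x \<and> y' = x) \<or> (y \<noteq> x \<and> y' \<noteq> x)" using z unfolding yy by blast
    then show "kin u (delta x) z = 0" unfolding yy by (auto simp: kin_def delta_def)
  qed auto
  then have k: "infsum (kin u (delta x)) UNIV = ?H + ?H" by (rule infsumI)
  have "(pot u (delta x) has_sum of_real (v x * m x) * u x) UNIV"
    by (rule has_sum_finite_neutralI[of "{x}"]) (auto simp: pot_def delta_def)
  then have p: "infsum (pot u (delta x)) UNIV = of_real (v x * m x) * u x" by (rule infsumI)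
  show ?thesis unfolding form_eq k p by (simp add: algebra_simps)
qed

lemma form_delta_finite:
  assumes X: "finite X" and u: "u \<in> supported_on X"
  shows "form u (delta x) = of_real (v x * m x + (\<Sum>\<^sub>\<infinity>y. b x y)) * u x - (\<Sum>y\<in>X. of_real (b x y) * phase x y * u y)"
proof -
  have fs: "u \<in> finitely_supported"
    using u X by (auto simp: supported_on_def finitely_supported_def intro: finite_subset[of _ X])
  have "(\<Sum>\<^sub>\<infinity>y. of_real (b x y) * phase x y * u y) = infsum (\<lambda>y. of_real (b x y) * phase x y * u y) X"
    by (rule infsum_cong_neutral) (use u in \<open>auto simp: supported_on_def\<close>)
  then show ?thesis using form_delta[OF fs, of x] X by simp
qed

lemma closable_lower_boundedI:
  assumes "\<And>f. f \<in> finitely_supported \<Longrightarrow> - C * (ell2_norm m f)\<^sup>2 \<le> Re (form f f)"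
    "closable_form m finitely_supported form"
  shows "closable_lower_bounded m form C"
  using assms by unfold_locales (auto intro: form_lin form_herm)

end

section \<open>Domination of resolvents\<close>

lemma (in closable_lower_bounded) q_right_expand:
  assumes X: "finite X" and g: "g \<in> supported_on X" and u: "u \<in> FS"
  shows "q u g = (\<Sum>x\<in>X. cnj (g x) * q u (delta x))"
proof -
  have z: "q u (\<lambda>_. 0) = 0" using q_linr[OF fs_zero fs_zero u, of 1] by simp
  have "(\<lambda>y. \<Sum>x\<in>S. g x * delta x y) \<in> FS \<and> q u (\<lambda>y. \<Sum>x\<in>S. g x * delta x y) = (\<Sum>x\<in>S. cnj (g x) * q u (delta x))"
    if "finite S" for S using that
  proof induction
    case (insert x S)
    then show ?case
      using fs_lin[OF _ delta_fs, of "\<lambda>y. \<Sum>x\<in>S. g x * delta x y" "g x" x]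
        q_linr[OF _ delta_fs u, of "\<lambda>y. \<Sum>x\<in>S. g x * delta x y" "g x" x]
      by (simp add: add.commute)
  qed (simp add: fs_zero z)
  from this[OF X] show ?thesis
    using finite_support_sum[OF X, of g] g by (simp add: supported_on_def)
qed

locale comparison = M: magnetic_graph m b v \<theta> +
    M0: magnetic_graph m b "\<lambda>x. - weighted_degree b m x" "\<lambda>_ _. 0" +
    Q: closable_lower_bounded m "magnetic_form b m v \<theta>" C +
    Q0: closable_lower_bounded m "magnetic_form b m (\<lambda>x. - weighted_degree b m x) (\<lambda>_ _. 0)" C0
  for m :: "'x::countable \<Rightarrow> real" and b v \<theta> C C0
begin

abbreviation "q \<equiv> magnetic_form b m v \<theta>"
abbreviation "q0 \<equiv> magnetic_form b m (\<lambda>x. - weighted_degree b m x) (\<lambda>_ _. 0)"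

lemma supported_on_fs: "finite X \<Longrightarrow> u \<in> supported_on X \<Longrightarrow> u \<in> finitely_supported"
  by (auto simp: supported_on_def finitely_supported_def intro: finite_subset[of _ X])

text \<open>The potential \<open>- deg\<close> cancels the diagonal, so that \<open>- L\<^sub>0\<close> is the adjacency operator.\<close>

lemma q0_delta:
  assumes "finite X" "u \<in> supported_on X"
  shows "q0 u (delta x) = - (\<Sum>y\<in>X. of_real (b x y) * u y)"
  using M0.form_delta_finite[OF assms, of x] by (simp add: M0.phase_def weighted_degree_def)

text \<open>On a finite set \<open>1 + s L\<^sub>0\<close> is a positive definite matrix with nonpositive off-diagonal entries. Test
  with the negative part.\<close>

lemma M_matrix:
  assumes X: "finite X" and s: "0 \<le> s" "s * C0 < 1" and r0: "\<And>x. x \<notin> X \<Longrightarrow> r x = 0"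
    and sup: "\<And>x. x \<in> X \<Longrightarrow> 0 \<le> m x * r x - s * (\<Sum>y\<in>X. b x y * r y)"
  shows "0 \<le> r x"
proof -
  define g where "g x = max (- r x) 0" for x
  define p where "p x = max (r x) 0" for x
  have rpg: "r x = p x - g x" and gp: "g x * p x = 0" and g0: "0 \<le> g x" and p0: "0 \<le> p x" for x
    by (auto simp: p_def g_def max_def)
  let ?G = "\<lambda>x. complex_of_real (g x)"
  have G: "?G \<in> supported_on X" using r0 by (auto simp: supported_on_def g_def)
  have Gfs: "?G \<in> finitely_supported" by (rule supported_on_fs[OF X G])
  have nG: "(ell2_norm m ?G)\<^sup>2 = (\<Sum>x\<in>X. m x * g x * g x)"
    by (subst M.norm_finite[OF X]) (use G in \<open>auto simp: supported_on_def power2_eq_square mult_ac\<close>)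
  have "q0 ?G ?G = (\<Sum>x\<in>X. of_real (g x) * - (\<Sum>y\<in>X. of_real (b x y) * of_real (g y)))"
    by (subst Q0.q_right_expand[OF X G Gfs]) (simp add: q0_delta[OF X G])
  also have "\<dots> = of_real (- (\<Sum>x\<in>X. g x * (\<Sum>y\<in>X. b x y * g y)))"
    by (simp add: sum_negf)
  finally have qG: "Re (q0 ?G ?G) = - (\<Sum>x\<in>X. g x * (\<Sum>y\<in>X. b x y * g y))"
    by (simp only: Re_complex_of_real)
  have "0 \<le> (\<Sum>x\<in>X. g x * (m x * r x - s * (\<Sum>y\<in>X. b x y * r y)))"
    by (intro sum_nonneg mult_nonneg_nonneg g0 sup)
  also have "\<dots> = (\<Sum>x\<in>X. - (m x * g x * g x) + s * (g x * (\<Sum>y\<in>X. b x y * g y)) - s * (g x * (\<Sum>y\<in>X. b x y * p y)))"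
  proof (rule sum.cong)
    fix x
    have "(\<Sum>y\<in>X. b x y * r y) = (\<Sum>y\<in>X. b x y * p y) - (\<Sum>y\<in>X. b x y * g y)"
      by (simp add: rpg right_diff_distrib sum_subtractf)
    moreover have "g x * (m x * r x) = - (m x * g x * g x)"
      using gp[of x] by (simp add: rpg algebra_simps)
    moreover have "g x * (a - s * (k - l)) = g x * a + s * (g x * l) - s * (g x * k)" for a k l
      by (simp add: algebra_simps)
    ultimately show "g x * (m x * r x - s * (\<Sum>y\<in>X. b x y * r y))
        = - (m x * g x * g x) + s * (g x * (\<Sum>y\<in>X. b x y * g y)) - s * (g x * (\<Sum>y\<in>X. b x y * p y))"
      by simp
  qed simp
  also have "\<dots> \<le> (\<Sum>x\<in>X. - (m x * g x * g x) + s * (g x * (\<Sum>y\<in>X. b x y * g y)))"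
    using s g0 p0 M.b_nonneg by (intro sum_mono) (simp add: sum_nonneg)
  also have "\<dots> = - (ell2_norm m ?G)\<^sup>2 - s * Re (q0 ?G ?G)"
    unfolding nG qG by (simp add: sum.distrib sum_negf sum_subtractf sum_distrib_left)
  also have "\<dots> \<le> - (ell2_norm m ?G)\<^sup>2 + s * (C0 * (ell2_norm m ?G)\<^sup>2)"
    using mult_left_mono[OF Q0.q_lower[OF Gfs] s(1)] by simp
  finally have "(1 - s * C0) * (ell2_norm m ?G)\<^sup>2 \<le> 0" by (simp add: algebra_simps)
  then have "(ell2_norm m ?G)\<^sup>2 \<le> 0" using s by (simp add: mult_le_0_iff)
  then have "?G = (\<lambda>_. 0)" using M.norm_zero_imp[OF M.finitely_supported_ell2[OF Gfs]] by simp
  then have "g x = 0" by (metis of_real_eq_0_iff)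
  then show ?thesis by (simp add: g_def max_def split: if_splits)
qed

text \<open>The equation for \<open>u\<close> at \<open>x\<close> reads \<open>(m + i s d) u = m f + i s A u\<close> with a real number \<open>d\<close> and with \<open>A\<close> the adjacency
  matrix twisted by phases. As \<open>|m + i s d| \<ge> m\<close>, it implies \<open>m |u| - s A |u| \<le> m |f|\<close> with the untwisted matrix, and the
  right-hand side is what the same operator makes of \<open>w\<close>. This is where the electric potential disappears.\<close>

lemma finite_domination:
  assumes X: "finite X" and s: "0 \<le> s" "s * C0 < 1" and u: "u \<in> supported_on X" and w: "w \<in> supported_on X"
    and ue: "\<And>x. x \<in> X \<Longrightarrow> u x * of_real (m x) + \<i> * of_real s * q u (delta x) = f x * of_real (m x)"
    and we: "\<And>x. x \<in> X \<Longrightarrow> w x * of_real (m x) + of_real s * q0 w (delta x) = of_real (cmod (f x)) * of_real (m x)"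
  shows "cmod (u x) \<le> Re (w x)" "Im (w x) = 0"
proof -
  have w0: "w x = 0" and u0: "u x = 0" if "x \<notin> X" for x using w u that by (auto simp: supported_on_def)
  have wRe: "m x * Re (w x) - s * (\<Sum>y\<in>X. b x y * Re (w y)) = m x * cmod (f x)"
    and wIm: "m x * Im (w x) - s * (\<Sum>y\<in>X. b x y * Im (w y)) = 0" if "x \<in> X" for x
    using we[OF that] unfolding q0_delta[OF X w] by (auto simp: complex_eq_iff algebra_simps Re_sum Im_sum)
  have "0 \<le> Im (w x)" by (rule M_matrix[OF X s]) (use w0 wIm in auto)
  moreover have "0 \<le> - Im (w x)"
    by (rule M_matrix[OF X s]) (use w0 wIm in \<open>auto simp: sum_negf\<close>)
  ultimately show "Im (w x) = 0" by simp
  have um: "m x * cmod (u x) \<le> m x * cmod (f x) + s * (\<Sum>y\<in>X. b x y * cmod (u y))" if x: "x \<in> X" for x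
  proof -
    define d where "d = v x * m x + (\<Sum>\<^sub>\<infinity>y. b x y)"
    define a where "a = (\<Sum>y\<in>X. of_real (b x y) * M.phase x y * u y)"
    have "Complex (m x) (s * d) * u x = f x * of_real (m x) + \<i> * of_real s * a"
      using ue[OF x] unfolding M.form_delta_finite[OF X u] d_def[symmetric] a_def[symmetric]
      by (simp add: Complex_eq algebra_simps)
    then have 1: "cmod (Complex (m x) (s * d)) * cmod (u x) = cmod (f x * of_real (m x) + \<i> * of_real s * a)"
      by (metis norm_mult)
    have 2: "cmod (f x * of_real (m x) + \<i> * of_real s * a) \<le> m x * cmod (f x) + s * cmod a"
      by (rule order_trans[OF norm_triangle_ineq]) (use s in \<open>simp add: norm_mult mult.commute\<close>)
    have "cmod a \<le> (\<Sum>y\<in>X. b x y * cmod (u y))"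
      unfolding a_def by (rule order_trans[OF norm_sum]) (simp add: norm_mult)
    then have 3: "s * cmod a \<le> s * (\<Sum>y\<in>X. b x y * cmod (u y))" using s by (intro mult_left_mono)
    have "m x \<le> cmod (Complex (m x) (s * d))"
      using complex_Re_le_cmod[of "Complex (m x) (s * d)"] by simp
    then have "m x * cmod (u x) \<le> cmod (Complex (m x) (s * d)) * cmod (u x)" by (rule mult_right_mono) simp
    then show ?thesis using 1 2 3 by linarith
  qed
  have "0 \<le> Re (w x) - cmod (u x)"
  proof (rule M_matrix[OF X s])
    fix x assume x: "x \<in> X"
    have "(\<Sum>y\<in>X. b x y * (Re (w y) - cmod (u y))) = (\<Sum>y\<in>X. b x y * Re (w y)) - (\<Sum>y\<in>X. b x y * cmod (u y))"
      by (simp add: right_diff_distrib sum_subtractf)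
    then show "0 \<le> m x * (Re (w x) - cmod (u x)) - s * (\<Sum>y\<in>X. b x y * (Re (w y) - cmod (u y)))"
      using wRe[OF x] um[OF x] by (simp add: right_diff_distrib)
  qed (use w0 u0 in auto)
  then show "cmod (u x) \<le> Re (w x)" by simp
qed

end

section \<open>Resolvents and exponentials in the functional calculus\<close>

definition res :: "real \<Rightarrow> real \<Rightarrow> complex" where "res s \<sigma> = 1 / (1 + \<i> * of_real s * of_real \<sigma>)"

lemma res_denominator: "1 \<le> cmod (1 + \<i> * of_real s * of_real \<sigma>)" "\<bar>s * \<sigma>\<bar> \<le> cmod (1 + \<i> * of_real s * of_real \<sigma>)"
  using abs_Re_le_cmod[of "1 + \<i> * of_real s * of_real \<sigma>"] abs_Im_le_cmod[of "1 + \<i> * of_real s * of_real \<sigma>"]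
  by simp_all

lemma norm_res_le: "cmod (res s \<sigma>) \<le> 1"
  using res_denominator(1)[of s \<sigma>] by (simp add: res_def norm_divide divide_simps)

lemma bounded_res [simp]: "bounded_borel (res s)"
  by (rule bounded_borelI[OF _ norm_res_le]) (unfold res_def, measurable)

lemma bounded_mult_res: assumes "s \<noteq> 0" shows "bounded_borel (\<lambda>\<sigma>. of_real \<sigma> * res s \<sigma>)"
proof (rule bounded_borelI)
  show "cmod (of_real \<sigma> * res s \<sigma>) \<le> 1 / \<bar>s\<bar>" for \<sigma>
    using res_denominator[of s \<sigma>] assms
    by (simp add: res_def norm_mult norm_divide divide_simps abs_mult mult.commute)
qed (unfold res_def, measurable)

text \<open>The function \<open>\<sigma> \<mapsto> 1 / (1 + s \<sigma>)\<close>, cut off below the spectrum of \<open>L\<^sub>0\<close> so that it is bounded.\<close>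

definition pos_res :: "real \<Rightarrow> real \<Rightarrow> real \<Rightarrow> complex" where
  "pos_res C s \<sigma> = (if - C \<le> \<sigma> then of_real (1 / (1 + s * \<sigma>)) else 0)"

lemma
  assumes s: "0 < s" "s * C < 1"
  shows bounded_pos_res: "bounded_borel (pos_res C s)"
    and bounded_mult_pos_res: "bounded_borel (\<lambda>\<sigma>. of_real \<sigma> * pos_res C s \<sigma>)"
    and pos_res_identity: "of_real \<sigma> * pos_res C s \<sigma> + of_real (1 / s) * pos_res C s \<sigma> = of_real (1 / s) * indicator {- C..} \<sigma>"
proof -
  have p: "1 + s * \<sigma> \<ge> 1 - s * C" if "- C \<le> \<sigma>" for \<sigma>
    using mult_left_mono[OF that, of s] s by simp
  have [measurable]: "pos_res C s \<in> borel_measurable borel" unfolding pos_res_def by measurable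
  show b: "bounded_borel (pos_res C s)"
  proof (rule bounded_borelI)
    show "cmod (pos_res C s \<sigma>) \<le> 1 / (1 - s * C)" for \<sigma>
      using p[of \<sigma>] s by (auto simp: pos_res_def norm_divide frac_le simp flip: of_real_add of_real_mult)
  qed measurable
  show id: "of_real \<sigma> * pos_res C s \<sigma> + of_real (1 / s) * pos_res C s \<sigma> = of_real (1 / s) * indicator {- C..} \<sigma>" for \<sigma>
  proof (cases "- C \<le> \<sigma>")
    case True
    then have "1 + s * \<sigma> \<noteq> 0" using p[OF True] s by linarith
    then have "\<sigma> * (1 / (1 + s * \<sigma>)) + 1 / s * (1 / (1 + s * \<sigma>)) = 1 / s"
      using s by (simp add: divide_simps)
    then have "complex_of_real \<sigma> * of_real (1 / (1 + s * \<sigma>)) + of_real (1 / s) * of_real (1 / (1 + s * \<sigma>)) = of_real (1 / s)"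
      by (simp only: of_real_mult[symmetric] of_real_add[symmetric])
    then show ?thesis using True by (simp only: pos_res_def if_True) simp
  qed (simp add: pos_res_def)
  have "(\<lambda>\<sigma>. of_real \<sigma> * pos_res C s \<sigma>) = (\<lambda>\<sigma>. of_real (1 / s) * indicator {- C..} \<sigma> + (- of_real (1 / s)) * pos_res C s \<sigma>)"
  proof
    fix \<sigma>
    have "of_real \<sigma> * pos_res C s \<sigma>
        = (of_real \<sigma> * pos_res C s \<sigma> + of_real (1 / s) * pos_res C s \<sigma>) + (- of_real (1 / s)) * pos_res C s \<sigma>"
      by simp
    then show "of_real \<sigma> * pos_res C s \<sigma> = of_real (1 / s) * indicator {- C..} \<sigma> + (- of_real (1 / s)) * pos_res C s \<sigma>"
      unfolding id .
  qed
  then show "bounded_borel (\<lambda>\<sigma>. of_real \<sigma> * pos_res C s \<sigma>)"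
    by (simp only:) (intro bounded_borel_lin bounded_borel_mult b, auto)
qed

text \<open>The numbers \<open>1 / (1 + i y)\<close> and \<open>exp (- i y)\<close> have modulus at most one and a distance of order \<open>y\<^sup>2\<close>, so
  their \<open>n\<close>-th powers have a distance of order \<open>n y\<^sup>2\<close>; here \<open>y = t \<sigma> / n\<close>.\<close>

lemma res_limit: "(\<lambda>n. res (t / real n) \<sigma> ^ n) \<longlonglongrightarrow> exp (- \<i> * of_real t * of_real \<sigma>)"
proof -
  define a where "a = t * \<sigma>"
  have "cmod (res (t / real n) \<sigma> ^ n - exp (- \<i> * of_real t * of_real \<sigma>)) \<le> a\<^sup>2 / real n" if n: "n > 0" for n
  proof -
    define y where "y = a / real n"
    have r: "res (t / real n) \<sigma> = 1 / (1 + \<i> * of_real y)" by (simp add: res_def y_def a_def)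
    have e: "exp (- \<i> * of_real t * of_real \<sigma>) = exp (- (\<i> * of_real y)) ^ n"
      using n by (simp add: exp_of_nat_mult[symmetric] y_def a_def mult.assoc)
    have nz: "1 + \<i> * of_real y \<noteq> 0" using res_denominator(1)[of 1 y] by auto
    have ne: "cmod (exp (- (\<i> * of_real y))) = 1" by (simp add: norm_exp_eq_Re)
    have "1 / (1 + \<i> * of_real y) - exp (- (\<i> * of_real y))
        = exp (- (\<i> * of_real y)) * (exp (\<i> * of_real y) - (1 + \<i> * of_real y)) / (1 + \<i> * of_real y)"
      using nz by (simp add: right_diff_distrib exp_minus field_simps)
    then have "cmod (1 / (1 + \<i> * of_real y) - exp (- (\<i> * of_real y)))
        = cmod (exp (\<i> * of_real y) - (1 + \<i> * of_real y)) / cmod (1 + \<i> * of_real y)"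
      using ne by (simp add: norm_mult norm_divide)
    also have "\<dots> \<le> cmod (exp (\<i> * of_real y) - (1 + \<i> * of_real y)) / 1"
      using res_denominator(1)[of 1 y] by (intro divide_left_mono) auto
    also have "\<dots> \<le> y\<^sup>2"
    proof -
      have "cmod (exp (\<i> * of_real y) - (1 + \<i> * of_real y)) \<le> y\<^sup>2 / 2"
        using iexp_approx1[of y 1] by (simp add: power2_eq_square)
      then show ?thesis using zero_le_power2[of y] by linarith
    qed
    finally have "cmod (res (t / real n) \<sigma> - exp (- (\<i> * of_real y))) \<le> y\<^sup>2" by (simp only: r)
    then have "real n * cmod (res (t / real n) \<sigma> - exp (- (\<i> * of_real y))) \<le> real n * y\<^sup>2"
      by (rule mult_left_mono) simp
    also have "\<dots> = a\<^sup>2 / real n" using n by (simp add: y_def power2_eq_square)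
    finally have "real n * cmod (res (t / real n) \<sigma> - exp (- (\<i> * of_real y))) \<le> a\<^sup>2 / real n" .
    then show ?thesis unfolding e
      using norm_power_diff[of "res (t / real n) \<sigma>" "exp (- (\<i> * of_real y))" n] norm_res_le[of "t / real n" \<sigma>] ne
      by simp
  qed
  then have "\<forall>\<^sub>F n in sequentially. norm (res (t / real n) \<sigma> ^ n - exp (- \<i> * of_real t * of_real \<sigma>)) \<le> a\<^sup>2 / real n"
    by (auto simp: eventually_sequentially intro!: exI[of _ 1])
  from Lim_null_comparison[OF this lim_const_over_n] show ?thesis by (simp add: LIM_zero_iff)
qed

lemma pos_res_limit: "(\<lambda>n. pos_res C (t / real n) \<sigma> ^ n) \<longlonglongrightarrow> indicator {- C..} \<sigma> * exp (- of_real t * of_real \<sigma>)"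
proof (cases "- C \<le> \<sigma>")
  case True
  have "(\<lambda>n. inverse ((1 + (t * \<sigma>) / real n) ^ n)) \<longlonglongrightarrow> inverse (exp (t * \<sigma>))"
    by (intro tendsto_inverse tendsto_exp_limit_sequentially) simp
  then have "(\<lambda>n. complex_of_real (inverse ((1 + (t * \<sigma>) / real n) ^ n))) \<longlonglongrightarrow> complex_of_real (inverse (exp (t * \<sigma>)))"
    by (rule tendsto_of_real)
  moreover have "pos_res C (t / real n) \<sigma> ^ n = complex_of_real (inverse ((1 + (t * \<sigma>) / real n) ^ n))" for n
    using True by (simp add: pos_res_def divide_inverse power_inverse mult_ac)
  moreover have "complex_of_real (inverse (exp (t * \<sigma>))) = indicator {- C..} \<sigma> * exp (- of_real t * of_real \<sigma>)"
    using True by (simp add: exp_minus exp_of_real flip: of_real_mult)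
  ultimately show ?thesis by simp
next
  case False
  then have "pos_res C (t / real n) \<sigma> ^ n = 0" if "n \<ge> 1" for n
    using that by (simp add: pos_res_def power_0_left)
  then show ?thesis using False
    by (intro tendsto_eventually) (auto simp: eventually_sequentially indicator_def intro!: exI[of _ 1])
qed

lemma norm_pos_res_power_le:
  assumes "0 \<le> t" "0 \<le> C" "2 * (t * C) \<le> real n" "0 < n"
  shows "cmod (pos_res C (t / real n) \<sigma> ^ n) \<le> exp (2 * (t * C))"
proof (cases "- C \<le> \<sigma>")
  case True
  define z where "z = t * C / real n"
  have z: "0 \<le> z" "z \<le> 1 / 2" using assms by (simp_all add: z_def divide_simps)
  \<comment> \<open>For \<open>0 \<le> z \<le> 1/2\<close> one has \<open>1 - z \<ge> exp (- 2 z)\<close>, which bounds the powers independently of \<open>n\<close>.\<close>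
  have "exp (- (2 * z)) \<le> 1 - z"
  proof -
    have "(1 + 2 * z) * (1 - z) = 1 + z * (1 - 2 * z)" by (simp add: algebra_simps)
    also have "\<dots> \<ge> 1" using z by simp
    finally have "1 \<le> (1 + 2 * z) * (1 - z)" .
    also have "\<dots> \<le> exp (2 * z) * (1 - z)" using z exp_ge_add_one_self[of "2 * z"] by (intro mult_right_mono) auto
    finally show ?thesis by (simp add: exp_minus divide_simps mult.commute)
  qed
  also have "1 - z \<le> 1 + t / real n * \<sigma>"
    using mult_left_mono[OF True, of "t / real n"] assms by (simp add: z_def)
  finally have ge: "exp (- (2 * z)) \<le> 1 + t / real n * \<sigma>" .
  then have pos: "0 < 1 + t / real n * \<sigma>" using exp_gt_zero[of "- (2 * z)"] by linarith
  have "1 / (1 + t / real n * \<sigma>) \<le> exp (2 * z)"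
    using ge pos by (simp add: exp_minus field_simps)
  then have "(1 / (1 + t / real n * \<sigma>)) ^ n \<le> exp (2 * z) ^ n" using pos by (intro power_mono) auto
  also have "\<dots> = exp (2 * (t * C))"
    using assms(4) by (simp add: exp_of_nat_mult[symmetric] z_def)
  finally show ?thesis using True pos
    by (simp only: pos_res_def if_True norm_power norm_of_real abs_of_nonneg divide_nonneg_pos zero_le_one)
next
  case False
  then have eq: "pos_res C (t / real n) \<sigma> ^ n = 0" using assms(4) by (simp add: pos_res_def power_0_left)
  show ?thesis unfolding eq by simp
qed

context spectral_calc
begin

lemma calc_cong_AE:
  assumes b: "bounded_borel \<phi>" "bounded_borel \<phi>'" and f: "f \<in> ell2 m"
    and ae: "\<And>f. f \<in> ell2 m \<Longrightarrow> AE s in \<mu> f. \<phi> s = \<phi>' s"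
  shows "calc \<phi> f = calc \<phi>' f"
proof -
  have "(\<integral>s. \<phi> s \<partial>\<mu> h) = (\<integral>s. \<phi>' s \<partial>\<mu> h)" if "h \<in> ell2 m" for h
    using b[THEN bounded_borel_measurable] ae[OF that] by (intro integral_cong_AE) auto
  then show ?thesis unfolding calc_def spectral_pairing_def using f by (simp add: mem)
qed

lemma calc_power:
  assumes b: "bounded_borel \<phi>" and f: "f \<in> ell2 m"
  shows "calc (\<lambda>s. \<phi> s ^ Suc k) f = calc \<phi> (calc (\<lambda>s. \<phi> s ^ k) f)"
  using calc_calc[OF b bounded_borel_power[OF b, of k] f] by simp

text \<open>The function \<open>res s\<close> gives \<open>(1 + i s L)\<^sup>-\<^sup>1\<close>.\<close>

lemma imaginary_resolvent:
  assumes s: "s \<noteq> 0" and f: "f \<in> ell2 m"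
  shows "\<exists>h. (calc (res s) f, h) \<in> spectral_integral m E (\<lambda>s. of_real s) \<and>
    (\<forall>x. calc (res s) f x + \<i> * of_real s * h x = f x)"
proof -
  let ?h = "calc (\<lambda>\<sigma>. of_real \<sigma> * res s \<sigma>) f"
  have "res s \<sigma> + \<i> * of_real s * (of_real \<sigma> * res s \<sigma>) = 1" for \<sigma>
  proof -
    have "1 + \<i> * of_real s * of_real \<sigma> \<noteq> 0" using res_denominator(1)[of s \<sigma>] by auto
    then show ?thesis by (simp add: res_def divide_simps)
  qed
  then have "calc (\<lambda>_. 1) f = (\<lambda>x. calc (res s) f x + \<i> * of_real s * ?h x)"
    using calc_lin_fun[OF bounded_res bounded_mult_res[OF s] f, of s "\<i> * of_real s"] by simp
  then have "\<forall>x. calc (res s) f x + \<i> * of_real s * ?h x = f x"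
    using calc_one[OF f] by (simp add: fun_eq_iff)
  then show ?thesis
    using calc_in_spectral_integral[OF bounded_res bounded_mult_res[OF s] f] by blast
qed

text \<open>On the spectral subspace of \<open>[- N, - C)\<close> the operator is bounded, and \<open>\<langle>L u, u\<rangle> < - C \<parallel>u\<parallel>\<^sup>2\<close> for every nonzero \<open>u\<close> in it.\<close>

lemma spectral_support:
  assumes low: "\<And>u h. (u, h) \<in> spectral_integral m E (\<lambda>s. of_real s) \<Longrightarrow> - C * (ell2_norm m u)\<^sup>2 \<le> Re (ell2_inner m h u)"
    and f: "f \<in> ell2 m"
  shows "AE s in \<mu> f. - C \<le> s"
proof -
  interpret finite_measure "\<mu> f" by (rule finite_\<mu>[OF f])
  have "AE s in \<mu> f. s \<notin> {- real N..<- C}" for N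
  proof -
    let ?B = "{- real N..<- C}"
    let ?i = "\<lambda>s. indicator ?B s :: complex"
    have b: "bounded_borel ?i" by simp
    have sb: "bounded_borel (\<lambda>s. of_real s * ?i s)"
    proof (rule bounded_borelI)
      show "cmod (of_real s * ?i s) \<le> max (real N) \<bar>C\<bar>" for s by (auto simp: indicator_def norm_mult)
    qed measurable
    let ?u = "calc ?i f" and ?h = "calc (\<lambda>s. of_real s * ?i s) f"
    have u: "?u \<in> ell2 m" and h: "?h \<in> ell2 m" using b sb f by (auto intro: calc_mem)
    have int: "integrable (\<mu> f) (\<lambda>s. s * indicator ?B s)"
      by (rule integrable_const_bound[of _ "max (real N) \<bar>C\<bar>"]) (auto simp: indicator_def)
    have int1: "integrable (\<mu> f) (indicat_real ?B)"
      by (rule integrable_const_bound[of _ 1]) (auto simp: indicator_def)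
    have "ell2_inner m ?h ?u = pairing ?i ?h f"
      using calc_adjoint[OF b h f] by (simp add: indicator_def if_distrib[of cnj] of_bool_def cong: if_cong)
    also have "\<dots> = pairing (\<lambda>s. ?i s * (of_real s * ?i s)) f f" by (rule pairing_calc[OF b sb f f])
    also have "\<dots> = (\<integral>s. ?i s * (of_real s * ?i s) \<partial>\<mu> f)" by (rule pairing_self[OF bounded_borel_mult[OF b sb] f])
    also have "\<dots> = (\<integral>s. complex_of_real (s * indicator ?B s) \<partial>\<mu> f)"
      by (rule Bochner_Integration.integral_cong) (auto simp: indicator_def)
    also have "\<dots> = of_real (\<integral>s. s * indicator ?B s \<partial>\<mu> f)" by (rule integral_complex_of_real)
    finally have 1: "Re (ell2_inner m ?h ?u) = (\<integral>s. s * indicator ?B s \<partial>\<mu> f)" by simp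
    have 2: "(ell2_norm m ?u)\<^sup>2 = (\<integral>s. indicator ?B s \<partial>\<mu> f)"
      unfolding norm_calc_sq[OF b f] by (rule Bochner_Integration.integral_cong) (auto simp: indicator_def)
    have "- C * (ell2_norm m ?u)\<^sup>2 \<le> Re (ell2_inner m ?h ?u)"
      by (rule low[OF calc_in_spectral_integral[OF b sb f]])
    then have "0 \<le> (\<integral>s. s * indicator ?B s \<partial>\<mu> f) + C * (\<integral>s. indicator ?B s \<partial>\<mu> f)"
      unfolding 1 2 by simp
    also have "\<dots> = - (\<integral>s. (- C - s) * indicator ?B s \<partial>\<mu> f)"
    proof -
      have "(\<integral>s. (- C - s) * indicator ?B s \<partial>\<mu> f) = (\<integral>s. (- C) * indicator ?B s - s * indicator ?B s \<partial>\<mu> f)"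
        by (simp add: left_diff_distrib)
      also have "\<dots> = - C * (\<integral>s. indicator ?B s \<partial>\<mu> f) - (\<integral>s. s * indicator ?B s \<partial>\<mu> f)"
        by (subst Bochner_Integration.integral_diff) (use int int1 in auto)
      finally show ?thesis by simp
    qed
    finally have le: "(\<integral>s. (- C - s) * indicator ?B s \<partial>\<mu> f) \<le> 0" by simp
    have nn: "AE s in \<mu> f. 0 \<le> (- C - s) * indicator ?B s"
      by (intro AE_I2) (simp add: indicator_def)
    have i: "integrable (\<mu> f) (\<lambda>s. (- C - s) * indicator ?B s)"
      by (rule integrable_const_bound[of _ "real N + \<bar>C\<bar>"]) (auto simp: indicator_def)
    have "(\<integral>s. (- C - s) * indicator ?B s \<partial>\<mu> f) = 0"
      using le integral_nonneg_AE[OF nn] by (rule antisym)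
    then have "AE s in \<mu> f. (- C - s) * indicator ?B s = 0"
      using integral_nonneg_eq_0_iff_AE[OF i nn] by blast
    then show ?thesis by eventually_elim (auto simp: indicator_def split: if_splits)
  qed
  then have "AE s in \<mu> f. \<forall>N. s \<notin> {- real N..<- C}" by (subst AE_all_countable) blast
  then show ?thesis
  proof eventually_elim
    case (elim s)
    obtain N :: nat where "- s \<le> real N" using real_arch_simple by blast
    then show ?case using elim[rule_format, of N] by auto
  qed
qed

text \<open>The functions of interest differ from bounded ones only outside of the spectrum.\<close>

lemma kernel_eq:
  assumes \<phi>: "\<phi> \<in> borel_measurable borel" and b: "bounded_borel \<phi>'"
    and ae: "\<And>f. f \<in> ell2 m \<Longrightarrow> AE s in \<mu> f. \<phi> s = \<phi>' s" and E: "E = spectral_measure m L"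
  shows "integral_kernel m (spectral_calculus m L \<phi>) x y = pairing \<phi>' (delta y) (delta x) / of_real (m x * m y)"
proof -
  have "spectral_calculus m L \<phi> f = calc \<phi>' f" if "f \<in> ell2 m" for f
    unfolding spectral_calculus_def E[symmetric]
    by (rule the_equality) (use that spectral_integral_AE_bounded[OF \<phi> b ae] in auto)
  then show ?thesis by (subst integral_kernel_calc[OF b]) auto
qed

end

section \<open>Comparison of the kernels\<close>

lemma (in closable_lower_bounded) shifted: "C + 1 \<le> c \<Longrightarrow> shifted_form m q C c"
  by unfold_locales

lemma (in weights) cmod_ell2: "f \<in> ell2 m \<Longrightarrow> (\<lambda>x. of_real (cmod (f x))) \<in> ell2 m"
  by (simp add: ell2_def)

lemma step_small:
  fixes s C :: real
  assumes "0 < s" "C + 1 \<le> 1 / s" shows "s * C < 1"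
proof -
  have "s * (C + 1) \<le> s * (1 / s)" using assms by (intro mult_left_mono) auto
  then show ?thesis using assms by (simp add: algebra_simps)
qed

context comparison
begin

text \<open>Domination of \<open>(1 + i s L)\<^sup>-\<^sup>1 f\<close> by \<open>(1 + s L\<^sub>0)\<^sup>-\<^sup>1 |f| = R ((1 / s) |f|)\<close> with \<open>R = (L\<^sub>0 + 1 / s)\<^sup>-\<^sup>1\<close>. The
  finite comparison passes to the limit along the exhaustion, weakly on the left and strongly on the right.\<close>

lemma resolvent_domination:
  assumes s: "0 < s" "C0 + 1 \<le> 1 / s" and f: "f \<in> ell2 m"
    and uh: "(u, h) \<in> Q.L" "\<And>x. u x + \<i> * of_real s * h x = f x"
    and gw: "\<And>x. \<exists>g w. (g, w) \<in> Q.L \<and> (\<forall>z. g z - \<i> * of_real s * w z = delta x z)"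
  defines "P \<equiv> shifted_form.R m q0 (1 / s) (\<lambda>x. of_real (1 / s) * of_real (cmod (f x)))"
  shows "cmod (u x) \<le> Re (P x)" "Im (P x) = 0"
proof -
  interpret S: shifted_form m q C "C + 1" by (rule Q.shifted) simp
  interpret S0: shifted_form m q0 C0 "1 / s" by (rule Q0.shifted[OF s(2)])
  define k where "k = (\<lambda>x. of_real (1 / s) * complex_of_real (cmod (f x)))"
  have k: "k \<in> ell2 m" unfolding k_def by (intro M.scale_mem M.cmod_ell2 f)
  have sC: "s * C0 < 1" by (rule step_small[OF s])
  have "\<forall>n. \<exists>u. u \<in> supported n \<and> (\<forall>g\<in>supported n. ell2_inner m u g + \<i> * of_real s * q u g = ell2_inner m f g)"
    using S.Galerkin_imaginary_solution[OF f, of _ s] by blast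
  then obtain U where U: "\<And>n. U n \<in> supported n"
    "\<And>n g. g \<in> supported n \<Longrightarrow> ell2_inner m (U n) g + \<i> * of_real s * q (U n) g = ell2_inner m f g"
    by metis
  define W where "W n = S0.Rn n k" for n
  have W: "W n \<in> supported n" for n unfolding W_def by (rule S0.Rn_supported[OF k])
  have dom: "cmod (U n x) \<le> Re (W n x)" "Im (W n x) = 0" for n
  proof (atomize (full), rule conjI)
    have ue: "U n z * of_real (m z) + \<i> * of_real s * q (U n) (delta z) = f z * of_real (m z)" if "z \<in> exhaustion n" for z
      using U(2)[OF delta_supported[OF that]] by simp
    have we: "W n z * of_real (m z) + of_real s * q0 (W n) (delta z) = of_real (cmod (f z)) * of_real (m z)" if "z \<in> exhaustion n" for z
    proof -
      have "q0 (W n) (delta z) + of_real (1 / s) * (W n z * of_real (m z)) = k z * of_real (m z)"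
        using S0.Rn_eq[OF k delta_supported[OF that] order_refl] unfolding S0.qc_def W_def by simp
      then have "of_real s * (q0 (W n) (delta z) + of_real (1 / s) * (W n z * of_real (m z))) = of_real s * (k z * of_real (m z))"
        by simp
      then show ?thesis using s by (simp add: k_def distrib_left add.commute)
    qed
    note fd = finite_domination[OF finite_exhaustion less_imp_le[OF s(1)] sC U(1) W ue we]
    show "cmod (U n x) \<le> Re (W n x)" by (rule fd(1))
    show "Im (W n x) = 0" by (rule fd(2))
  qed
  have limU: "(\<lambda>n. U n x) \<longlonglongrightarrow> u x"
  proof -
    obtain g w where "(g, w) \<in> Q.L" "\<And>z. g z - \<i> * of_real s * w z = delta x z" using gw[of x] by blast
    then show ?thesis by (intro S.Galerkin_pointwise[OF f U uh])
  qed
  have limW: "(\<lambda>n. W n x) \<longlonglongrightarrow> P x"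
    unfolding W_def P_def k_def[symmetric]
    by (rule M.tendsto_coordinate[OF S0.Rn_ell2[OF k] S0.R_ell2[OF k] S0.Rn_tendsto[OF k]])
  show "cmod (u x) \<le> Re (P x)"
    by (rule LIMSEQ_le[OF tendsto_norm[OF limU] tendsto_Re[OF limW]]) (use dom in auto)
  have "(\<lambda>n. Im (W n x)) \<longlonglongrightarrow> Im (P x)" by (rule tendsto_Im[OF limW])
  then show "Im (P x) = 0" using dom(2) by (simp add: LIMSEQ_const_iff)
qed

definition "EL = spectral_measure m Q.L"
definition "EL0 = spectral_measure m Q0.L"

lemma EL: "projection_valued_measure m EL" "Q.L = spectral_integral m EL (\<lambda>s. of_real s)"
proof -
  interpret S: shifted_form m q C "C + 1" by (rule Q.shifted) simp
  show "projection_valued_measure m EL" "Q.L = spectral_integral m EL (\<lambda>s. of_real s)"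
    using someI_ex[OF S.L_spectral_measure] unfolding EL_def spectral_measure_def by auto
qed

lemma EL0: "projection_valued_measure m EL0" "Q0.L = spectral_integral m EL0 (\<lambda>s. of_real s)"
proof -
  interpret S: shifted_form m q0 C0 "C0 + 1" by (rule Q0.shifted) simp
  show "projection_valued_measure m EL0" "Q0.L = spectral_integral m EL0 (\<lambda>s. of_real s)"
    using someI_ex[OF S.L_spectral_measure] unfolding EL0_def spectral_measure_def by auto
qed

sublocale X: spectral_calc m EL by unfold_locales (rule EL)
sublocale X0: spectral_calc m EL0 by unfold_locales (rule EL0)

lemma L0_support: "f \<in> ell2 m \<Longrightarrow> AE s in X0.\<mu> f. - C0 \<le> s"
proof -
  interpret S: shifted_form m q0 C0 "C0 + 1" by (rule Q0.shifted) simp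
  show "f \<in> ell2 m \<Longrightarrow> AE s in X0.\<mu> f. - C0 \<le> s"
    by (rule X0.spectral_support) (use S.L_lower EL0(2) in auto)
qed

text \<open>The calculus of \<open>L\<^sub>0\<close> maps into its domain, where the Galerkin resolvent is the only solution operator.\<close>

lemma pos_res_resolvent:
  assumes s: "0 < s" "C0 + 1 \<le> 1 / s" and f: "f \<in> ell2 m"
  shows "X0.calc (pos_res C0 s) f = shifted_form.R m q0 (1 / s) (\<lambda>x. of_real (1 / s) * f x)"
proof -
  interpret S0: shifted_form m q0 C0 "1 / s" by (rule Q0.shifted[OF s(2)])
  have sC: "s * C0 < 1" by (rule step_small[OF s])
  note b = bounded_pos_res[OF s(1) sC] and b' = bounded_mult_pos_res[OF s(1) sC]
  let ?u = "X0.calc (pos_res C0 s) f" and ?h = "X0.calc (\<lambda>\<sigma>. of_real \<sigma> * pos_res C0 s \<sigma>) f"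
  have "(?u, ?h) \<in> Q0.L" unfolding EL0(2) by (rule X0.calc_in_spectral_integral[OF b b' f])
  then obtain k where k: "?u = S0.R k" "?h = (\<lambda>x. k x - of_real (1 / s) * S0.R k x)"
    unfolding S0.L_eq by blast
  have "X0.calc (\<lambda>\<sigma>. of_real (1 / s) * indicator {- C0..} \<sigma>) f = (\<lambda>x. ?h x + of_real (1 / s) * ?u x)"
    using X0.calc_lin_fun[OF b' b f, of "of_real (1 / s)"] by (simp only: pos_res_identity[OF s(1) sC])
  also have "\<dots> = k" unfolding k by simp
  also have "X0.calc (\<lambda>\<sigma>. of_real (1 / s) * indicator {- C0..} \<sigma>) f = X0.calc (\<lambda>_. 0 + of_real (1 / s) * 1) f"
  proof (rule X0.calc_cong_AE[OF _ _ f])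
    show "AE \<sigma> in X0.\<mu> g. of_real (1 / s) * indicator {- C0..} \<sigma> = 0 + of_real (1 / s) * (1::complex)" if "g \<in> ell2 m" for g
      using L0_support[OF that] by eventually_elim simp
  qed (rule bounded_borel_mult, auto)
  also have "\<dots> = (\<lambda>x. X0.calc (\<lambda>_. 0) f x + of_real (1 / s) * f x)"
    by (subst X0.calc_lin_fun) (auto simp: f X0.calc_one)
  also have "X0.calc (\<lambda>_. 0) f = (\<lambda>_. 0)"
    by (simp add: X0.calc_def spectral_pairing_def)
  finally show ?thesis using k(1) by simp
qed

lemma calc_domination:
  assumes s: "0 < s" "C0 + 1 \<le> 1 / s" and f: "f \<in> ell2 m"
  shows "cmod (X.calc (res s) f x) \<le> Re (X0.calc (pos_res C0 s) (\<lambda>x. of_real (cmod (f x))) x)"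
    and "Im (X0.calc (pos_res C0 s) (\<lambda>x. of_real (cmod (f x))) x) = 0"
proof -
  have sn: "s \<noteq> 0" "- s \<noteq> 0" using s by auto
  obtain h where h: "(X.calc (res s) f, h) \<in> Q.L" "\<And>x. X.calc (res s) f x + \<i> * of_real s * h x = f x"
    using X.imaginary_resolvent[OF sn(1) f] unfolding EL(2) by blast
  have g: "\<exists>g w. (g, w) \<in> Q.L \<and> (\<forall>z. g z - \<i> * of_real s * w z = delta x z)" for x
    using X.imaginary_resolvent[OF sn(2) M.delta_ell2, of x] unfolding EL(2) by auto
  note d = resolvent_domination[OF s f h g, of x]
  show "cmod (X.calc (res s) f x) \<le> Re (X0.calc (pos_res C0 s) (\<lambda>x. of_real (cmod (f x))) x)"
    unfolding pos_res_resolvent[OF s M.cmod_ell2[OF f]] by (rule d(1))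
  show "Im (X0.calc (pos_res C0 s) (\<lambda>x. of_real (cmod (f x))) x) = 0"
    unfolding pos_res_resolvent[OF s M.cmod_ell2[OF f]] by (rule d(2))
qed

text \<open>The operator \<open>P = (1 + s L\<^sub>0)\<^sup>-\<^sup>1\<close> preserves positivity, because it dominates. Hence
  \<open>|(1 + i s L)\<^sup>-\<^sup>1 F| \<le> P |F| \<le> P F\<^sub>0\<close> if \<open>|F| \<le> F\<^sub>0\<close>.\<close>

lemma calc_power_domination:
  assumes s: "0 < s" "C0 + 1 \<le> 1 / s"
  shows "cmod (X.calc (\<lambda>\<sigma>. res s \<sigma> ^ k) (delta y) x) \<le> Re (X0.calc (\<lambda>\<sigma>. pos_res C0 s \<sigma> ^ k) (delta y) x)
    \<and> Im (X0.calc (\<lambda>\<sigma>. pos_res C0 s \<sigma> ^ k) (delta y) x) = 0"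
proof (induction k arbitrary: x)
  case 0
  have "cmod (delta y x) \<le> Re (delta y x) \<and> Im (delta y x) = 0" by (simp add: delta_def)
  then show ?case by (simp add: X.calc_one X0.calc_one)
next
  case (Suc k)
  have sC: "s * C0 < 1" by (rule step_small[OF s])
  note b = bounded_pos_res[OF s(1) sC]
  let ?P = "X0.calc (pos_res C0 s)"
  define F where "F = X.calc (\<lambda>\<sigma>. res s \<sigma> ^ k) (delta y)"
  define F0 where "F0 = X0.calc (\<lambda>\<sigma>. pos_res C0 s \<sigma> ^ k) (delta y)"
  have F: "F \<in> ell2 m" unfolding F_def by (intro X.calc_mem bounded_borel_power bounded_res M.delta_ell2)
  have F0: "F0 \<in> ell2 m" unfolding F0_def by (intro X0.calc_mem bounded_borel_power b M.delta_ell2)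
  define A where "A = (\<lambda>x. complex_of_real (cmod (F x)))"
  define D where "D = (\<lambda>x. F0 x - A x)"
  have A: "A \<in> ell2 m" unfolding A_def by (rule M.cmod_ell2[OF F])
  have D: "D \<in> ell2 m" unfolding D_def by (rule M.diff_mem[OF F0 A])
  have "D = (\<lambda>x. complex_of_real (cmod (D x)))"
  proof
    fix x
    have "D x = of_real (Re (F0 x) - cmod (F x))" "0 \<le> Re (F0 x) - cmod (F x)"
      using Suc.IH[of x] unfolding F_def[symmetric] F0_def[symmetric] by (auto simp: D_def A_def complex_eq_iff)
    then show "D x = complex_of_real (cmod (D x))" by (simp only: norm_of_real abs_of_nonneg)
  qed
  then have PD: "0 \<le> Re (?P D x)" "Im (?P D x) = 0"
    using calc_domination[OF s D, of x] norm_ge_zero order_trans by metis+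
  have PA: "cmod (X.calc (res s) F x) \<le> Re (?P A x)" "Im (?P A x) = 0"
    unfolding A_def by (rule calc_domination[OF s F])+
  have "F0 = (\<lambda>x. A x + 1 * D x)" by (simp add: D_def)
  then have "?P F0 = (\<lambda>x. ?P A x + 1 * ?P D x)" using X0.calc_lin[OF b A D, of 1] by simp
  then have "cmod (X.calc (res s) F x) \<le> Re (?P F0 x) \<and> Im (?P F0 x) = 0"
    using PA PD by simp
  then show ?case
    unfolding X.calc_power[OF bounded_res M.delta_ell2] X0.calc_power[OF b M.delta_ell2]
    by (simp add: F_def F0_def)
qed

text \<open>Take \<open>s = t / n\<close> in the domination of the \<open>n\<close>-th powers and let \<open>n\<close> tend to infinity.\<close>

lemma exponential_domination:
  fixes t :: real and x y :: 'x
  assumes t: "0 \<le> t" and C0: "0 \<le> C0"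
  defines "p \<equiv> X.pairing (\<lambda>\<sigma>. exp (- \<i> * of_real t * of_real \<sigma>)) (delta y) (delta x)"
    and "p0 \<equiv> X0.pairing (\<lambda>\<sigma>. indicator {- C0..} \<sigma> * exp (- of_real t * of_real \<sigma>)) (delta y) (delta x)"
  shows "cmod p \<le> Re p0 \<and> Im p0 = 0"
proof (cases "t = 0")
  case True
  have "p0 = X0.pairing (\<lambda>_. 1) (delta y) (delta x)"
  proof -
    have "X0.calc (\<lambda>\<sigma>. indicator {- C0..} \<sigma>) (delta y) = X0.calc (\<lambda>_. 1) (delta y)"
    proof (rule X0.calc_cong_AE[OF _ _ M.delta_ell2])
      show "AE \<sigma> in X0.\<mu> g. indicator {- C0..} \<sigma> = (1::complex)" if "g \<in> ell2 m" for g
        using L0_support[OF that] by eventually_elim simp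
    qed auto
    then show ?thesis
      using X0.calc_inner[OF _ M.delta_ell2 M.delta_ell2, of "\<lambda>\<sigma>. indicator {- C0..} \<sigma>" y x]
        X0.calc_inner[OF _ M.delta_ell2 M.delta_ell2, of "\<lambda>_. 1" y x]
      by (simp add: p0_def True del: M.inner_delta)
  qed
  moreover have "p = X.pairing (\<lambda>_. 1) (delta y) (delta x)" by (simp add: p_def True)
  ultimately have "p = delta y x * of_real (m x)" "p0 = delta y x * of_real (m x)"
    by (simp_all add: X.pairing_one X0.pairing_one)
  then show ?thesis by (simp add: delta_def)
next
  case False
  then have t: "t > 0" using t by simp
  \<comment> \<open>From \<open>n1\<close> on, the step \<open>t / n\<close> is small enough for the resolvent comparison and for the uniform bound.\<close>
  obtain n1 :: nat where n1: "max (t * (C0 + 1)) (2 * (t * C0)) + 1 \<le> real n1" using real_arch_simple by blast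
  define \<psi> where "\<psi> n = (\<lambda>\<sigma>. res (t / real (n + n1)) \<sigma> ^ (n + n1))" for n
  define \<psi>0 where "\<psi>0 n = (\<lambda>\<sigma>. pos_res C0 (t / real (n + n1)) \<sigma> ^ (n + n1))" for n
  have n: "real (n + n1) > 0" "t / real (n + n1) > 0" "C0 + 1 \<le> 1 / (t / real (n + n1))" "2 * (t * C0) \<le> real (n + n1)" for n
  proof -
    have "t * (C0 + 1) + 1 \<le> real n1" "2 * (t * C0) + 1 \<le> real n1" using n1 by linarith+
    then have *: "t * (C0 + 1) + 1 \<le> real (n + n1)" "2 * (t * C0) + 1 \<le> real (n + n1)" by simp_all
    have "0 \<le> t * (C0 + 1)" using t C0 by simp
    then show "real (n + n1) > 0" using * by linarith
    then show "t / real (n + n1) > 0" using t by simp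
    have "t * (C0 + 1) \<le> real (n + n1)" using * by linarith
    then show "C0 + 1 \<le> 1 / (t / real (n + n1))" using t by (simp add: field_simps)
    show "2 * (t * C0) \<le> real (n + n1)" using * by linarith
  qed
  have bres: "bounded_borel (\<psi> n)" for n unfolding \<psi>_def by (intro bounded_borel_power bounded_res)
  have bpos: "bounded_borel (\<psi>0 n)" for n
  proof -
    have "t / real (n + n1) * C0 < 1" by (rule step_small[OF n(2,3)])
    then show ?thesis unfolding \<psi>0_def by (intro bounded_borel_power bounded_pos_res n)
  qed
  have lim: "(\<lambda>n. X.pairing (\<psi> n) (delta y) (delta x)) \<longlonglongrightarrow> p"
    unfolding p_def
  proof (rule X.pairing_lim[OF M.delta_ell2 M.delta_ell2 bres])
    show "bounded_borel (\<lambda>\<sigma>. exp (- \<i> * of_real t * of_real \<sigma>))"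
      by (rule bounded_borelI[of _ 1]) (auto simp: norm_exp_eq_Re)
    show "cmod (\<psi> n \<sigma>) \<le> 1" for n \<sigma>
      unfolding \<psi>_def norm_power by (intro power_le_one norm_res_le) auto
    show "(\<lambda>n. \<psi> n \<sigma>) \<longlonglongrightarrow> exp (- \<i> * of_real t * of_real \<sigma>)" for \<sigma>
      unfolding \<psi>_def by (rule LIMSEQ_ignore_initial_segment[OF res_limit])
  qed
  have lim0: "(\<lambda>n. X0.pairing (\<psi>0 n) (delta y) (delta x)) \<longlonglongrightarrow> p0"
    unfolding p0_def
  proof (rule X0.pairing_lim[OF M.delta_ell2 M.delta_ell2 bpos])
    show "bounded_borel (\<lambda>\<sigma>. indicator {- C0..} \<sigma> * exp (- of_real t * of_real \<sigma>))"
    proof (rule bounded_borelI)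
      show "cmod (indicator {- C0..} \<sigma> * exp (- of_real t * of_real \<sigma>)) \<le> exp (t * C0)" for \<sigma>
        using mult_left_mono[of "- C0" \<sigma> t] t by (auto simp: norm_mult norm_exp_eq_Re indicator_def)
    qed measurable
    show "cmod (\<psi>0 n \<sigma>) \<le> exp (2 * (t * C0))" for n \<sigma>
      unfolding \<psi>0_def using n[of n] t C0 by (intro norm_pos_res_power_le) auto
    show "(\<lambda>n. \<psi>0 n \<sigma>) \<longlonglongrightarrow> indicator {- C0..} \<sigma> * exp (- of_real t * of_real \<sigma>)" for \<sigma>
      unfolding \<psi>0_def by (rule LIMSEQ_ignore_initial_segment[OF pos_res_limit])
  qed
  have cmp: "cmod (X.pairing (\<psi> n) (delta y) (delta x)) \<le> Re (X0.pairing (\<psi>0 n) (delta y) (delta x))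
      \<and> Im (X0.pairing (\<psi>0 n) (delta y) (delta x)) = 0" for n
  proof -
    have "cmod (X.calc (\<psi> n) (delta y) x) \<le> Re (X0.calc (\<psi>0 n) (delta y) x) \<and> Im (X0.calc (\<psi>0 n) (delta y) x) = 0"
      unfolding \<psi>_def \<psi>0_def by (rule calc_power_domination[OF n(2,3)])
    then show ?thesis
      using M.m_pos[of x] by (simp add: X.calc_def X0.calc_def norm_divide divide_le_cancel)
  qed
  have "cmod p \<le> Re p0"
    by (rule LIMSEQ_le[OF tendsto_norm[OF lim] tendsto_Re[OF lim0]]) (use cmp in auto)
  moreover have "Im p0 = 0"
    using tendsto_Im[OF lim0] cmp by (simp add: LIMSEQ_const_iff)
  ultimately show ?thesis by blast
qed

end

theorem corollary4p3:
  fixes b :: "'x::countable \<Rightarrow> 'x \<Rightarrow> real" and m v :: "'x \<Rightarrow> real"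
    and \<theta> :: "'x \<Rightarrow> 'x \<Rightarrow> real" and t :: real and x y :: 'x
  assumes "weighted_graph b m"
    and "magnetic_potential b \<theta>"
    and "semibounded_below m finitely_supported (magnetic_form b m v \<theta>)"
    and "closable_form m finitely_supported (magnetic_form b m v \<theta>)"
    and "semibounded_below m finitely_supported
           (magnetic_form b m (\<lambda>x. - weighted_degree b m x) (\<lambda>_ _. 0))"
    and "closable_form m finitely_supported
           (magnetic_form b m (\<lambda>x. - weighted_degree b m x) (\<lambda>_ _. 0))"
    and "0 \<le> t"
  defines "K \<equiv> integral_kernel m (spectral_calculus m (magnetic_schroedinger b m v \<theta>)
                  (\<lambda>s. exp (- \<i> * of_real t * of_real s)))"
    and "K0 \<equiv> integral_kernel m (spectral_calculus m
                  (magnetic_schroedinger b m (\<lambda>x. - weighted_degree b m x) (\<lambda>_ _. 0))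
                  (\<lambda>s. exp (- of_real t * of_real s)))"
  shows "K0 x y \<in> \<real> \<and> cmod (K x y) \<le> Re (K0 x y)"
proof -
  interpret weights m using assms(1) by unfold_locales (simp add: weighted_graph_def)
  interpret M: magnetic_graph m b v \<theta> using assms(1,2) by unfold_locales
  interpret M0: magnetic_graph m b "\<lambda>x. - weighted_degree b m x" "\<lambda>_ _. 0"
    using assms(1) by unfold_locales (simp_all add: magnetic_potential_def)
  obtain c where c: "\<And>f. f \<in> finitely_supported \<Longrightarrow> c * (ell2_norm m f)\<^sup>2 \<le> Re (magnetic_form b m v \<theta> f f)"
    using assms(3) by (auto simp: semibounded_below_def)
  obtain c0 where c0: "\<And>f. f \<in> finitely_supported \<Longrightarrow>
      c0 * (ell2_norm m f)\<^sup>2 \<le> Re (magnetic_form b m (\<lambda>x. - weighted_degree b m x) (\<lambda>_ _. 0) f f)"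
    using assms(5) by (auto simp: semibounded_below_def)
  define C0 where "C0 = max 0 (- c0)"
  have "- C0 * (ell2_norm m f)\<^sup>2 \<le> c0 * (ell2_norm m f)\<^sup>2" for f
    by (intro mult_right_mono) (auto simp: C0_def)
  then have low0: "- C0 * (ell2_norm m f)\<^sup>2 \<le> Re (magnetic_form b m (\<lambda>x. - weighted_degree b m x) (\<lambda>_ _. 0) f f)"
    if "f \<in> finitely_supported" for f
    using c0[OF that] order_trans by blast
  interpret Q: closable_lower_bounded m "magnetic_form b m v \<theta>" "- c"
    by (rule M.closable_lower_boundedI) (use c assms(4) in auto)
  interpret Q0: closable_lower_bounded m "magnetic_form b m (\<lambda>x. - weighted_degree b m x) (\<lambda>_ _. 0)" C0
    by (rule M0.closable_lower_boundedI) (use low0 assms(6) in auto)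
  interpret comparison m b v \<theta> "- c" C0 by unfold_locales
  have L: "magnetic_schroedinger b m v \<theta> = Q.L"
    "magnetic_schroedinger b m (\<lambda>x. - weighted_degree b m x) (\<lambda>_ _. 0) = Q0.L"
    by (simp_all add: magnetic_schroedinger_def Q.L_def Q0.L_def)
  have K: "K x y = X.pairing (\<lambda>\<sigma>. exp (- \<i> * of_real t * of_real \<sigma>)) (delta y) (delta x) / of_real (m x * m y)"
    unfolding K_def L(1)
    by (rule X.kernel_eq) (auto simp: EL_def norm_exp_eq_Re intro!: bounded_borelI[of _ 1])
  have K0: "K0 x y = X0.pairing (\<lambda>\<sigma>. indicator {- C0..} \<sigma> * exp (- of_real t * of_real \<sigma>)) (delta y) (delta x) / of_real (m x * m y)"
    unfolding K0_def L(2)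
  proof (rule X0.kernel_eq)
    show "bounded_borel (\<lambda>\<sigma>. indicator {- C0..} \<sigma> * exp (- of_real t * of_real \<sigma>))"
    proof (rule bounded_borelI)
      show "cmod (indicator {- C0..} \<sigma> * exp (- of_real t * of_real \<sigma>)) \<le> exp (t * C0)" for \<sigma>
        using mult_left_mono[of "- C0" \<sigma> t] assms(7) by (auto simp: norm_mult norm_exp_eq_Re indicator_def)
    qed measurable
    show "AE s in X0.\<mu> f. exp (- of_real t * of_real s) = indicator {- C0..} s * exp (- of_real t * complex_of_real s)"
      if "f \<in> ell2 m" for f using L0_support[OF that] by eventually_elim simp
  qed (auto simp: EL0_def)
  have dom: "cmod (X.pairing (\<lambda>\<sigma>. exp (- \<i> * of_real t * of_real \<sigma>)) (delta y) (delta x))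
      \<le> Re (X0.pairing (\<lambda>\<sigma>. indicator {- C0..} \<sigma> * exp (- of_real t * of_real \<sigma>)) (delta y) (delta x))"
    "Im (X0.pairing (\<lambda>\<sigma>. indicator {- C0..} \<sigma> * exp (- of_real t * of_real \<sigma>)) (delta y) (delta x)) = 0"
    using exponential_domination[OF assms(7), of y x] by (auto simp: C0_def)
  have mm: "0 < m x * m y" using m_pos by simp
  have "Im (K0 x y) = 0" unfolding K0 Im_divide_of_real using dom(2) by simp
  moreover have "cmod (K x y) \<le> Re (K0 x y)"
    unfolding K K0 Re_divide_of_real norm_divide norm_of_real using dom(1) mm by (simp add: divide_right_mono)
  ultimately show ?thesis by (simp add: complex_is_Real_iff)
qed

end
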